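(* Let $k$ be a field, $Q$ a finite acyclic quiver, $M$ a preprojective $k$-representation of $Q$ and $\underline{\mathbf d}$ a filtration of $\underline{\dim}M$. Take $r\ge0$ such that $(C^+)^rM=0$. Then $\mathrm{Fl}_Q(\underline{\mathbf d},M)$ is non-empty if and only if $(C^+)^r\underline{\mathbf d}=0$ and for every intermediate sequence $w$ of admissible sink reflections $S_w^+\underline{\mathbf d}$ is a filtration of $S_w^+M$. In particular, this depends only on the isomorphism class of $M$ and the filtration $\underline{\mathbf d}$, but not on the choice of $M$ or the field $k$. Moreover, if $k$ is a finite field with $q$ elements, then $\mathrm{Fl}_Q(\underline{\mathbf d},M)$ non-empty implies that $$\#\mathrm{Fl}_Q(\underline{\mathbf d},M)\equiv1\mod q.$$
   Context: Representations are finite-dimensional over $k$; varieties are identified with their sets of $k$-points. A filtration of $M$ (or of $\underline{\dim}M$) is a sequence of dimension vectors $\underline{\mathbf d}=(\underline d^0,\dots,\underline d^\nu)$ with $\underline d^0=0$, $\underline d^l\le\underline d^{l+1}$, $\underline d^\nu=\underline{\dim}M$; it is identified with $(\underline d^1,\dots,\underline d^{\nu-1})$. $\mathrm{Fl}_Q(\underline{\mathbf d},M)$ is the set of flags $(U^0\subset\dots\subset U^\nu=M)$ of subrepresentations with $\underline{\dim}\,U^l=\underline d^l$. With $\langle\underline d,\underline e\rangle=\sum_i d_ie_i-\sum_{\alpha:i\to j}d_ie_j$ and $(\underline d,\underline e)=\langle\underline d,\underline e\rangle+\langle\underline e,\underline d\rangle$, put $\sigma_a\underline d=\underline d-(\underline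 d,\epsilon_a)\epsilon_a$. $\sigma_aQ$ is $Q$ with all arrows at $a$ reversed, $\alpha$ becoming $\alpha^*$. For a sink $a$, $\phi_a^M:\bigoplus_{\alpha:j\to a}M_j\to M_a$ has components $M_\alpha$. $S_a^+M$ is the representation of $\sigma_aQ$ with $(S_a^+M)_i=M_i$ for $i\neq a$, $(S_a^+M)_a=\ker\phi_a^M$, maps $(S_a^+M)_{\alpha^*}$ given by inclusion followed by projection to the summand of $\alpha$, and all other maps unchanged. Reflection of filtrations: define $r_+^0:=0$ and $r_+^l:=\max\{0,(\sigma_a(\underline d^{l-1}-\underline d^l))_a+r_+^{l-1}\}$ for $0<l<\nu$. Then $S_a^+\underline{\mathbf d}:=(\sigma_a\underline d^1+r_+^1\epsilon_a,\dots,\sigma_a\underline d^{\nu-1}+r_+^{\nu-1}\epsilon_a)$. It is a filtration of $S_a^+M$ if this sequence, completed by $0$ at the start and $\underline{\dim}S_a^+M$ at the end, is a filtration. An admissible sequence is a sequence of vertices $(i_1,\dots,i_m)$ such that $i_p$ is a sink of $\sigma_{i_{p-1}}\cdots\sigma_{i_1}Q$ for each $p$; for such $w$, $S_w^+=S_{i_m}^+\circ\dots\circ S_{i_1}^+$ (on representations and on filtrations). Fix an admissible sequence $(a_1,\dots,a_n)$ containing each vertex exactly once (an admissible ordering); $C^+:=S_{a_n}^+\circ\dots\circ S_{a_1}^+$, on representations and on filtrations. On representations $C^+$ does not depend on the ordering. The intermediate sequences $w$ are the initial segments of the $r$-fold repetition of $(a_1,\dots,a_n)$. An indecomposable $M$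 is preprojective if $(C^+)^rM=0$ for some $r\ge0$; a representation is preprojective if it is a direct sum of indecomposable preprojectives. Indecomposable preprojectives are determined up to isomorphism by their dimension vectors, independently of the field; isomorphism classes of preprojective representations over different fields are identified via the multiplicities of these indecomposable summands. *)

theory Defs
  imports
    "HOL-Library.Function_Algebras"
    "HOL-Library.FuncSet"
    "HOL-Library.Multiset"
    "HOL-Number_Theory.Cong"
    "Graph_Theory.Arc_Walk"
begin

text \<open>
  Quivers are the multi-digraphs \<^typ>\<open>('a, 'b) pre_digraph\<close> (vertices of type \<^typ>\<open>'a\<close>, arrows of
  type \<^typ>\<open>'b\<close>).  Scalars come from a type \<^typ>\<open>'k\<close> of class \<^class>\<open>field\<close>; vectors from an
  arbitrary vector space, given by its scalar multiplication
  \<open>s :: 'k \<Rightarrow> 'v \<Rightarrow> 'v\<close> with \<open>vector_space s\<close>.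
\<close>

section \<open>Representations\<close>

text \<open>
  All the spaces of one representation are subspaces of a common vector space; the maps matter
  only on these subspaces, and only values at vertices and arrows of the quiver matter.
\<close>

record ('a, 'b, 'v) qrep =
  space :: "'a \<Rightarrow> 'v set"
  rmap :: "'b \<Rightarrow> 'v \<Rightarrow> 'v"

definition fin_dim_subspace :: "('k::field \<Rightarrow> 'v::ab_group_add \<Rightarrow> 'v) \<Rightarrow> 'v set \<Rightarrow> bool" where
  "fin_dim_subspace s V \<longleftrightarrow>
     module.subspace s V \<and> (\<exists>B. finite B \<and> module.span s B = V)"

definition linear_between ::
  "('k::field \<Rightarrow> 'v::ab_group_add \<Rightarrow> 'v) \<Rightarrow> ('k \<Rightarrow> 'w::ab_group_add \<Rightarrow> 'w) \<Rightarrow>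
   'v set \<Rightarrow> 'w set \<Rightarrow> ('v \<Rightarrow> 'w) \<Rightarrow> bool" where
  "linear_between s t V W f \<longleftrightarrow>
     f ` V \<subseteq> W \<and> (\<forall>x\<in>V. \<forall>y\<in>V. f (x + y) = f x + f y) \<and> (\<forall>c. \<forall>x\<in>V. f (s c x) = t c (f x))"

definition quiver_rep ::
  "('k::field \<Rightarrow> 'v::ab_group_add \<Rightarrow> 'v) \<Rightarrow> ('a, 'b) pre_digraph \<Rightarrow> ('a, 'b, 'v) qrep \<Rightarrow> bool" where
  "quiver_rep s Q M \<longleftrightarrow>
     (\<forall>i\<in>verts Q. fin_dim_subspace s (space M i)) \<and>
     (\<forall>e\<in>arcs Q. linear_between s s (space M (tail Q e)) (space M (head Q e)) (rmap M e))"

definition zero_rep :: "('a, 'b) pre_digraph \<Rightarrow> ('a, 'b, 'v::zero) qrep \<Rightarrow> bool" where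
  "zero_rep Q M \<longleftrightarrow> (\<forall>i\<in>verts Q. space M i = {0})"

definition rep_iso ::
  "('k::field \<Rightarrow> 'v::ab_group_add \<Rightarrow> 'v) \<Rightarrow> ('k \<Rightarrow> 'w::ab_group_add \<Rightarrow> 'w) \<Rightarrow>
   ('a, 'b) pre_digraph \<Rightarrow> ('a, 'b, 'v) qrep \<Rightarrow> ('a, 'b, 'w) qrep \<Rightarrow> bool" where
  "rep_iso s t Q M N \<longleftrightarrow>
     (\<exists>f. (\<forall>i\<in>verts Q. linear_between s t (space M i) (space N i) (f i) \<and>
                         bij_betw (f i) (space M i) (space N i)) \<and>
          (\<forall>e\<in>arcs Q. \<forall>x\<in>space M (tail Q e).
             f (head Q e) (rmap M e x) = rmap N e (f (tail Q e) x)))"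

text \<open>
  A subrepresentation is given by its family of spaces, fixed to be \<^const>\<open>undefined\<close> off the
  vertex set so that equal subrepresentations are equal families and counting is meaningful.
\<close>

definition subrep ::
  "('k::field \<Rightarrow> 'v::ab_group_add \<Rightarrow> 'v) \<Rightarrow> ('a, 'b) pre_digraph \<Rightarrow> ('a, 'b, 'v) qrep \<Rightarrow>
   ('a \<Rightarrow> 'v set) \<Rightarrow> bool" where
  "subrep s Q M U \<longleftrightarrow>
     U \<in> extensional (verts Q) \<and>
     (\<forall>i\<in>verts Q. module.subspace s (U i) \<and> U i \<subseteq> space M i) \<and>
     (\<forall>e\<in>arcs Q. rmap M e ` U (tail Q e) \<subseteq> U (head Q e))"

text \<open>\<open>M\<close> is the (internal) direct sum of the listed subrepresentations; the list may be empty.\<close>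

definition internal_direct_sum ::
  "('k::field \<Rightarrow> 'v::ab_group_add \<Rightarrow> 'v) \<Rightarrow> ('a, 'b) pre_digraph \<Rightarrow> ('a, 'b, 'v) qrep \<Rightarrow>
   ('a \<Rightarrow> 'v set) list \<Rightarrow> bool" where
  "internal_direct_sum s Q M Us \<longleftrightarrow>
     (\<forall>U\<in>set Us. subrep s Q M U) \<and>
     (\<forall>i\<in>verts Q. \<forall>x\<in>space M i.
        \<exists>!xs. length xs = length Us \<and> (\<forall>l<length Us. xs ! l \<in> (Us ! l) i) \<and> sum_list xs = x)"

definition indecomposable ::
  "('k::field \<Rightarrow> 'v::ab_group_add \<Rightarrow> 'v) \<Rightarrow> ('a, 'b) pre_digraph \<Rightarrow> ('a, 'b, 'v) qrep \<Rightarrow> bool" where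
  "indecomposable s Q M \<longleftrightarrow>
     quiver_rep s Q M \<and> \<not> zero_rep Q M \<and>
     (\<forall>U W. internal_direct_sum s Q M [U, W] \<longrightarrow>
        zero_rep Q (M\<lparr>space := U\<rparr>) \<or> zero_rep Q (M\<lparr>space := W\<rparr>))"

section \<open>Dimension vectors, filtrations and flags\<close>

text \<open>
  Dimension vectors take integer values because \<open>\<sigma>\<^sub>a\<close> may produce negative entries.
\<close>

definition dimvec ::
  "('k::field \<Rightarrow> 'v::ab_group_add \<Rightarrow> 'v) \<Rightarrow> ('a, 'b) pre_digraph \<Rightarrow> ('a, 'b, 'v) qrep \<Rightarrow>
   'a \<Rightarrow> int" where
  "dimvec s Q M = (\<lambda>i. if i \<in> verts Q then int (vector_space.dim s (space M i)) else 0)"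

text \<open>
  A filtration \<open>(d\<^sup>0, \<dots>, d\<^sup>\<nu>)\<close> with \<open>\<nu> \<ge> 1\<close> is represented by the list
  \<open>[d\<^sup>1, \<dots>, d\<^sup>\<nu>\<^sup>-\<^sup>1]\<close>; \<open>full_filt\<close> completes it by \<open>d\<^sup>0 = 0\<close> and the final vector.
\<close>

definition full_filt :: "('a \<Rightarrow> int) list \<Rightarrow> ('a \<Rightarrow> int) \<Rightarrow> ('a \<Rightarrow> int) list" where
  "full_filt ds v = 0 # ds @ [v]"

definition is_filtration ::
  "('a, 'b) pre_digraph \<Rightarrow> ('a \<Rightarrow> int) list \<Rightarrow> ('a \<Rightarrow> int) \<Rightarrow> bool" where
  "is_filtration Q ds v \<longleftrightarrow>
     (\<forall>l \<le> length ds. \<forall>i\<in>verts Q. (full_filt ds v ! l) i \<le> (full_filt ds v ! Suc l) i)"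

definition Fl ::
  "('k::field \<Rightarrow> 'v::ab_group_add \<Rightarrow> 'v) \<Rightarrow> ('a, 'b) pre_digraph \<Rightarrow> ('a \<Rightarrow> int) list \<Rightarrow>
   ('a, 'b, 'v) qrep \<Rightarrow> ('a \<Rightarrow> 'v set) list set" where
  "Fl s Q ds M = {Us.
     length Us = length ds + 2 \<and>
     (\<forall>U\<in>set Us. subrep s Q M U) \<and>
     (\<forall>l < length Us. \<forall>i\<in>verts Q.
        dimvec s Q (M\<lparr>space := Us ! l\<rparr>) i = (full_filt ds (dimvec s Q M) ! l) i) \<and>
     (\<forall>l. Suc l < length Us \<longrightarrow> (\<forall>i\<in>verts Q. (Us ! l) i \<subseteq> (Us ! Suc l) i)) \<and>
     last Us = restrict (space M) (verts Q)}"

section \<open>Reflections of quivers and of filtrations\<close>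

definition is_sink :: "('a, 'b) pre_digraph \<Rightarrow> 'a \<Rightarrow> bool" where
  "is_sink Q a \<longleftrightarrow> a \<in> verts Q \<and> out_arcs Q a = {}"

text \<open>The reversed arrow \<open>\<alpha>\<^sup>*\<close> keeps the name \<open>\<alpha>\<close>.\<close>

definition reflect_quiver :: "'a \<Rightarrow> ('a, 'b) pre_digraph \<Rightarrow> ('a, 'b) pre_digraph" where
  "reflect_quiver a Q = Q\<lparr>
     tail := (\<lambda>e. if tail Q e = a \<or> head Q e = a then head Q e else tail Q e),
     head := (\<lambda>e. if tail Q e = a \<or> head Q e = a then tail Q e else head Q e)\<rparr>"

fun admissible_seq :: "('a, 'b) pre_digraph \<Rightarrow> 'a list \<Rightarrow> bool" where
  "admissible_seq Q [] \<longleftrightarrow> True"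
| "admissible_seq Q (a # w) \<longleftrightarrow> is_sink Q a \<and> admissible_seq (reflect_quiver a Q) w"

definition admissible_ordering :: "('a, 'b) pre_digraph \<Rightarrow> 'a list \<Rightarrow> bool" where
  "admissible_ordering Q as \<longleftrightarrow> admissible_seq Q as \<and> distinct as \<and> set as = verts Q"

definition euler_form :: "('a, 'b) pre_digraph \<Rightarrow> ('a \<Rightarrow> int) \<Rightarrow> ('a \<Rightarrow> int) \<Rightarrow> int" where
  "euler_form Q d e = (\<Sum>i\<in>verts Q. d i * e i) - (\<Sum>\<alpha>\<in>arcs Q. d (tail Q \<alpha>) * e (head Q \<alpha>))"

definition sym_euler_form :: "('a, 'b) pre_digraph \<Rightarrow> ('a \<Rightarrow> int) \<Rightarrow> ('a \<Rightarrow> int) \<Rightarrow> int" where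
  "sym_euler_form Q d e = euler_form Q d e + euler_form Q e d"

definition unit_vec :: "'a \<Rightarrow> 'a \<Rightarrow> int" where
  "unit_vec a = (\<lambda>i. if i = a then 1 else 0)"

definition sigma :: "('a, 'b) pre_digraph \<Rightarrow> 'a \<Rightarrow> ('a \<Rightarrow> int) \<Rightarrow> 'a \<Rightarrow> int" where
  "sigma Q a d = (\<lambda>i. d i - sym_euler_form Q d (unit_vec a) * unit_vec a i)"

text \<open>\<open>(0 # ds) ! l\<close> is \<open>d\<^sup>l\<close> for \<open>l < \<nu>\<close>.\<close>

fun r_plus :: "('a, 'b) pre_digraph \<Rightarrow> 'a \<Rightarrow> ('a \<Rightarrow> int) list \<Rightarrow> nat \<Rightarrow> int" where
  "r_plus Q a ds 0 = 0"
| "r_plus Q a ds (Suc l) =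
     max 0 (sigma Q a ((0 # ds) ! l - (0 # ds) ! Suc l) a + r_plus Q a ds l)"

definition reflect_filt ::
  "('a, 'b) pre_digraph \<Rightarrow> 'a \<Rightarrow> ('a \<Rightarrow> int) list \<Rightarrow> ('a \<Rightarrow> int) list" where
  "reflect_filt Q a ds =
     map (\<lambda>l i. sigma Q a ((0 # ds) ! l) i + r_plus Q a ds l * unit_vec a i) [1..<Suc (length ds)]"

fun reflect_filt_seq ::
  "('a, 'b) pre_digraph \<Rightarrow> 'a list \<Rightarrow> ('a \<Rightarrow> int) list \<Rightarrow> ('a \<Rightarrow> int) list" where
  "reflect_filt_seq Q [] ds = ds"
| "reflect_filt_seq Q (a # w) ds = reflect_filt_seq (reflect_quiver a Q) w (reflect_filt Q a ds)"

definition zero_filt :: "('a, 'b) pre_digraph \<Rightarrow> ('a \<Rightarrow> int) list \<Rightarrow> bool" where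
  "zero_filt Q ds \<longleftrightarrow> (\<forall>d\<in>set ds. \<forall>i\<in>verts Q. d i = 0)"

section \<open>Reflection functors\<close>

text \<open>
  Reflection functors can only be iterated on one type of vectors, so that type must contain the
  direct sums of its subspaces over sets of arrows.  This holds for \<^typ>\<open>'b list \<Rightarrow> 'v\<close>: a family
  \<open>(m \<alpha>)\<close> indexed by arrows is encoded as the function mapping the list \<open>\<alpha> # w\<close> to \<open>m \<alpha> w\<close>
  and the empty list to \<open>0\<close>.  A representation in \<^typ>\<open>'v\<close> is first moved to
  \<^typ>\<open>'b list \<Rightarrow> 'v\<close> by the isomorphism \<open>lift_rep\<close> onto functions supported at the empty list.
\<close>

definition pscale :: "('k \<Rightarrow> 'v \<Rightarrow> 'v) \<Rightarrow> 'k \<Rightarrow> ('b list \<Rightarrow> 'v) \<Rightarrow> 'b list \<Rightarrow> 'v" where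
  "pscale s c u = (\<lambda>w. s c (u w))"

lemma vector_space_pscale:
  assumes "vector_space s"
  shows "vector_space (pscale s)"
  using assms unfolding vector_space_def by (auto simp: pscale_def fun_eq_iff)

definition at_Nil :: "'v::zero \<Rightarrow> 'b list \<Rightarrow> 'v" where
  "at_Nil x = (\<lambda>w. if w = [] then x else 0)"

definition lift_rep :: "('a, 'b, 'v::zero) qrep \<Rightarrow> ('a, 'b, 'b list \<Rightarrow> 'v) qrep" where
  "lift_rep M = \<lparr>space = (\<lambda>i. at_Nil ` space M i), rmap = (\<lambda>e u. at_Nil (rmap M e (u [])))\<rparr>"

definition component :: "'b \<Rightarrow> ('b list \<Rightarrow> 'v) \<Rightarrow> 'b list \<Rightarrow> 'v" where
  "component \<alpha> u = (\<lambda>w. u (\<alpha> # w))"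

definition arrow_sum ::
  "'b set \<Rightarrow> ('b \<Rightarrow> ('b list \<Rightarrow> 'v::zero) set) \<Rightarrow> ('b list \<Rightarrow> 'v) set" where
  "arrow_sum A V =
     {u. u [] = 0 \<and> (\<forall>\<alpha>\<in>A. component \<alpha> u \<in> V \<alpha>) \<and> (\<forall>\<alpha>. \<alpha> \<notin> A \<longrightarrow> component \<alpha> u = 0)}"

definition phi ::
  "('a, 'b) pre_digraph \<Rightarrow> 'a \<Rightarrow> ('a, 'b, 'b list \<Rightarrow> 'v::ab_group_add) qrep \<Rightarrow>
   ('b list \<Rightarrow> 'v) \<Rightarrow> 'b list \<Rightarrow> 'v" where
  "phi Q a M u = (\<Sum>\<alpha>\<in>in_arcs Q a. rmap M \<alpha> (component \<alpha> u))"

definition reflect_rep ::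
  "('a, 'b) pre_digraph \<Rightarrow> 'a \<Rightarrow> ('a, 'b, 'b list \<Rightarrow> 'v::ab_group_add) qrep \<Rightarrow>
   ('a, 'b, 'b list \<Rightarrow> 'v) qrep" where
  "reflect_rep Q a M =
     \<lparr>space = (\<lambda>i. if i = a
                   then {u \<in> arrow_sum (in_arcs Q a) (\<lambda>\<alpha>. space M (tail Q \<alpha>)). phi Q a M u = 0}
                   else space M i),
      rmap = (\<lambda>\<alpha>. if \<alpha> \<in> in_arcs Q a then component \<alpha> else rmap M \<alpha>)\<rparr>"

fun reflect_rep_seq ::
  "('a, 'b) pre_digraph \<Rightarrow> 'a list \<Rightarrow> ('a, 'b, 'b list \<Rightarrow> 'v::ab_group_add) qrep \<Rightarrow>
   ('a, 'b, 'b list \<Rightarrow> 'v) qrep" where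
  "reflect_rep_seq Q [] M = M"
| "reflect_rep_seq Q (a # w) M = reflect_rep_seq (reflect_quiver a Q) w (reflect_rep Q a M)"

section \<open>Preprojective representations\<close>

text \<open>
  Here \<open>as\<close> is an admissible ordering of \<open>Q\<close>, so \<open>reflect_rep_seq Q as\<close> is \<open>C\<^sup>+\<close>; it
  can be iterated because reflecting once at every vertex returns \<open>Q\<close>.
\<close>

definition cox_vanishes ::
  "('a, 'b) pre_digraph \<Rightarrow> 'a list \<Rightarrow> nat \<Rightarrow> ('a, 'b, 'v::ab_group_add) qrep \<Rightarrow> bool" where
  "cox_vanishes Q as r M \<longleftrightarrow> zero_rep Q ((reflect_rep_seq Q as ^^ r) (lift_rep M))"

definition indec_preprojective ::
  "('k::field \<Rightarrow> 'v::ab_group_add \<Rightarrow> 'v) \<Rightarrow> ('a, 'b) pre_digraph \<Rightarrow> 'a list \<Rightarrow>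
   ('a, 'b, 'v) qrep \<Rightarrow> bool" where
  "indec_preprojective s Q as M \<longleftrightarrow> indecomposable s Q M \<and> (\<exists>r. cox_vanishes Q as r M)"

definition preprojective_decomp ::
  "('k::field \<Rightarrow> 'v::ab_group_add \<Rightarrow> 'v) \<Rightarrow> ('a, 'b) pre_digraph \<Rightarrow> 'a list \<Rightarrow>
   ('a, 'b, 'v) qrep \<Rightarrow> ('a \<Rightarrow> 'v set) list \<Rightarrow> bool" where
  "preprojective_decomp s Q as M Us \<longleftrightarrow>
     internal_direct_sum s Q M Us \<and> (\<forall>U\<in>set Us. indec_preprojective s Q as (M\<lparr>space := U\<rparr>))"

definition preprojective ::
  "('k::field \<Rightarrow> 'v::ab_group_add \<Rightarrow> 'v) \<Rightarrow> ('a, 'b) pre_digraph \<Rightarrow> 'a list \<Rightarrow>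
   ('a, 'b, 'v) qrep \<Rightarrow> bool" where
  "preprojective s Q as M \<longleftrightarrow> quiver_rep s Q M \<and> (\<exists>Us. preprojective_decomp s Q as M Us)"

text \<open>
  Isomorphism classes of preprojectives over possibly different fields are identified by the
  multiplicities of the indecomposable summands, which are named by their dimension vectors.
\<close>

definition same_multiplicities ::
  "('a, 'b) pre_digraph \<Rightarrow> 'a list \<Rightarrow>
   ('k::field \<Rightarrow> 'v::ab_group_add \<Rightarrow> 'v) \<Rightarrow> ('a, 'b, 'v) qrep \<Rightarrow>
   ('l::field \<Rightarrow> 'w::ab_group_add \<Rightarrow> 'w) \<Rightarrow> ('a, 'b, 'w) qrep \<Rightarrow> bool" where
  "same_multiplicities Q as s M t N \<longleftrightarrow>
     (\<exists>Us Ws. preprojective_decomp s Q as M Us \<and> preprojective_decomp t Q as N Ws \<and>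
        image_mset (\<lambda>U. dimvec s Q (M\<lparr>space := U\<rparr>)) (mset Us) =
        image_mset (\<lambda>W. dimvec t Q (N\<lparr>space := W\<rparr>)) (mset Ws))"

end

theory Submission
  imports Defs
begin

text \<open>
  Fix a sink \<open>a\<close> and compare the flags of type \<open>d\<close> in \<open>M\<close> with the flags of the reflected type \<open>e\<close>
  in \<open>S\<^sub>a\<^sup>+M\<close>.  Both consist of a flag \<open>P\<close> of subspaces away from \<open>a\<close>, where \<open>M\<close> and
  \<open>S\<^sub>a\<^sup>+M\<close> coincide, and of a chain of subspaces at \<open>a\<close>.  Let \<open>I\<^sup>l\<close> and \<open>K\<^sup>l\<close> be the image and the
  kernel of the restriction of \<open>\<phi>\<^sub>a\<close> to the sum of the spaces \<open>P\<^sup>l\<close> over the arrows into \<open>a\<close>.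
  Over a given \<open>P\<close>, the flags in \<open>M\<close> are the chains of subspaces \<open>W\<^sup>l \<supseteq> I\<^sup>l\<close> of the space of \<open>M\<close> at \<open>a\<close>
  with \<open>dim W\<^sup>l = d\<^sup>l\<^sub>a\<close>, and the flags in \<open>S\<^sub>a\<^sup>+M\<close> are the chains of subspaces \<open>W\<^sup>l \<subseteq> K\<^sup>l\<close> with
  \<open>dim W\<^sup>l = e\<^sup>l\<^sub>a\<close>.

  Such chains can be chosen one member at a time, from the top in the first case and from the
  bottom in the second, so they exist as soon as the dimensions allow it.  Over a field with \<open>q\<close>
  elements each choice is made among a number of subspaces that is congruent to 1 modulo \<open>q\<close>
  (\<open>card_subspaces_between_cong_1\<close>).  Hence every non-empty fibre has cardinality 1 modulo \<open>q\<close>.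

  By the rank formula, \<open>dim I\<^sup>l + dim K\<^sup>l\<close> is the sum of the \<open>d\<^sup>l\<^sub>j\<close> over the arrows \<open>j \<rightarrow> a\<close>, so the
  bound \<open>e\<^sup>l\<^sub>a \<le> dim K\<^sup>l\<close> says \<open>dim I\<^sup>l \<le> d\<^sup>l\<^sub>a - r\<^sup>l\<close>, where \<open>r\<^sup>l\<close> is the correction term of the reflected
  filtration.  The spaces \<open>K\<^sup>l\<close> increase with \<open>l\<close>, and the recursion for \<open>r\<^sup>l\<close> is exactly what this
  monotonicity imposes on the defects \<open>d\<^sup>l\<^sub>a - dim I\<^sup>l\<close> once they are non-negative
  (\<open>reflected_bounds_iff\<close>).  So the fibres for \<open>M\<close> and for \<open>S\<^sub>a\<^sup>+M\<close> are non-empty over the same \<open>P\<close>: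
  when \<open>d\<close> is a filtration, one flag set is empty if and only if the other is, and their
  cardinalities agree modulo \<open>q\<close> (\<open>Fl_reflect_sink\<close>).  A non-empty flag set forces its type to
  be a filtration.  Induction along the sequence of reflections leads to the zero
  representation, which has a flag of type \<open>d\<close> only for \<open>d = 0\<close>, and then exactly one.  This
  gives the criterion and the congruence (\<open>Fl_nonempty_iff\<close>).

  Isomorphisms carry flags to flags.  For two representations over different fields, the
  criterion refers only to \<open>d\<close> and to the dimension vectors of the reflected representations.
  Reflection respects direct sums (\<open>splits_reflect\<close>), and by the argument of Bernstein, Gelfand
  and Ponomarev an indecomposable representation either lives at \<open>a\<close> alone and is killed, or is
  sent to an indecomposable one whose dimension vector is obtained by \<open>\<sigma>\<^sub>a\<close> (\<open>indec_reflect\<close>,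
  \<open>dimvec_reflect_indec\<close>).  So these dimension vectors are determined by those of the
  indecomposable summands.
\<close>

section \<open>Finite-dimensional subspaces\<close>

context vector_space
begin

lemma fin_dim_subspace_basis:
  assumes "fin_dim_subspace scale V"
  obtains B where "B \<subseteq> V" "independent B" "span B = V" "finite B" "card B = dim V"
proof -
  obtain S where S: "subspace V" "finite S" "span S = V"
    using assms by (auto simp: fin_dim_subspace_def)
  obtain B where B: "B \<subseteq> S" "independent B" "S \<subseteq> span B"
    using maximal_independent_subset by blast
  have "span B = V"
    using B S by (metis span_mono span_span subset_antisym)
  moreover have "finite B" using B S finite_subset by blast
  moreover have "B \<subseteq> V" using B S span_superset by blast
  ultimately show thesis using that B dim_span_eq_card_independent by metis
qed

lemma fin_dim_subspace_imp_subspace: "fin_dim_subspace scale V \<Longrightarrow> subspace V"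
  by (simp add: fin_dim_subspace_def)

lemma fin_dim_subspace_span: "finite B \<Longrightarrow> fin_dim_subspace scale (span B)"
  by (auto simp: fin_dim_subspace_def)

lemma fin_dim_subspace_mono:
  assumes V: "fin_dim_subspace scale V" and W: "subspace W" "W \<subseteq> V"
  shows "fin_dim_subspace scale W" and "dim W \<le> dim V" and "dim W = dim V \<Longrightarrow> W = V"
proof -
  obtain B where B: "B \<subseteq> V" "independent B" "span B = V" "finite B" "card B = dim V"
    by (rule fin_dim_subspace_basis[OF V])
  obtain C where C: "C \<subseteq> W" "independent C" "W \<subseteq> span C"
    using maximal_independent_subset by blast
  have span_C: "span C = W" using C W span_subspace by blast
  have "finite C \<and> card C \<le> card B"
    using independent_span_bound B C W by blast
  then have fin_C: "finite C" and "card C \<le> dim V" using B by auto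
  moreover have dim_W: "dim W = card C" using span_C C dim_span_eq_card_independent by blast
  ultimately show "dim W \<le> dim V" by simp
  show "fin_dim_subspace scale W" using span_C fin_C W by (auto simp: fin_dim_subspace_def)
  assume eq: "dim W = dim V"
  obtain D where D: "C \<subseteq> D" "D \<subseteq> V" "independent D" "V \<subseteq> span D"
    using maximal_independent_subset_extend[of C V] C W by blast
  have "card D = dim V" using D basis_card_eq_dim by blast
  moreover have "finite D" using independent_span_bound B D by blast
  ultimately have "C = D" using D dim_W eq card_subset_eq by metis
  then show "W = V" using D span_C W by blast
qed

lemma dim_span_insert:
  assumes V: "fin_dim_subspace scale V" and x: "x \<notin> V"
  shows "fin_dim_subspace scale (span (insert x V))" and "dim (span (insert x V)) = Suc (dim V)"
proof -
  obtain B where B: "B \<subseteq> V" "independent B" "span B = V" "finite B" "card B = dim V"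
    by (rule fin_dim_subspace_basis[OF V])
  have "span (insert x V) = span (insert x B)"
  proof -
    have "insert x V \<subseteq> span (insert x B)"
      using B span_mono[of B "insert x B"] span_base[of x "insert x B"] by auto
    moreover have "insert x B \<subseteq> span (insert x V)"
      using B span_superset by blast
    ultimately show ?thesis by (simp add: span_eq)
  qed
  moreover have "independent (insert x B)" using B x independent_insertI by blast
  moreover have "x \<notin> B" using B x by blast
  ultimately show "fin_dim_subspace scale (span (insert x V))" "dim (span (insert x V)) = Suc (dim V)"
    using B dim_span_eq_card_independent[of "insert x B"] fin_dim_subspace_span[of "insert x B"] by auto
qed

lemma span_Int_span_independent:
  assumes B: "finite B" "independent B" and A: "A \<subseteq> B"
  shows "span A \<inter> span (B - A) = {0}"
proof -
  have "x = 0" if x: "x \<in> span A" "x \<in> span (B - A)" for x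
  proof -
    have fin: "finite A" "finite (B - A)" using B(1) A finite_subset by auto
    obtain u v where u: "x = (\<Sum>a\<in>A. scale (u a) a)" and v: "x = (\<Sum>a\<in>B-A. scale (v a) a)"
      using x unfolding span_finite[OF fin(1)] span_finite[OF fin(2)] by (elim imageE)
    define w where "w b = (if b \<in> A then u b else - v b)" for b
    have "(\<Sum>b\<in>B. scale (w b) b) = (\<Sum>b\<in>A. scale (w b) b) + (\<Sum>b\<in>B-A. scale (w b) b)"
      using sum.subset_diff[OF A B(1), of "\<lambda>b. scale (w b) b"] by (simp add: add.commute)
    also have "(\<Sum>b\<in>A. scale (w b) b) = x" by (simp add: w_def u)
    also have "(\<Sum>b\<in>B-A. scale (w b) b) = (\<Sum>b\<in>B-A. - scale (v b) b)"
      by (rule sum.cong) (auto simp: w_def)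
    also have "\<dots> = - x" by (simp add: v sum_negf)
    finally have "(\<Sum>b\<in>B. scale (w b) b) = 0" by simp
    then have w: "w b = 0" if "b \<in> B" for b
      using independentD[OF B(2,1) subset_refl, of w b] that by simp
    have "u a = 0" if "a \<in> A" for a using w[of a] A that by (auto simp: w_def)
    then show "x = 0" by (simp add: u)
  qed
  then show ?thesis using span_zero by blast
qed

lemma dim_zero_space: "dim {0} = 0"
  using dim_span_eq_card_independent[of "{}"] by (simp add: independent_empty)

lemma fin_dim_zero_space: "fin_dim_subspace scale {0}"
  using fin_dim_subspace_span[of "{}"] by simp

lemma dim_eq_0_iff:
  assumes "fin_dim_subspace scale V"
  shows "dim V = 0 \<longleftrightarrow> V = {0}"
  using fin_dim_subspace_mono(3)[OF assms, of "{0}"] dim_zero_space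
    fin_dim_subspace_imp_subspace[OF assms] subspace_0 by (auto simp: subspace_single_0)

end

lemma linear_between_zero:
  assumes "vector_space s" "vector_space t" "linear_between s t V W f" "module.subspace s V"
  shows "f 0 = 0"
proof -
  interpret vs1: vector_space s by fact
  interpret vs2: vector_space t by fact
  have "0 \<in> V" using assms vs1.subspace_0 by blast
  then have "f (0 + 0) = f 0 + f 0" using assms unfolding linear_between_def by blast
  then show ?thesis by simp
qed

text \<open>
  A basis of the kernel is extended to a basis of \<open>V\<close>; the added vectors are mapped to a basis of
  the image.  As \<open>f\<close> is only linear on \<open>V\<close>, it is first replaced by a linear map on the whole
  space that agrees with it there.
\<close>

lemma rank_nullity:
  assumes "vector_space s" "vector_space t" and V: "fin_dim_subspace s V"
    and f: "linear_between s t V W f"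
  shows "fin_dim_subspace t (f ` V)" and "fin_dim_subspace s {x \<in> V. f x = 0}"
    and "vector_space.dim s V = vector_space.dim s {x \<in> V. f x = 0} + vector_space.dim t (f ` V)"
proof -
  interpret vs1: vector_space s by fact
  interpret vs2: vector_space t by fact
  interpret vector_space_pair s t ..
  have subV: "vs1.subspace V" using V vs1.fin_dim_subspace_imp_subspace by blast
  have f_add: "\<And>x y. x \<in> V \<Longrightarrow> y \<in> V \<Longrightarrow> f (x + y) = f x + f y"
    and f_scale: "\<And>c x. x \<in> V \<Longrightarrow> f (s c x) = t c (f x)"
    using f by (auto simp: linear_between_def)
  have f_0: "f 0 = 0" using linear_between_zero assms(1,2) f subV by blast
  show ker: "fin_dim_subspace s {x \<in> V. f x = 0}"
  proof (rule vs1.fin_dim_subspace_mono(1)[OF V])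
    show "vs1.subspace {x \<in> V. f x = 0}"
      using subV f_add f_scale f_0 by (auto simp: vs1.subspace_def)
  qed auto
  then obtain A where A: "A \<subseteq> {x \<in> V. f x = 0}" "vs1.independent A"
      "vs1.span A = {x \<in> V. f x = 0}" "finite A" "card A = vs1.dim {x \<in> V. f x = 0}"
    by (rule vs1.fin_dim_subspace_basis)
  obtain B where B: "A \<subseteq> B" "B \<subseteq> V" "vs1.independent B" "V \<subseteq> vs1.span B"
    using vs1.maximal_independent_subset_extend[of A V] A by blast
  have cardB: "card B = vs1.dim V" using B vs1.basis_card_eq_dim by blast
  have spanB: "vs1.span B = V" using B subV vs1.span_subspace by blast
  have finB: "finite B"
  proof -
    obtain S where "finite S" "vs1.span S = V" using V by (auto simp: fin_dim_subspace_def)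
    then show ?thesis using vs1.independent_span_bound B by blast
  qed
  define g where "g = construct B f"
  have lin: "Vector_Spaces.linear s t g" unfolding g_def using B linear_construct by blast
  have g_eq: "g x = f x" if "x \<in> V" for x
  proof -
    from that have "x \<in> vs1.span B" using spanB by simp
    then have "x \<in> V \<and> g x = f x"
    proof (induction rule: vs1.span_induct_alt)
      case base
      then show ?case using lin f_0 subV by (simp add: vs1.subspace_0 linear_0)
    next
      case (step c b y)
      then have "b \<in> V" "g b = f b" using B by (auto simp: g_def construct_basis)
      with step show ?case
        using lin subV f_add f_scale
        by (simp add: vs1.subspace_add vs1.subspace_scale linear_add linear_scale)
    qed
    then show ?thesis by simp
  qed
  define C where "C = B - A"
  have C: "finite C" "vs1.independent C" "C \<subseteq> V"
    using finB B vs1.independent_mono by (auto simp: C_def)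
  have spanCV: "vs1.span C \<subseteq> V" using C subV vs1.span_minimal by blast
  have gA: "g ` A \<subseteq> {0}" using A g_eq by fastforce
  have img: "f ` V = vs2.span (g ` C)"
  proof -
    have "f ` V = g ` vs1.span B" using spanB g_eq by auto
    also have "\<dots> = vs2.span (g ` B)" using lin linear_span_image by blast
    also have "g ` B = g ` A \<union> g ` C" using B by (auto simp: C_def)
    also have "vs2.span (g ` A \<union> g ` C) = vs2.span (g ` C)"
    proof -
      have "g ` A = {} \<or> g ` A = {0}" using gA by (simp add: subset_singleton_iff)
      then show ?thesis by auto
    qed
    finally show ?thesis .
  qed
  have inj: "inj_on g (vs1.span C)"
  proof -
    have "x = 0" if x: "x \<in> vs1.span C" "g x = 0" for x
    proof -
      have "x \<in> vs1.span A" using x spanCV A g_eq by auto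
      then show ?thesis using x(1) vs1.span_Int_span_independent[OF finB B(3,1)] by (auto simp: C_def)
    qed
    then show ?thesis using linear_inj_on_iff_eq_0[OF lin vs1.subspace_span] by blast
  qed
  have "vs2.independent (g ` C)" using linear_independent_injective_image lin C inj by blast
  moreover have "card (g ` C) = card C"
    using card_image[OF inj_on_subset[OF inj vs1.span_superset]] .
  ultimately have "vs2.dim (f ` V) = card C"
    using img vs2.dim_span_eq_card_independent by metis
  moreover have "card B = card A + card C"
    using B(1) A(4) finB card_mono[OF finB B(1)] by (simp add: C_def card_Diff_subset)
  ultimately show "vs1.dim V = vs1.dim {x \<in> V. f x = 0} + vs2.dim (f ` V)"
    using cardB A by simp
  show "fin_dim_subspace t (f ` V)" using img C vs2.fin_dim_subspace_span by simp
qed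

lemma injective_image_fin_dim:
  assumes "vector_space s" "vector_space t" and V: "fin_dim_subspace s V"
    and f: "linear_between s t V W f" and inj: "inj_on f V"
  shows "fin_dim_subspace t (f ` V)" and "vector_space.dim t (f ` V) = vector_space.dim s V"
proof -
  interpret vs1: vector_space s by fact
  have sub: "vs1.subspace V" using V vs1.fin_dim_subspace_imp_subspace by blast
  then have "0 \<in> V" "f 0 = 0"
    using linear_between_zero[OF assms(1,2) f sub] vs1.subspace_0[OF sub] by auto
  then have "{x \<in> V. f x = 0} = {0}"
    using inj by (auto simp: inj_on_def)
  then show "vector_space.dim t (f ` V) = vector_space.dim s V"
    using rank_nullity(3)[OF assms(1-4)] vs1.dim_zero_space by simp
  show "fin_dim_subspace t (f ` V)" using rank_nullity(1)[OF assms(1-4)] .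
qed

context vector_space
begin

text \<open>
  The rank formula for the projection to \<open>A\<close> along \<open>B\<close>.
\<close>

lemma dim_direct_sum:
  assumes A: "fin_dim_subspace scale A" and B: "fin_dim_subspace scale B" and AB: "A \<inter> B = {0}"
  shows "fin_dim_subspace scale {a + b |a b. a \<in> A \<and> b \<in> B}"
    and "dim {a + b |a b. a \<in> A \<and> b \<in> B} = dim A + dim B"
proof -
  let ?S = "{a + b |a b. a \<in> A \<and> b \<in> B}"
  have sub: "subspace A" "subspace B" using A B fin_dim_subspace_imp_subspace by auto
  obtain X Y where XY: "finite X" "span X = A" "finite Y" "span Y = B"
    using A B by (auto simp: fin_dim_subspace_def)
  have "?S = span (X \<union> Y)" using XY by (simp add: span_Un)
  then show S: "fin_dim_subspace scale ?S" using XY fin_dim_subspace_span by simp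
  define f where "f x = (THE a. a \<in> A \<and> x - a \<in> B)" for x
  have f_eq: "f (a + b) = a" if "a \<in> A" "b \<in> B" for a b
    unfolding f_def
  proof (rule the_equality)
    fix a' assume a': "a' \<in> A \<and> a + b - a' \<in> B"
    have "a - a' \<in> A" using a' that sub subspace_diff by blast
    moreover have "(a + b - a') - b \<in> B" using a' that sub subspace_diff by blast
    ultimately have "a - a' \<in> A \<inter> B" by (simp add: algebra_simps)
    then show "a' = a" using AB by simp
  qed (use that in auto)
  have lin: "linear_between scale scale ?S A f"
    unfolding linear_between_def
  proof (intro conjI ballI allI)
    show "f ` ?S \<subseteq> A" using f_eq by auto
    fix x y assume "x \<in> ?S" "y \<in> ?S"
    then obtain a b a' b' where *: "x = a + b" "a \<in> A" "b \<in> B" "y = a' + b'" "a' \<in> A" "b' \<in> B"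
      by auto
    have "f ((a + a') + (b + b')) = a + a'" using * sub subspace_add f_eq by blast
    then show "f (x + y) = f x + f y" using * f_eq by (simp add: algebra_simps)
  next
    fix c x assume "x \<in> ?S"
    then obtain a b where *: "x = a + b" "a \<in> A" "b \<in> B" by auto
    have "f (scale c a + scale c b) = scale c a" using * sub subspace_scale f_eq by blast
    then show "f (scale c x) = scale c (f x)" using * f_eq by (simp add: scale_right_distrib)
  qed
  have "{x \<in> ?S. f x = 0} = B"
  proof
    show "B \<subseteq> {x \<in> ?S. f x = 0}"
    proof
      fix b assume b: "b \<in> B"
      have "0 \<in> A" using sub subspace_0 by blast
      then have "0 + b \<in> ?S" "f (0 + b) = 0" using b f_eq by blast+
      then show "b \<in> {x \<in> ?S. f x = 0}" by simp
    qed
  qed (use f_eq in auto)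
  moreover have "f ` ?S = A"
  proof
    show "A \<subseteq> f ` ?S"
    proof
      fix a assume a: "a \<in> A"
      have "0 \<in> B" using sub subspace_0 by blast
      then have "a + 0 \<in> ?S" "f (a + 0) = a" using a f_eq by blast+
      then show "a \<in> f ` ?S" by force
    qed
  qed (use f_eq in auto)
  ultimately show "dim ?S = dim A + dim B"
    using rank_nullity(3)[OF vector_space_axioms vector_space_axioms S lin] by simp
qed

lemma subspace_complement:
  assumes V: "fin_dim_subspace scale V" and W: "subspace W" "W \<subseteq> V"
  obtains C where "subspace C" "C \<subseteq> V" "C \<inter> W = {0}" "V = {x + y |x y. x \<in> W \<and> y \<in> C}"
proof -
  have W': "fin_dim_subspace scale W" using fin_dim_subspace_mono V W by blast
  obtain A where A: "A \<subseteq> W" "independent A" "span A = W" "finite A" "card A = dim W"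
    by (rule fin_dim_subspace_basis[OF W'])
  obtain B where B: "A \<subseteq> B" "B \<subseteq> V" "independent B" "V \<subseteq> span B"
    using maximal_independent_subset_extend[of A V] A W by blast
  have subV: "subspace V" using V fin_dim_subspace_imp_subspace by blast
  have spanB: "span B = V" using B subV span_subspace by blast
  have finB: "finite B"
  proof -
    obtain S where "finite S" "span S = V" using V by (auto simp: fin_dim_subspace_def)
    then show ?thesis using independent_span_bound B by blast
  qed
  define C where "C = span (B - A)"
  have 1: "V = {x + y |x y. x \<in> W \<and> y \<in> C}"
    using spanB B A span_Un[of A "B - A"] by (simp add: C_def Un_absorb1)
  have "C \<inter> W = {0}"
    using span_Int_span_independent[OF finB B(3,1)] A(3) by (auto simp: C_def)
  moreover have subC: "subspace C" by (simp add: C_def)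
  moreover have "C \<subseteq> V" using spanB span_mono[of "B - A" B] by (auto simp: C_def)
  ultimately show thesis using that 1 subC by blast
qed

end

section \<open>Counting intermediate subspaces\<close>

definition subspaces_between ::
  "('k::field \<Rightarrow> 'v::ab_group_add \<Rightarrow> 'v) \<Rightarrow> 'v set \<Rightarrow> 'v set \<Rightarrow> int \<Rightarrow> 'v set set" where
  "subspaces_between s A B n =
     {W. module.subspace s W \<and> A \<subseteq> W \<and> W \<subseteq> B \<and> int (vector_space.dim s W) = n}"

context vector_space
begin

lemma subspaces_between_nonempty:
  assumes B: "fin_dim_subspace scale B"
    and A: "subspace A" "A \<subseteq> B" and n: "int (dim A) \<le> n" "n \<le> int (dim B)"
  shows "subspaces_between scale A B n \<noteq> {}"
  using A n
proof (induction "nat n - dim A" arbitrary: A)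
  case 0
  then have "A \<in> subspaces_between scale A B n" by (auto simp: subspaces_between_def)
  then show ?case by blast
next
  case (Suc d)
  have A: "fin_dim_subspace scale A" using fin_dim_subspace_mono(1) B Suc by blast
  have "A \<noteq> B" using Suc by auto
  then obtain x where x: "x \<in> B" "x \<notin> A" using Suc by blast
  let ?A = "span (insert x A)"
  have "?A \<subseteq> B" using x Suc B fin_dim_subspace_imp_subspace by (simp add: span_minimal)
  moreover have dim: "dim ?A = Suc (dim A)" using dim_span_insert[OF A x(2)] by simp
  moreover have "d = nat n - dim ?A" using Suc dim by simp
  moreover have "int (dim ?A) \<le> n" using Suc(2) dim by simp
  ultimately have "subspaces_between scale ?A B n \<noteq> {}"
    using Suc.hyps(1)[of ?A] Suc.prems by auto
  moreover have "A \<subseteq> ?A" using span_superset by blast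
  ultimately show ?case by (auto simp: subspaces_between_def)
qed

lemma finite_subspaces_between: "finite B \<Longrightarrow> finite (subspaces_between scale A B n)"
  by (rule finite_subset[of _ "Pow B"]) (auto simp: subspaces_between_def)

lemma card_span_independent:
  assumes "finite B" "independent B" and fin: "finite (UNIV :: 'a set)"
  shows "finite (span B) \<and> card (span B) = card (UNIV :: 'a set) ^ card B"
  using assms(1,2)
proof (induction B)
  case empty
  then show ?case by simp
next
  case (insert x B)
  then have x: "x \<notin> span B" and B: "independent B"
    using independent_insert[of x B] by (auto split: if_splits)
  have img: "span (insert x B) = (\<lambda>(c, v). scale c x + v) ` (UNIV \<times> span B)"
  proof (intro set_eqI iffI)
    fix y assume "y \<in> span (insert x B)"
    then obtain c where "y - scale c x \<in> span B" using span_breakdown_eq by blast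
    then have "(\<lambda>(c, v). scale c x + v) (c, y - scale c x) \<in> (\<lambda>(c, v). scale c x + v) ` (UNIV \<times> span B)"
      by (intro imageI) auto
    then show "y \<in> (\<lambda>(c, v). scale c x + v) ` (UNIV \<times> span B)" by simp
  next
    fix y assume "y \<in> (\<lambda>(c, v). scale c x + v) ` (UNIV \<times> span B)"
    then obtain c v where "y = scale c x + v" "v \<in> span B" by auto
    then show "y \<in> span (insert x B)" using span_breakdown_eq[of y x B] by (auto intro!: exI[of _ c])
  qed
  have inj: "inj_on (\<lambda>(c, v). scale c x + v) (UNIV \<times> span B)"
  proof (rule inj_onI, clarify)
    fix c v d w assume vw: "v \<in> span B" "w \<in> span B" and eq: "scale c x + v = scale d x + w"
    have e: "scale (c - d) x = w - v" using eq by (simp add: scale_left_diff_distrib algebra_simps)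
    then have "scale (c - d) x \<in> span B" using vw span_diff by simp
    then have "scale (inverse (c - d)) (scale (c - d) x) \<in> span B" by (rule span_scale)
    then have "c - d = 0" using x by (cases "c - d = 0") auto
    then show "c = d \<and> v = w" using eq by simp
  qed
  have "card (span (insert x B)) = card ((UNIV :: 'a set) \<times> span B)"
    unfolding img using card_image[OF inj] .
  also have "\<dots> = card (UNIV :: 'a set) ^ card (insert x B)"
    using insert B by (simp add: card_cartesian_product)
  finally show ?case using img insert B fin by simp
qed

lemma card_fin_dim_subspace:
  assumes "fin_dim_subspace scale V" and "finite (UNIV :: 'a set)"
  shows "finite V" and "card V = card (UNIV :: 'a set) ^ dim V"
proof -
  obtain B where "independent B" "span B = V" "finite B" "card B = dim V"
    using fin_dim_subspace_basis[OF assms(1)] by metis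
  then show "finite V" "card V = card (UNIV :: 'a set) ^ dim V"
    using card_span_independent[of B] assms(2) by auto
qed

lemma field_card_gt_1: "finite (UNIV :: 'a set) \<Longrightarrow> card (UNIV :: 'a set) > 1"
proof -
  assume "finite (UNIV :: 'a set)"
  then have "card {0, 1 :: 'a} \<le> card (UNIV :: 'a set)" by (intro card_mono) auto
  then show ?thesis by simp
qed

text \<open>
  For the minimal subspaces \<open>W\<close> strictly above \<open>A\<close>, the sets \<open>W - A\<close> partition \<open>B - A\<close>.  With \<open>N\<close>
  of them, \<open>a = dim A\<close> and \<open>n = dim B\<close> this gives \<open>q\<^sup>n - q\<^sup>a = N (q\<^sup>a\<^sup>+\<^sup>1 - q\<^sup>a)\<close>, so
  \<open>N (q - 1)\<close> is a power of \<open>q\<close> with positive exponent minus 1, and \<open>N\<close> is 1 modulo \<open>q\<close>.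
\<close>

lemma card_minimal_oversubspaces_cong_1:
  assumes B: "fin_dim_subspace scale B" and A: "subspace A" "A \<subseteq> B" "A \<noteq> B"
    and fin: "finite (UNIV :: 'a set)"
  shows "[card (subspaces_between scale A B (int (Suc (dim A)))) = 1] (mod card (UNIV :: 'a set))"
proof -
  let ?q = "card (UNIV :: 'a set)" and ?S = "subspaces_between scale A B (int (Suc (dim A)))"
  let ?a = "dim A" and ?n = "dim B"
  have A': "fin_dim_subspace scale A" using fin_dim_subspace_mono(1) B A by blast
  have finB: "finite B" and cardB: "card B = ?q ^ ?n" using card_fin_dim_subspace B fin by auto
  have finA: "finite A" and cardA: "card A = ?q ^ ?a" using card_fin_dim_subspace A' fin by auto
  have "?a < ?n" using fin_dim_subspace_mono(2,3)[OF B A(1,2)] A(3) by linarith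
  then obtain d where d: "?n = ?a + Suc d" using less_imp_Suc_add by auto
  let ?g = "\<lambda>x. span (insert x A)"
  have finS: "finite ?S" using finite_subspaces_between[OF finB] .
  have gS: "?g ` (B - A) \<subseteq> ?S"
  proof clarify
    fix x assume x: "x \<in> B" "x \<notin> A"
    have "?g x \<subseteq> B" using x A B fin_dim_subspace_imp_subspace by (simp add: span_minimal)
    then show "?g x \<in> ?S"
      using dim_span_insert[OF A' x(2)] span_superset[of "insert x A"] by (auto simp: subspaces_between_def)
  qed
  have fibre: "{x \<in> B - A. ?g x = W} = W - A" if W: "W \<in> ?S" for W
  proof
    show "{x \<in> B - A. ?g x = W} \<subseteq> W - A" using span_base by fastforce
    show "W - A \<subseteq> {x \<in> B - A. ?g x = W}"
    proof
      fix x assume "x \<in> W - A"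
      then have x: "x \<in> W" "x \<notin> A" by auto
      have W': "subspace W" "A \<subseteq> W" "W \<subseteq> B" "dim W = Suc (dim A)"
        using W by (auto simp: subspaces_between_def)
      have "fin_dim_subspace scale W" using fin_dim_subspace_mono(1)[OF B] W' by blast
      moreover have "?g x \<subseteq> W" using x W' by (simp add: span_minimal)
      moreover have "dim (?g x) = dim W" using dim_span_insert[OF A' x(2)] W' by simp
      ultimately have "?g x = W" using fin_dim_subspace_mono(3)[of W "?g x"] by blast
      then show "x \<in> {x \<in> B - A. ?g x = W}" using x W' by blast
    qed
  qed
  \<comment> \<open>Every vector of \<open>B\<close> outside \<open>A\<close> spans, together with \<open>A\<close>, exactly one minimal oversubspace.\<close>
  have "card (B - A) = (\<Sum>W\<in>?S. \<Sum>x\<in>{x \<in> B - A. ?g x = W}. 1)"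
    using sum.group[OF _ finS gS, of "\<lambda>_. 1::nat"] finB by simp
  also have "\<dots> = (\<Sum>W\<in>?S. card (W - A))"
    using fibre by (intro sum.cong[OF refl]) (simp only: card_eq_sum)
  also have "\<dots> = (\<Sum>W\<in>?S. ?q ^ Suc ?a - ?q ^ ?a)"
  proof (rule sum.cong[OF refl])
    fix W assume W: "W \<in> ?S"
    then have W': "subspace W" "A \<subseteq> W" "W \<subseteq> B" "dim W = Suc (dim A)"
      by (auto simp: subspaces_between_def)
    have "fin_dim_subspace scale W" using fin_dim_subspace_mono(1)[OF B] W' by blast
    then show "card (W - A) = ?q ^ Suc ?a - ?q ^ ?a"
      using card_fin_dim_subspace fin W' cardA finA by (simp add: card_Diff_subset)
  qed
  finally have eq: "?q ^ (?a + Suc d) - ?q ^ ?a = card ?S * (?q ^ Suc ?a - ?q ^ ?a)"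
    using A finA cardA cardB d by (simp add: card_Diff_subset)
  have q: "?q > 1" using field_card_gt_1 fin .
  have "int ?q ^ ?a * (int ?q ^ Suc d - 1) = int ?q ^ ?a * (int (card ?S) * (int ?q - 1))"
  proof -
    have "?q ^ ?a \<le> ?q ^ (?a + Suc d)" "?q ^ ?a \<le> ?q ^ Suc ?a"
      using q by (auto intro!: power_increasing simp del: power_Suc add_Suc_right)
    then have "int ?q ^ (?a + Suc d) - int ?q ^ ?a = int (card ?S) * (int ?q ^ Suc ?a - int ?q ^ ?a)"
      using arg_cong[OF eq, of int] by (simp only: of_nat_diff of_nat_power of_nat_mult)
    then show ?thesis by (simp add: power_add algebra_simps)
  qed
  then have "int ?q ^ Suc d - 1 = int (card ?S) * (int ?q - 1)" using q by simp
  then have "int (card ?S) - 1 = int ?q * (int (card ?S) - int ?q ^ d)" by (simp add: algebra_simps)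
  then have "int ?q dvd int (card ?S) - 1" by simp
  then have "[int (card ?S) = int 1] (mod int ?q)" by (simp add: cong_iff_dvd_diff)
  then show ?thesis by (simp only: cong_int_iff)
qed

text \<open>
  Double counting of the pairs \<open>L \<subseteq> W\<close> with \<open>W\<close> of dimension \<open>n\<close> and \<open>L\<close> minimal above \<open>A\<close>: there
  are 1 modulo \<open>q\<close> spaces \<open>L\<close>, each contained in 1 modulo \<open>q\<close> spaces \<open>W\<close> by induction, and each
  \<open>W\<close> contains 1 modulo \<open>q\<close> spaces \<open>L\<close>.
\<close>

theorem card_subspaces_between_cong_1:
  assumes B: "fin_dim_subspace scale B"
    and A: "subspace A" "A \<subseteq> B" and n: "int (dim A) \<le> n" "n \<le> int (dim B)"
    and fin: "finite (UNIV :: 'a set)"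
  shows "[card (subspaces_between scale A B n) = 1] (mod card (UNIV :: 'a set))"
  using A n
proof (induction "nat n - dim A" arbitrary: A)
  case 0
  have "W = A" if "W \<in> subspaces_between scale A B n" for W
  proof -
    have W: "subspace W" "A \<subseteq> W" "W \<subseteq> B" "dim W = nat n"
      using that by (auto simp: subspaces_between_def)
    have W': "fin_dim_subspace scale W" using fin_dim_subspace_mono(1)[OF B] W by blast
    show ?thesis using fin_dim_subspace_mono(3)[OF W' _ W(2)] 0 W by fastforce
  qed
  moreover have "A \<in> subspaces_between scale A B n" using 0 by (auto simp: subspaces_between_def)
  ultimately have "subspaces_between scale A B n = {A}" by blast
  then show ?case by simp
next
  case (Suc d)
  let ?q = "card (UNIV :: 'a set)"
  let ?S = "subspaces_between scale A B (int (Suc (dim A)))"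
  let ?T = "subspaces_between scale A B n"
  have finB: "finite B" using card_fin_dim_subspace B fin by auto
  have "A \<noteq> B" using Suc by auto
  then have S: "[card ?S = 1] (mod ?q)"
    using card_minimal_oversubspaces_cong_1[OF B] Suc.prems fin by blast
  have up: "{W \<in> ?T. L \<subseteq> W} = subspaces_between scale L B n" if "L \<in> ?S" for L
    using that by (auto simp: subspaces_between_def)
  have down: "{L \<in> ?S. L \<subseteq> W} = subspaces_between scale A W (int (Suc (dim A)))" if "W \<in> ?T" for W
    using that by (auto simp: subspaces_between_def)
  \<comment> \<open>The pairs \<open>L \<subseteq> W\<close>, counted by \<open>L\<close> and by \<open>W\<close>.\<close>
  have "(\<Sum>L\<in>?S. card {W \<in> ?T. L \<subseteq> W}) = (\<Sum>W\<in>?T. card {L \<in> ?S. L \<subseteq> W})"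
    using finite_subspaces_between[OF finB] by (intro sum_multicount_gen) auto
  then have double: "(\<Sum>L\<in>?S. card (subspaces_between scale L B n)) =
      (\<Sum>W\<in>?T. card (subspaces_between scale A W (int (Suc (dim A)))))"
    using up down by simp
  have "[(\<Sum>L\<in>?S. card (subspaces_between scale L B n)) = (\<Sum>L\<in>?S. 1)] (mod ?q)"
  proof (rule cong_sum)
    fix L assume "L \<in> ?S"
    then have "subspace L" "L \<subseteq> B" "dim L = Suc (dim A)" by (auto simp: subspaces_between_def)
    then show "[card (subspaces_between scale L B n) = 1] (mod ?q)"
      using Suc.hyps(1)[of L] Suc.hyps(2) Suc.prems by auto
  qed
  then have l: "[(\<Sum>L\<in>?S. card (subspaces_between scale L B n)) = 1] (mod ?q)"
    using S cong_trans by fastforce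
  have "[(\<Sum>W\<in>?T. card (subspaces_between scale A W (int (Suc (dim A))))) = (\<Sum>W\<in>?T. 1)] (mod ?q)"
  proof (rule cong_sum)
    fix W assume "W \<in> ?T"
    then have W: "subspace W" "W \<subseteq> B" "A \<subseteq> W" "int (dim W) = n" by (auto simp: subspaces_between_def)
    then have "fin_dim_subspace scale W" using fin_dim_subspace_mono(1)[OF B] by blast
    moreover have "A \<noteq> W" using W Suc.hyps(2) by auto
    ultimately show "[card (subspaces_between scale A W (int (Suc (dim A)))) = 1] (mod ?q)"
      using card_minimal_oversubspaces_cong_1[of W A] Suc.prems W fin by blast
  qed
  then have "[(\<Sum>W\<in>?T. card (subspaces_between scale A W (int (Suc (dim A))))) = card ?T] (mod ?q)"
    by simp
  then show ?case using l double cong_sym cong_trans by metis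
qed

end

section \<open>Chains of subspaces\<close>

text \<open>
  Non-emptiness over an arbitrary field and the congruence over a finite field \<open>K\<close> are proved
  together, because both pass through the same sequence of choices.
\<close>

definition one_mod :: "'k set \<Rightarrow> 'x set \<Rightarrow> bool" where
  "one_mod K F \<longleftrightarrow> F \<noteq> {} \<and> (finite K \<longrightarrow> finite F \<and> [card F = 1] (mod card K))"

lemma one_mod_image: "one_mod K F \<Longrightarrow> inj_on f F \<Longrightarrow> one_mod K (f ` F)"
  by (simp add: one_mod_def card_image)

lemma one_mod_Sigma:
  assumes X: "one_mod K X" and F: "\<And>x. x \<in> X \<Longrightarrow> one_mod K (F x)"
  shows "one_mod K (SIGMA x:X. F x)"
  unfolding one_mod_def
proof (intro conjI impI)
  show "(SIGMA x:X. F x) \<noteq> {}" using X F by (auto simp: one_mod_def)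
  assume K: "finite K"
  then have X': "finite X" "[card X = 1] (mod card K)"
    and F': "\<And>x. x \<in> X \<Longrightarrow> finite (F x) \<and> [card (F x) = 1] (mod card K)"
    using X F by (auto simp: one_mod_def)
  show "finite (SIGMA x:X. F x)" using X' F' by simp
  have "[(\<Sum>x\<in>X. card (F x)) = (\<Sum>x\<in>X. 1)] (mod card K)"
    using F' by (intro cong_sum) simp
  then show "[card (SIGMA x:X. F x) = 1] (mod card K)"
    using X' F' by (simp add: card_SigmaI) (rule cong_trans)
qed

lemma card_Sigma_cong_card_nonempty:
  assumes X: "finite X" and K: "finite K" and F: "\<And>x. x \<in> X \<Longrightarrow> F x \<noteq> {} \<Longrightarrow> one_mod K (F x)"
  shows "[card (SIGMA x:X. F x) = card {x \<in> X. F x \<noteq> {}}] (mod card K)"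
proof -
  have F': "finite (F x) \<and> [card (F x) = 1] (mod card K)" if "x \<in> X" "F x \<noteq> {}" for x
    using F[OF that] K by (simp add: one_mod_def)
  have "(SIGMA x:X. F x) = (SIGMA x:{x \<in> X. F x \<noteq> {}}. F x)" by auto
  then have "card (SIGMA x:X. F x) = (\<Sum>x\<in>{x \<in> X. F x \<noteq> {}}. card (F x))"
    using X F' by (simp add: card_SigmaI)
  also have "[\<dots> = (\<Sum>x\<in>{x \<in> X. F x \<noteq> {}}. 1)] (mod card K)"
    using F' by (intro cong_sum) auto
  finally show ?thesis by simp
qed

text \<open>
  The entry of \<open>xs\<close> at an index is the prescribed lower bound \<open>I\<close> and dimension \<open>n\<close> of the
  member there.  The recursion chooses a member after all larger ones, so that its upper bound
  is the next member or, for the last one, the total space \<open>T\<close>.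
\<close>

fun chains_above ::
  "('k::field \<Rightarrow> 'v::ab_group_add \<Rightarrow> 'v) \<Rightarrow> 'v set \<Rightarrow> ('v set \<times> int) list \<Rightarrow> 'v set list set" where
  "chains_above s T [] = {[]}"
| "chains_above s T ((I, n) # xs) =
     (\<lambda>(Ws, W). W # Ws) ` (SIGMA Ws:chains_above s T xs. subspaces_between s I (hd (Ws @ [T])) n)"

text \<open>
  Here \<open>xs\<close> prescribes upper bounds, and a member is chosen after all smaller ones; \<open>B\<close> is the
  previous member.
\<close>

fun chains_below ::
  "('k::field \<Rightarrow> 'v::ab_group_add \<Rightarrow> 'v) \<Rightarrow> 'v set \<Rightarrow> ('v set \<times> int) list \<Rightarrow> 'v set list set" where
  "chains_below s B [] = {[]}"
| "chains_below s B ((K, n) # xs) =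
     (\<lambda>(W, Ws). W # Ws) ` (SIGMA W:subspaces_between s B K n. chains_below s W xs)"

lemma all_less_Suc_iff: "(\<forall>l<Suc n. P l) \<longleftrightarrow> P 0 \<and> (\<forall>l<n. P (Suc l))"
  by (metis less_Suc_eq_0_disj)

lemma chains_above_iff:
  "Ws \<in> chains_above s T xs \<longleftrightarrow> length Ws = length xs \<and>
     (\<forall>l<length xs. Ws ! l \<in> subspaces_between s (fst (xs ! l)) ((Ws @ [T]) ! Suc l) (snd (xs ! l)))"
proof (induction xs arbitrary: Ws)
  case Nil
  then show ?case by auto
next
  case (Cons x xs)
  obtain I n where x: "x = (I, n)" by (cases x)
  show ?case
  proof (cases Ws)
    case Nil
    then show ?thesis by (auto simp: x)
  next
    case (Cons W Ws')
    have hd: "hd (Ws' @ [T]) = (Ws' @ [T]) ! 0" by (cases Ws') auto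
    show ?thesis
      by (auto simp: x Cons Cons.IH all_less_Suc_iff hd image_iff)
  qed
qed

lemma chains_above_subset:
  assumes Ws: "Ws \<in> chains_above s T xs" and l: "l < length Ws"
  shows "Ws ! l \<subseteq> T"
proof -
  have all: "Ws ! l \<subseteq> (Ws @ [T]) ! Suc l" if "l < length Ws" for l
    using Ws that by (auto simp: chains_above_iff subspaces_between_def)
  show ?thesis
    using l
  proof (induction "length Ws - l" arbitrary: l)
    case (Suc k)
    show ?case
    proof (cases "Suc l < length Ws")
      case True
      then have "Ws ! Suc l \<subseteq> T" using Suc by auto
      moreover have "Ws ! l \<subseteq> Ws ! Suc l" using all[OF Suc.prems] True by (simp add: nth_append)
      ultimately show ?thesis by blast
    next
      case False
      then show ?thesis using all[OF Suc.prems] Suc.prems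
        by (simp add: nth_append not_less less_eq_Suc_le)
    qed
  qed simp
qed

lemma chains_below_iff:
  "Ws \<in> chains_below s B xs \<longleftrightarrow> length Ws = length xs \<and>
     (\<forall>l<length xs. Ws ! l \<in> subspaces_between s ((B # Ws) ! l) (fst (xs ! l)) (snd (xs ! l)))"
proof (induction xs arbitrary: Ws B)
  case Nil
  then show ?case by auto
next
  case (Cons x xs)
  obtain I n where x: "x = (I, n)" by (cases x)
  show ?case
  proof (cases Ws)
    case Nil
    then show ?thesis by (auto simp: x)
  next
    case (Cons W Ws')
    show ?thesis
      by (auto simp: x Cons Cons.IH all_less_Suc_iff image_iff)
  qed
qed

context vector_space
begin

lemma one_mod_subspaces_between:
  assumes B: "fin_dim_subspace scale B" and A: "subspace A" "A \<subseteq> B"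
    and n: "int (dim A) \<le> n" "n \<le> int (dim B)"
  shows "one_mod (UNIV :: 'a set) (subspaces_between scale A B n)"
  using subspaces_between_nonempty[OF assms] card_subspaces_between_cong_1[OF assms]
    finite_subspaces_between card_fin_dim_subspace(1)[OF B] by (auto simp: one_mod_def)

lemma one_mod_chains_above:
  assumes T: "fin_dim_subspace scale T"
    and I: "\<forall>l<length xs. subspace (fst (xs ! l)) \<and> fst (xs ! l) \<subseteq> (map fst xs @ [T]) ! Suc l"
    and n: "\<forall>l<length xs. int (dim (fst (xs ! l))) \<le> snd (xs ! l) \<and>
      snd (xs ! l) \<le> (map snd xs @ [int (dim T)]) ! Suc l"
  shows "one_mod (UNIV :: 'a set) (chains_above scale T xs)"
  using I n
proof (induction xs)
  case Nil
  then show ?case by (simp add: one_mod_def)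
next
  case (Cons x xs)
  obtain I n where x: "x = (I, n)" by (cases x)
  let ?C = "chains_above scale T xs"
  have IH: "one_mod (UNIV :: 'a set) ?C" using Cons by (auto simp: all_less_Suc_iff)
  have head: "subspace I" "I \<subseteq> hd (map fst xs @ [T])" "int (dim I) \<le> n"
      "n \<le> hd (map snd xs @ [int (dim T)])"
    using Cons.prems by (auto simp: all_less_Suc_iff x hd_conv_nth)
  have top: "fin_dim_subspace scale (hd (Ws @ [T])) \<and> I \<subseteq> hd (Ws @ [T]) \<and>
      n \<le> int (dim (hd (Ws @ [T])))" if Ws: "Ws \<in> ?C" for Ws
  proof (cases xs)
    case Nil
    then show ?thesis using Ws head T by auto
  next
    case (Cons y ys)
    have "Ws ! l \<subseteq> T" if "l < length Ws" for l
      using chains_above_subset[OF Ws that] .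
    moreover have "length Ws > 0" using Ws Cons by (simp add: chains_above_iff)
    moreover have "Ws ! 0 \<in> subspaces_between scale (fst y) ((Ws @ [T]) ! 1) (snd y)"
      using Ws Cons by (auto simp: chains_above_iff)
    moreover have "I \<subseteq> fst y" "n \<le> snd y" using head Cons by auto
    ultimately show ?thesis
      using fin_dim_subspace_mono(1)[OF T] by (auto simp: subspaces_between_def hd_append hd_conv_nth)
  qed
  have "one_mod (UNIV :: 'a set) (SIGMA Ws:?C. subspaces_between scale I (hd (Ws @ [T])) n)"
    using top head by (intro one_mod_Sigma[OF IH] one_mod_subspaces_between) blast+
  then show ?case
    unfolding x chains_above.simps by (rule one_mod_image) (auto simp: inj_on_def)
qed

lemma one_mod_chains_below:
  assumes B: "subspace B"
    and K: "\<forall>l<length xs. fin_dim_subspace scale (fst (xs ! l)) \<and> (B # map fst xs) ! l \<subseteq> fst (xs ! l)"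
    and n: "\<forall>l<length xs. snd (xs ! l) \<le> int (dim (fst (xs ! l))) \<and>
      (int (dim B) # map snd xs) ! l \<le> snd (xs ! l)"
  shows "one_mod (UNIV :: 'a set) (chains_below scale B xs)"
  using B K n
proof (induction xs arbitrary: B)
  case Nil
  then show ?case by (simp add: one_mod_def)
next
  case (Cons x xs)
  obtain K n where x: "x = (K, n)" by (cases x)
  let ?S = "subspaces_between scale B K n"
  have head: "fin_dim_subspace scale K" "B \<subseteq> K" "int (dim B) \<le> n" "n \<le> int (dim K)"
    and tail: "\<forall>l<length xs. fin_dim_subspace scale (fst (xs ! l)) \<and> (K # map fst xs) ! l \<subseteq> fst (xs ! l)"
      "\<forall>l<length xs. snd (xs ! l) \<le> int (dim (fst (xs ! l))) \<and> (n # map snd xs) ! l \<le> snd (xs ! l)"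
    using Cons.prems by (auto simp: all_less_Suc_iff x)
  have IH: "one_mod (UNIV :: 'a set) (chains_below scale W xs)" if W: "W \<in> ?S" for W
  proof (rule Cons.IH)
    have W': "subspace W" "W \<subseteq> K" "int (dim W) = n" using W by (auto simp: subspaces_between_def)
    then show "subspace W" by simp
    have "(W # map fst xs) ! l \<subseteq> (K # map fst xs) ! l" for l using W'(2) by (cases l) auto
    then show "\<forall>l<length xs. fin_dim_subspace scale (fst (xs ! l)) \<and> (W # map fst xs) ! l \<subseteq> fst (xs ! l)"
      using tail(1) by (meson subset_trans)
    show "\<forall>l<length xs. snd (xs ! l) \<le> int (dim (fst (xs ! l))) \<and> (int (dim W) # map snd xs) ! l \<le> snd (xs ! l)"
      using tail(2) W'(3) by simp
  qed
  have "one_mod (UNIV :: 'a set) (SIGMA W:?S. chains_below scale W xs)"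
    using IH by (rule one_mod_Sigma[OF one_mod_subspaces_between[OF head(1) Cons.prems(1) head(2-4)]])
  then show ?case
    unfolding x chains_below.simps by (rule one_mod_image) (auto simp: inj_on_def)
qed

end

section \<open>Flags of subrepresentations\<close>

abbreviation del_vertex :: "('a, 'b) pre_digraph \<Rightarrow> 'a \<Rightarrow> ('a, 'b) pre_digraph" where
  "del_vertex Q a \<equiv> pre_digraph.del_vert Q a"

lemma dimvec_space_update:
  "i \<in> verts Q \<Longrightarrow> dimvec s Q (M\<lparr>space := U\<rparr>) i = int (vector_space.dim s (U i))"
  by (simp add: dimvec_def)

lemma Fl_iff:
  "Us \<in> Fl s Q ds M \<longleftrightarrow> length Us = length ds + 2 \<and>
     (\<forall>l < length ds + 2. subrep s Q M (Us ! l) \<and>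
        (\<forall>i\<in>verts Q. int (vector_space.dim s ((Us ! l) i)) = (full_filt ds (dimvec s Q M) ! l) i)) \<and>
     (\<forall>l < length ds + 1. \<forall>i\<in>verts Q. (Us ! l) i \<subseteq> (Us ! Suc l) i) \<and>
     Us ! (length ds + 1) = restrict (space M) (verts Q)"
proof (cases "length Us = length ds + 2")
  case True
  then have "last Us = Us ! (length ds + 1)" by (subst last_conv_nth) auto
  moreover have "(\<forall>U\<in>set Us. P U) \<longleftrightarrow> (\<forall>l < length ds + 2. P (Us ! l))" for P
    using True by (simp add: all_set_conv_all_nth)
  moreover have "(\<forall>l. Suc l < length Us \<longrightarrow> P l) \<longleftrightarrow> (\<forall>l < length ds + 1. P l)" for P
    using True by simp
  ultimately show ?thesis
    using True by (auto simp: Fl_def dimvec_space_update)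
next
  case False
  then show ?thesis by (auto simp: Fl_def)
qed

lemma Fl_cong:
  assumes "verts Q = verts Q'" "arcs Q = arcs Q'"
    and "\<And>e. e \<in> arcs Q \<Longrightarrow> tail Q e = tail Q' e \<and> head Q e = head Q' e \<and> rmap M e = rmap M' e"
    and "\<And>i. i \<in> verts Q \<Longrightarrow> space M i = space M' i"
    and "length ds = length ds'"
    and "\<And>l i. l < length ds \<Longrightarrow> i \<in> verts Q \<Longrightarrow> (ds ! l) i = (ds' ! l) i"
  shows "Fl s Q ds M = Fl s Q' ds' M'"
proof (rule set_eqI)
  fix Us
  have "subrep s Q M U = subrep s Q' M' U" for U
    using assms(1-4) by (simp add: subrep_def)
  moreover have "restrict (space M) (verts Q) = restrict (space M') (verts Q')"
    using assms(1,4) by (auto simp: restrict_def fun_eq_iff)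
  moreover have "(full_filt ds (dimvec s Q M) ! l) i = (full_filt ds' (dimvec s Q' M') ! l) i"
    if "l < length ds + 2" "i \<in> verts Q" for l i
    using that assms by (auto simp: full_filt_def nth_Cons nth_append dimvec_def split: nat.splits)
  ultimately show "Us \<in> Fl s Q ds M \<longleftrightarrow> Us \<in> Fl s Q' ds' M'"
    using assms(1,5) by (auto simp: Fl_iff)
qed

lemma Fl_nonempty_imp_is_filtration:
  assumes "vector_space s" and M: "quiver_rep s Q M" and ne: "Fl s Q ds M \<noteq> {}"
  shows "is_filtration Q ds (dimvec s Q M)"
proof -
  interpret vector_space s by fact
  obtain Us where Us: "Us \<in> Fl s Q ds M" using ne by blast
  show ?thesis
    unfolding is_filtration_def
  proof (intro allI impI ballI)
    fix l i assume l: "l \<le> length ds" and i: "i \<in> verts Q"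
    have "subspace ((Us ! l) i)" "subspace ((Us ! Suc l) i)" "(Us ! Suc l) i \<subseteq> space M i"
        "(Us ! l) i \<subseteq> (Us ! Suc l) i"
      using Us l i by (auto simp: Fl_iff subrep_def)
    moreover have "fin_dim_subspace s (space M i)" using M i by (simp add: quiver_rep_def)
    ultimately have "dim ((Us ! l) i) \<le> dim ((Us ! Suc l) i)"
      using fin_dim_subspace_mono(1)[of "space M i" "(Us ! Suc l) i"]
        fin_dim_subspace_mono(2)[of "(Us ! Suc l) i" "(Us ! l) i"] by blast
    then have "int (dim ((Us ! l) i)) \<le> int (dim ((Us ! Suc l) i))" by simp
    then show "(full_filt ds (dimvec s Q M) ! l) i \<le> (full_filt ds (dimvec s Q M) ! Suc l) i"
      using Us l i unfolding Fl_iff by (metis add_2_eq_Suc' le_imp_less_Suc less_SucI Suc_mono)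
  qed
qed

lemma finite_Fl:
  assumes "vector_space s" "finite (UNIV :: 'k::field set)" "finite (verts Q)"
    and M: "quiver_rep (s :: 'k \<Rightarrow> 'v::ab_group_add \<Rightarrow> 'v) Q M"
  shows "finite (Fl s Q ds M)"
proof -
  interpret vector_space s by fact
  let ?F = "PiE (verts Q) (\<lambda>i. Pow (space M i))"
  have "finite (space M i)" if "i \<in> verts Q" for i
    using M that card_fin_dim_subspace(1)[OF _ assms(2)] by (auto simp: quiver_rep_def)
  then have "finite ?F" using assms(3) by (intro finite_PiE) auto
  then have "finite {Us. set Us \<subseteq> ?F \<and> length Us = length ds + 2}"
    by (rule finite_lists_length_eq)
  moreover have "Fl s Q ds M \<subseteq> {Us. set Us \<subseteq> ?F \<and> length Us = length ds + 2}"
    by (auto simp: Fl_def subrep_def PiE_def)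
  ultimately show ?thesis by (rule finite_subset[rotated])
qed

section \<open>Splitting flags at a vertex\<close>

text \<open>
  The possible components at \<open>a\<close> of a flag whose components at the other vertices are \<open>Ps\<close>.
\<close>

definition flags_at ::
  "('k::field \<Rightarrow> 'v::ab_group_add \<Rightarrow> 'v) \<Rightarrow> ('a, 'b) pre_digraph \<Rightarrow> 'a \<Rightarrow> ('a \<Rightarrow> int) list \<Rightarrow>
   ('a, 'b, 'v) qrep \<Rightarrow> ('a \<Rightarrow> 'v set) list \<Rightarrow> 'v set list set" where
  "flags_at s Q a ds M Ps = {Ws. length Ws = length ds + 2 \<and>
     (\<forall>l < length ds + 2.
        module.subspace s (Ws ! l) \<and> Ws ! l \<subseteq> space M a \<and>
        int (vector_space.dim s (Ws ! l)) = (full_filt ds (dimvec s Q M) ! l) a \<and>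
        (\<forall>e\<in>in_arcs Q a. rmap M e ` (Ps ! l) (tail Q e) \<subseteq> Ws ! l) \<and>
        (\<forall>e\<in>out_arcs Q a. rmap M e ` (Ws ! l) \<subseteq> (Ps ! l) (head Q e))) \<and>
     (\<forall>l < length ds + 1. Ws ! l \<subseteq> Ws ! Suc l) \<and>
     Ws ! (length ds + 1) = space M a}"

lemma subrep_fun_upd:
  assumes a: "a \<in> verts Q" and loop: "\<forall>e\<in>arcs Q. tail Q e \<noteq> a \<or> head Q e \<noteq> a"
    and wf: "wf_digraph Q"
    and P: "P \<in> extensional (verts Q - {a})"
  shows "subrep s Q M (P(a := W)) \<longleftrightarrow>
    subrep s (del_vertex Q a) M P \<and> module.subspace s W \<and> W \<subseteq> space M a \<and>
    (\<forall>e\<in>in_arcs Q a. rmap M e ` P (tail Q e) \<subseteq> W) \<and>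
    (\<forall>e\<in>out_arcs Q a. rmap M e ` W \<subseteq> P (head Q e))"
proof -
  have ext: "P(a := W) \<in> extensional (verts Q)" using P a by (auto simp: extensional_def)
  have arcs: "(\<forall>e\<in>arcs Q. rmap M e ` (P(a := W)) (tail Q e) \<subseteq> (P(a := W)) (head Q e)) \<longleftrightarrow>
     (\<forall>e\<in>arcs (del_vertex Q a). rmap M e ` P (tail Q e) \<subseteq> P (head Q e)) \<and>
     (\<forall>e\<in>in_arcs Q a. rmap M e ` P (tail Q e) \<subseteq> W) \<and>
     (\<forall>e\<in>out_arcs Q a. rmap M e ` W \<subseteq> P (head Q e))" (is "?L \<longleftrightarrow> ?A \<and> ?B \<and> ?C")
  proof -
    have split: "arcs Q = arcs (del_vertex Q a) \<union> in_arcs Q a \<union> out_arcs Q a"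
      by (auto simp: pre_digraph.arcs_del_vert)
    have 1: "(\<forall>e\<in>arcs (del_vertex Q a). rmap M e ` (P(a := W)) (tail Q e) \<subseteq> (P(a := W)) (head Q e)) \<longleftrightarrow> ?A"
      by (intro ball_cong refl) (auto simp: pre_digraph.arcs_del_vert)
    have 2: "(\<forall>e\<in>in_arcs Q a. rmap M e ` (P(a := W)) (tail Q e) \<subseteq> (P(a := W)) (head Q e)) \<longleftrightarrow> ?B"
      using loop by (intro ball_cong refl) auto
    have 3: "(\<forall>e\<in>out_arcs Q a. rmap M e ` (P(a := W)) (tail Q e) \<subseteq> (P(a := W)) (head Q e)) \<longleftrightarrow> ?C"
      using loop by (intro ball_cong refl) auto
    show ?thesis by (simp only: split ball_Un 1 2 3 conj_assoc)
  qed
  have "(\<forall>i\<in>verts Q. module.subspace s ((P(a := W)) i) \<and> (P(a := W)) i \<subseteq> space M i) \<longleftrightarrow>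
    (\<forall>i\<in>verts Q - {a}. module.subspace s (P i) \<and> P i \<subseteq> space M i) \<and>
    module.subspace s W \<and> W \<subseteq> space M a"
    using a by auto
  then show ?thesis
    unfolding subrep_def arcs using ext P by (simp add: pre_digraph.verts_del_vert pre_digraph.tail_del_vert pre_digraph.head_del_vert) blast
qed

lemma full_filt_dimvec_del_vertex:
  assumes "i \<in> verts Q - {a}" "l < length ds + 2"
  shows "(full_filt ds (dimvec s (del_vertex Q a) M) ! l) i = (full_filt ds (dimvec s Q M) ! l) i"
  using assms by (auto simp: full_filt_def nth_Cons nth_append dimvec_def pre_digraph.verts_del_vert split: nat.splits)

text \<open>
  As there is no loop at \<open>a\<close>, the condition on an arrow at \<open>a\<close> relates the component at \<open>a\<close> to one
  other component.  So flags are flags on the quiver without \<open>a\<close>, completed at \<open>a\<close>.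
\<close>

lemma flags_split_at_vertex:
  assumes a: "a \<in> verts Q" and loop: "\<forall>e\<in>arcs Q. tail Q e \<noteq> a \<or> head Q e \<noteq> a"
    and wf: "wf_digraph Q"
  shows "bij_betw (\<lambda>(Ps, Ws). map2 (\<lambda>P W. P(a := W)) Ps Ws)
     (SIGMA Ps:Fl s (del_vertex Q a) ds M. flags_at s Q a ds M Ps) (Fl s Q ds M)"
proof -
  let ?f = "\<lambda>(Ps, Ws). map2 (\<lambda>P W. P(a := W)) Ps Ws"
  let ?g = "\<lambda>Us. (map (\<lambda>U. restrict U (verts Q - {a})) Us, map (\<lambda>U. U a) Us)"
  let ?X = "SIGMA Ps:Fl s (del_vertex Q a) ds M. flags_at s Q a ds M Ps"
  let ?n = "length ds"
  have key: "?f (Ps, Ws) \<in> Fl s Q ds M \<longleftrightarrow> (Ps, Ws) \<in> ?X"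
    if len: "length Ps = ?n + 2" "length Ws = ?n + 2"
      and ext: "\<forall>l < ?n + 2. Ps ! l \<in> extensional (verts Q - {a})" for Ps Ws
  proof -
    have nth: "?f (Ps, Ws) ! l = (Ps ! l)(a := Ws ! l)" if "l < ?n + 2" for l using that len by simp
    have D: "(\<forall>i\<in>verts Q. int (vector_space.dim s (((Ps ! l)(a := Ws ! l)) i)) = (full_filt ds (dimvec s Q M) ! l) i)
        \<longleftrightarrow> (\<forall>i\<in>verts Q - {a}. int (vector_space.dim s ((Ps ! l) i)) =
              (full_filt ds (dimvec s (del_vertex Q a) M) ! l) i) \<and>
            int (vector_space.dim s (Ws ! l)) = (full_filt ds (dimvec s Q M) ! l) a"
      if "l < ?n + 2" for l
    proof -
      have "(full_filt ds (dimvec s (del_vertex Q a) M) ! l) i = (full_filt ds (dimvec s Q M) ! l) i"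
        if "i \<in> verts Q - {a}" for i
        using full_filt_dimvec_del_vertex[OF that \<open>l < ?n + 2\<close>] .
      then show ?thesis using a by auto
    qed
    have S: "(\<forall>i\<in>verts Q. ((Ps ! l)(a := Ws ! l)) i \<subseteq> ((Ps ! Suc l)(a := Ws ! Suc l)) i) \<longleftrightarrow>
        (\<forall>i\<in>verts Q - {a}. (Ps ! l) i \<subseteq> (Ps ! Suc l) i) \<and> Ws ! l \<subseteq> Ws ! Suc l" for l
      using a by auto
    have L: "(Ps ! (?n + 1))(a := Ws ! (?n + 1)) = restrict (space M) (verts Q) \<longleftrightarrow>
        Ps ! (?n + 1) = restrict (space M) (verts Q - {a}) \<and> Ws ! (?n + 1) = space M a"
    proof -
      have "Ps ! (?n + 1) \<in> extensional (verts Q - {a})" using ext by simp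
      then show ?thesis using a by (force simp: fun_eq_iff extensional_def restrict_def)
    qed
    define A where "A l \<longleftrightarrow> subrep s (del_vertex Q a) M (Ps ! l) \<and>
      (\<forall>i\<in>verts Q - {a}. int (vector_space.dim s ((Ps ! l) i)) =
         (full_filt ds (dimvec s (del_vertex Q a) M) ! l) i)" for l
    define B where "B l \<longleftrightarrow> module.subspace s (Ws ! l) \<and> Ws ! l \<subseteq> space M a \<and>
        int (vector_space.dim s (Ws ! l)) = (full_filt ds (dimvec s Q M) ! l) a \<and>
        (\<forall>e\<in>in_arcs Q a. rmap M e ` (Ps ! l) (tail Q e) \<subseteq> Ws ! l) \<and>
        (\<forall>e\<in>out_arcs Q a. rmap M e ` (Ws ! l) \<subseteq> (Ps ! l) (head Q e))" for l
    define C where "C l \<longleftrightarrow> (\<forall>i\<in>verts Q - {a}. (Ps ! l) i \<subseteq> (Ps ! Suc l) i)" for l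
    \<comment> \<open>The conditions at one index separate into conditions away from \<open>a\<close> and conditions at \<open>a\<close>.\<close>
    have AB: "subrep s Q M ((Ps ! l)(a := Ws ! l)) \<and>
        (\<forall>i\<in>verts Q. int (vector_space.dim s (((Ps ! l)(a := Ws ! l)) i)) = (full_filt ds (dimvec s Q M) ! l) i)
        \<longleftrightarrow> A l \<and> B l" if l: "l < ?n + 2" for l
      unfolding D[OF l] A_def B_def subrep_fun_upd[OF a loop wf ext[rule_format, OF l]]
      by (intro iffI; elim conjE; intro conjI; assumption)
    have "?f (Ps, Ws) \<in> Fl s Q ds M \<longleftrightarrow>
      (\<forall>l < ?n + 2. subrep s Q M ((Ps ! l)(a := Ws ! l)) \<and>
        (\<forall>i\<in>verts Q. int (vector_space.dim s (((Ps ! l)(a := Ws ! l)) i)) = (full_filt ds (dimvec s Q M) ! l) i)) \<and>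
     (\<forall>l < ?n + 1. \<forall>i\<in>verts Q. ((Ps ! l)(a := Ws ! l)) i \<subseteq> ((Ps ! Suc l)(a := Ws ! Suc l)) i) \<and>
     (Ps ! (?n + 1))(a := Ws ! (?n + 1)) = restrict (space M) (verts Q)"
      unfolding Fl_iff using len nth by simp
    also have "\<dots> \<longleftrightarrow> (\<forall>l < ?n + 2. A l \<and> B l) \<and> (\<forall>l < ?n + 1. C l \<and> Ws ! l \<subseteq> Ws ! Suc l) \<and>
       Ps ! (?n + 1) = restrict (space M) (verts Q - {a}) \<and> Ws ! (?n + 1) = space M a"
      using AB unfolding S L C_def by (simp cong: conj_cong)
    also have "\<dots> \<longleftrightarrow> ((\<forall>l < ?n + 2. A l) \<and> (\<forall>l < ?n + 1. C l) \<and>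
         Ps ! (?n + 1) = restrict (space M) (verts Q - {a})) \<and>
       ((\<forall>l < ?n + 2. B l) \<and> (\<forall>l < ?n + 1. Ws ! l \<subseteq> Ws ! Suc l) \<and> Ws ! (?n + 1) = space M a)"
      by (intro iffI conjI allI impI; elim conjE; simp)
    also have "\<dots> \<longleftrightarrow> (Ps, Ws) \<in> ?X"
      using len unfolding mem_Sigma_iff Fl_iff flags_at_def mem_Collect_eq A_def B_def C_def
      by (simp add: pre_digraph.verts_del_vert)
    finally show ?thesis .
  qed
  have restr: "restrict U (verts Q - {a}) \<in> extensional (verts Q - {a})" for U :: "'a \<Rightarrow> 'c set"
    by (auto simp: extensional_def)
  have glue: "(restrict U (verts Q - {a}))(a := U a) = U" if "U \<in> extensional (verts Q)" for U :: "'a \<Rightarrow> 'c set"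
    using that by (auto simp: fun_eq_iff extensional_def restrict_def)
  have fg: "?f (?g Us) = Us" if "Us \<in> Fl s Q ds M" for Us
  proof (rule nth_equalityI)
    fix l assume "l < length (?f (?g Us))"
    then have l: "l < length Us" by simp
    then have "Us ! l \<in> extensional (verts Q)" using that by (auto simp: Fl_iff subrep_def)
    then show "?f (?g Us) ! l = Us ! l" using l glue by simp
  qed simp
  have gf: "?g (?f (Ps, Ws)) = (Ps, Ws)" and len: "length Ps = ?n + 2" "length Ws = ?n + 2"
    and ext: "\<forall>l < ?n + 2. Ps ! l \<in> extensional (verts Q - {a})" if "(Ps, Ws) \<in> ?X" for Ps Ws
  proof -
    show len: "length Ps = ?n + 2" "length Ws = ?n + 2" using that by (auto simp: Fl_iff flags_at_def)
    show ext: "\<forall>l < ?n + 2. Ps ! l \<in> extensional (verts Q - {a})"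
      using that by (auto simp: Fl_iff subrep_def pre_digraph.verts_del_vert)
    have "restrict ((Ps ! l)(a := Ws ! l)) (verts Q - {a}) = Ps ! l" if "l < ?n + 2" for l
      using ext that by (auto simp: fun_eq_iff extensional_def restrict_def)
    then have "map (\<lambda>U. restrict U (verts Q - {a})) (?f (Ps, Ws)) = Ps"
      using len by (intro nth_equalityI) auto
    moreover have "map (\<lambda>U. U a) (?f (Ps, Ws)) = Ws"
      using len by (intro nth_equalityI) auto
    ultimately show "?g (?f (Ps, Ws)) = (Ps, Ws)" by blast
  qed
  show ?thesis
  proof (rule bij_betw_byWitness[where f' = ?g])
    show "\<forall>x\<in>?X. ?g (?f x) = x" using gf by (metis (no_types, lifting) surj_pair)
    show "\<forall>Us\<in>Fl s Q ds M. ?f (?g Us) = Us" using fg by blast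
    show "?f ` ?X \<subseteq> Fl s Q ds M" using key len ext by (metis (no_types, lifting) image_subsetI surj_pair)
    show "?g ` Fl s Q ds M \<subseteq> ?X"
    proof
      fix x assume "x \<in> ?g ` Fl s Q ds M"
      then obtain Us where Us: "Us \<in> Fl s Q ds M" and x: "x = ?g Us" by blast
      have "length Us = ?n + 2" using Us by (simp add: Fl_iff)
      then show "x \<in> ?X"
        unfolding x using Us fg[OF Us] restr by (subst key[symmetric]) auto
    qed
  qed
qed

section \<open>Direct sums over arrows\<close>

text \<open>
  The inclusion of the summand of \<open>\<alpha>\<close> into a direct sum over arrows, in the encoding used by
  \<open>arrow_sum\<close>.
\<close>

definition arrow_single :: "'b \<Rightarrow> ('b list \<Rightarrow> 'v::zero) \<Rightarrow> 'b list \<Rightarrow> 'v" where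
  "arrow_single \<alpha> x = (\<lambda>w. case w of [] \<Rightarrow> 0 | \<beta> # w' \<Rightarrow> if \<beta> = \<alpha> then x w' else 0)"

lemma component_arrow_single: "component \<beta> (arrow_single \<alpha> x) = (if \<beta> = \<alpha> then x else 0)"
  by (simp add: component_def arrow_single_def fun_eq_iff)

lemma arrow_single_Nil [simp]: "arrow_single \<alpha> x [] = 0"
  by (simp add: arrow_single_def)

lemma component_zero [simp]: "component \<alpha> 0 = 0"
  by (simp add: component_def fun_eq_iff)

lemma component_add [simp]:
  "component \<alpha> (u + v :: 'b list \<Rightarrow> 'v::ab_group_add) = component \<alpha> u + component \<alpha> v"
  by (simp add: component_def fun_eq_iff)

lemma component_pscale [simp]: "component \<alpha> (pscale s c u) = pscale s c (component \<alpha> u)"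
  by (simp add: component_def pscale_def fun_eq_iff)

lemma arrow_family_eqI:
  assumes "u [] = v []" "\<And>\<alpha>. component \<alpha> u = component \<alpha> v"
  shows "u = v"
proof
  fix w show "u w = v w"
    using assms by (cases w) (auto simp: component_def fun_eq_iff)
qed

lemma pscale_Nil_zero: "vector_space s \<Longrightarrow> u [] = 0 \<Longrightarrow> pscale s c u [] = 0"
  by (simp add: pscale_def vector_space.scale_eq_0_iff)

lemma arrow_sum_mono: "(\<And>\<alpha>. \<alpha> \<in> A \<Longrightarrow> V \<alpha> \<subseteq> V' \<alpha>) \<Longrightarrow> arrow_sum A V \<subseteq> arrow_sum A V'"
  by (auto simp: arrow_sum_def)

lemma fin_dim_arrow_sum:
  fixes V :: "'b \<Rightarrow> ('b list \<Rightarrow> 'v::ab_group_add) set"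
  assumes s: "vector_space s" and A: "finite A"
    and V: "\<And>\<alpha>. \<alpha> \<in> A \<Longrightarrow> fin_dim_subspace (pscale s) (V \<alpha>)"
  shows "fin_dim_subspace (pscale s) (arrow_sum A V)"
    and "vector_space.dim (pscale s) (arrow_sum A V) = (\<Sum>\<alpha>\<in>A. vector_space.dim (pscale s) (V \<alpha>))"
proof -
  interpret vector_space "pscale s" using vector_space_pscale[OF s] .
  have "fin_dim_subspace (pscale s) (arrow_sum A V) \<and> dim (arrow_sum A V) = (\<Sum>\<alpha>\<in>A. dim (V \<alpha>))"
    using A V
  proof (induction A)
    case empty
    have "arrow_sum {} V = {0}"
    proof -
      have "u = 0" if "u \<in> arrow_sum {} V" for u
        by (rule arrow_family_eqI) (use that in \<open>simp_all add: arrow_sum_def\<close>)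
      then show ?thesis by (auto simp: arrow_sum_def)
    qed
    then show ?case using fin_dim_zero_space dim_zero_space by simp
  next
    case (insert \<alpha> A)
    then have IH: "fin_dim_subspace (pscale s) (arrow_sum A V)"
        "dim (arrow_sum A V) = (\<Sum>\<alpha>\<in>A. dim (V \<alpha>))" by auto
    let ?S = "arrow_single \<alpha> ` V \<alpha>"
    have V\<alpha>: "fin_dim_subspace (pscale s) (V \<alpha>)" using insert by simp
    have sub: "subspace (V \<beta>)" if "\<beta> \<in> insert \<alpha> A" for \<beta>
      using insert that fin_dim_subspace_imp_subspace by blast
    have lin: "linear_between (pscale s) (pscale s) (V \<alpha>) UNIV (arrow_single \<alpha>)"
      unfolding linear_between_def
    proof (intro conjI ballI allI)
      show "arrow_single \<alpha> (x + y) = arrow_single \<alpha> x + arrow_single \<alpha> y" for x y :: "'b list \<Rightarrow> 'v"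
        by (rule arrow_family_eqI) (simp_all add: component_arrow_single)
      show "arrow_single \<alpha> (pscale s c x) = pscale s c (arrow_single \<alpha> x)" for c and x :: "'b list \<Rightarrow> 'v"
        by (rule arrow_family_eqI) (simp_all add: component_arrow_single pscale_Nil_zero[OF s])
    qed simp
    have inj: "inj_on (arrow_single \<alpha>) (V \<alpha>)"
      by (rule inj_onI) (metis component_arrow_single)
    have S: "fin_dim_subspace (pscale s) ?S" "dim ?S = dim (V \<alpha>)"
      using injective_image_fin_dim[OF vector_space_axioms vector_space_axioms V\<alpha> lin inj] by auto
    have int: "arrow_sum A V \<inter> ?S = {0}"
    proof -
      have "u = 0" if u: "u \<in> arrow_sum A V" "u \<in> ?S" for u
      proof -
        obtain x where x: "u = arrow_single \<alpha> x" using u(2) by blast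
        have "component \<alpha> u = 0" using u(1) insert(2) by (simp add: arrow_sum_def)
        then have "x = 0" by (simp add: x component_arrow_single)
        show "u = 0"
          by (rule arrow_family_eqI) (simp_all add: x \<open>x = 0\<close> component_arrow_single)
      qed
      moreover have "0 \<in> arrow_sum A V" using IH fin_dim_subspace_imp_subspace subspace_0 by blast
      moreover have "0 \<in> ?S" using S fin_dim_subspace_imp_subspace subspace_0 by blast
      ultimately show ?thesis by blast
    qed
    have "{u + v |u v. u \<in> arrow_sum A V \<and> v \<in> ?S} = arrow_sum (insert \<alpha> A) V"
    proof (intro set_eqI iffI)
      fix w assume "w \<in> {u + v |u v. u \<in> arrow_sum A V \<and> v \<in> ?S}"
      then obtain u x where w: "w = u + arrow_single \<alpha> x" "u \<in> arrow_sum A V" "x \<in> V \<alpha>" by blast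
      then show "w \<in> arrow_sum (insert \<alpha> A) V"
        using insert(2) by (auto simp: arrow_sum_def component_arrow_single)
    next
      fix w assume w: "w \<in> arrow_sum (insert \<alpha> A) V"
      define u where "u = w - arrow_single \<alpha> (component \<alpha> w)"
      have cu: "component \<beta> u = (if \<beta> = \<alpha> then 0 else component \<beta> w)" for \<beta>
        unfolding u_def by (auto simp: component_def arrow_single_def fun_eq_iff)
      have "u \<in> arrow_sum A V"
        using w insert(2) by (auto simp: arrow_sum_def cu) (auto simp: u_def)
      moreover have "component \<alpha> w \<in> V \<alpha>" using w by (simp add: arrow_sum_def)
      moreover have "w = u + arrow_single \<alpha> (component \<alpha> w)" by (simp add: u_def)
      ultimately show "w \<in> {u + v |u v. u \<in> arrow_sum A V \<and> v \<in> ?S}" by blast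
    qed
    then show ?case
      using dim_direct_sum[OF IH(1) S(1) int] IH(2) S(2) insert(1,2) by (simp add: add.commute)
  qed
  then show "fin_dim_subspace (pscale s) (arrow_sum A V)"
    "dim (arrow_sum A V) = (\<Sum>\<alpha>\<in>A. dim (V \<alpha>))" by auto
qed

section \<open>Reflection at a sink\<close>

lemma reflect_quiver_simps [simp]:
  "verts (reflect_quiver a Q) = verts Q" "arcs (reflect_quiver a Q) = arcs Q"
  by (simp_all add: reflect_quiver_def)

lemma fin_digraph_reflect_quiver: "fin_digraph Q \<Longrightarrow> fin_digraph (reflect_quiver a Q)"
proof -
  assume "fin_digraph Q"
  then interpret fin_digraph Q .
  show ?thesis by unfold_locales (auto simp: reflect_quiver_def)
qed

text \<open>
  The scalar multiplication is of the form \<open>pscale s0\<close>, since direct sums over arrows are formed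
  inside the type of families indexed by lists of arrows.
\<close>

locale rep_at_sink =
  fixes s0 :: "'k::field \<Rightarrow> 'v::ab_group_add \<Rightarrow> 'v"
    and Q :: "('a, 'b) pre_digraph" and a :: 'a and M :: "('a, 'b, 'b list \<Rightarrow> 'v) qrep"
  assumes vs: "vector_space s0"
    and fin: "fin_digraph Q"
    and sink: "is_sink Q a"
    and rep: "quiver_rep (pscale s0) Q M"
begin

abbreviation "s \<equiv> pscale s0 :: 'k \<Rightarrow> ('b list \<Rightarrow> 'v) \<Rightarrow> 'b list \<Rightarrow> 'v"
abbreviation "arrows_into P \<equiv> arrow_sum (in_arcs Q a) (\<lambda>\<alpha>. P (tail Q \<alpha>))"
abbreviation "image_of P \<equiv> phi Q a M ` arrows_into P"
abbreviation "kernel_of P \<equiv> {u \<in> arrows_into P. phi Q a M u = 0}"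

definition subspace_family :: "('a \<Rightarrow> ('b list \<Rightarrow> 'v) set) \<Rightarrow> bool" where
  "subspace_family P \<longleftrightarrow> (\<forall>i\<in>verts Q - {a}. module.subspace s (P i) \<and> P i \<subseteq> space M i)"

sublocale VS: vector_space s
  using vector_space_pscale[OF vs] .

sublocale D: fin_digraph Q
  by (rule fin)

lemma a_in_verts: "a \<in> verts Q"
  using sink by (simp add: is_sink_def)

lemma no_out_arcs: "e \<in> arcs Q \<Longrightarrow> tail Q e \<noteq> a"
  using sink by (auto simp: is_sink_def out_arcs_def)

lemma tail_in_arc: "e \<in> in_arcs Q a \<Longrightarrow> tail Q e \<in> verts Q - {a}"
  using no_out_arcs by auto

lemma fin_dim_space: "i \<in> verts Q \<Longrightarrow> fin_dim_subspace s (space M i)"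
  using rep by (simp add: quiver_rep_def)

lemma subspace_family_space: "subspace_family (space M)"
  using fin_dim_space VS.fin_dim_subspace_imp_subspace by (simp add: subspace_family_def)

lemma subspace_familyD:
  assumes "subspace_family P" "e \<in> in_arcs Q a"
  shows "VS.subspace (P (tail Q e))" "P (tail Q e) \<subseteq> space M (tail Q e)"
    "fin_dim_subspace s (P (tail Q e))"
  using assms tail_in_arc[OF assms(2)] fin_dim_space VS.fin_dim_subspace_mono(1)
  unfolding subspace_family_def by blast+

lemma rmap_linear: "e \<in> arcs Q \<Longrightarrow> linear_between s s (space M (tail Q e)) (space M (head Q e)) (rmap M e)"
  using rep by (simp add: quiver_rep_def)

lemma rmap_zero: "e \<in> arcs Q \<Longrightarrow> rmap M e 0 = 0"
  using linear_between_zero[OF VS.vector_space_axioms VS.vector_space_axioms rmap_linear]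
    fin_dim_space VS.fin_dim_subspace_imp_subspace by simp

lemma fin_dim_arrows_into:
  assumes "subspace_family P"
  shows "fin_dim_subspace s (arrows_into P)"
    and "VS.dim (arrows_into P) = (\<Sum>e\<in>in_arcs Q a. VS.dim (P (tail Q e)))"
  using fin_dim_arrow_sum[OF vs D.finite_in_arcs, where V = "\<lambda>e. P (tail Q e)"] subspace_familyD(3)[OF assms]
  by blast+

lemma arrows_into_subset: "subspace_family P \<Longrightarrow> arrows_into P \<subseteq> arrows_into (space M)"
  using subspace_familyD by (intro arrow_sum_mono) blast

lemma phi_linear:
  assumes P: "subspace_family P"
  shows "linear_between s s (arrows_into P) (space M a) (phi Q a M)"
  unfolding linear_between_def
proof (intro conjI ballI allI)
  note sub = arrows_into_subset[OF P]
  have comp: "component e u \<in> space M (tail Q e)" if "u \<in> arrows_into P" "e \<in> in_arcs Q a" for u e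
    using that sub by (auto simp: arrow_sum_def)
  have sa: "VS.subspace (space M a)"
    using fin_dim_space a_in_verts VS.fin_dim_subspace_imp_subspace by blast
  show "phi Q a M ` arrows_into P \<subseteq> space M a"
  proof
    fix y assume "y \<in> phi Q a M ` arrows_into P"
    then obtain u where u: "u \<in> arrows_into P" "y = phi Q a M u" by blast
    have "rmap M e (component e u) \<in> space M a" if "e \<in> in_arcs Q a" for e
      using comp[OF u(1) that] rmap_linear[of e] that by (auto simp: linear_between_def)
    then show "y \<in> space M a" unfolding u(2) phi_def by (rule VS.subspace_sum[OF sa])
  qed
  fix u assume u: "u \<in> arrows_into P"
  show "phi Q a M (u + v) = phi Q a M u + phi Q a M v" if v: "v \<in> arrows_into P" for v
    unfolding phi_def sum.distrib[symmetric]
    using comp[OF u] comp[OF v] rmap_linear by (intro sum.cong) (auto simp: linear_between_def)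
  show "phi Q a M (s c u) = s c (phi Q a M u)" for c
    unfolding phi_def VS.scale_sum_right
    using comp[OF u] rmap_linear by (intro sum.cong) (auto simp: linear_between_def)
qed

lemma image_of_fin_dim:
  assumes P: "subspace_family P"
  shows "fin_dim_subspace s (image_of P)" "image_of P \<subseteq> space M a"
  using rank_nullity(1)[OF VS.vector_space_axioms VS.vector_space_axioms fin_dim_arrows_into(1)[OF P] phi_linear[OF P]]
    phi_linear[OF P] by (auto simp: linear_between_def)

lemma kernel_of_fin_dim:
  assumes P: "subspace_family P"
  shows "fin_dim_subspace s (kernel_of P)"
  using rank_nullity(2)[OF VS.vector_space_axioms VS.vector_space_axioms fin_dim_arrows_into(1)[OF P] phi_linear[OF P]] .

lemma dim_kernel_plus_dim_image:
  assumes P: "subspace_family P"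
  shows "(\<Sum>e\<in>in_arcs Q a. VS.dim (P (tail Q e))) = VS.dim (kernel_of P) + VS.dim (image_of P)"
  using rank_nullity(3)[OF VS.vector_space_axioms VS.vector_space_axioms fin_dim_arrows_into(1)[OF P] phi_linear[OF P]]
    fin_dim_arrows_into(2)[OF P] by simp

lemma phi_arrow_single:
  assumes "e \<in> in_arcs Q a"
  shows "phi Q a M (arrow_single e x) = rmap M e x"
proof -
  have "phi Q a M (arrow_single e x) = (\<Sum>\<alpha>\<in>in_arcs Q a. if \<alpha> = e then rmap M e x else 0)"
    unfolding phi_def using rmap_zero by (intro sum.cong) (auto simp: component_arrow_single)
  then show ?thesis using assms D.finite_in_arcs by (simp add: sum.delta)
qed

lemma arrow_single_in_arrows_into:
  assumes P: "subspace_family P" and e: "e \<in> in_arcs Q a" and x: "x \<in> P (tail Q e)"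
  shows "arrow_single e x \<in> arrows_into P"
  using assms subspace_familyD(1)[OF P, THEN VS.subspace_0]
  by (auto simp: arrow_sum_def component_arrow_single)

text \<open>
  A space at the sink is compatible with given spaces elsewhere if and only if it contains the
  image of their sum; after reflection, the next lemma gives the dual upper bound.
\<close>

lemma image_of_subset_iff:
  assumes P: "subspace_family P" and W: "VS.subspace W"
  shows "image_of P \<subseteq> W \<longleftrightarrow> (\<forall>e\<in>in_arcs Q a. rmap M e ` P (tail Q e) \<subseteq> W)"
proof
  assume L: "image_of P \<subseteq> W"
  show "\<forall>e\<in>in_arcs Q a. rmap M e ` P (tail Q e) \<subseteq> W"
  proof (intro ballI image_subsetI)
    fix e x assume e: "e \<in> in_arcs Q a" and x: "x \<in> P (tail Q e)"
    show "rmap M e x \<in> W"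
      using L arrow_single_in_arrows_into[OF P e x] phi_arrow_single[OF e, of x] by force
  qed
next
  assume R: "\<forall>e\<in>in_arcs Q a. rmap M e ` P (tail Q e) \<subseteq> W"
  show "image_of P \<subseteq> W"
    unfolding phi_def using R by (intro image_subsetI VS.subspace_sum[OF W]) (auto simp: arrow_sum_def simp del: in_in_arcs_conv)
qed

lemma subset_kernel_of_iff:
  assumes "W \<subseteq> kernel_of (space M)"
  shows "W \<subseteq> kernel_of P \<longleftrightarrow> (\<forall>e\<in>in_arcs Q a. component e ` W \<subseteq> P (tail Q e))"
  using assms by (auto simp: arrow_sum_def image_subset_iff subset_iff simp del: in_in_arcs_conv)

lemma reflect_rep_simps:
  "space (reflect_rep Q a M) a = kernel_of (space M)"
  "i \<noteq> a \<Longrightarrow> space (reflect_rep Q a M) i = space M i"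
  "e \<in> in_arcs Q a \<Longrightarrow> rmap (reflect_rep Q a M) e = component e"
  "e \<notin> in_arcs Q a \<Longrightarrow> rmap (reflect_rep Q a M) e = rmap M e"
  by (auto simp: reflect_rep_def)

lemma reflect_quiver_ends:
  assumes "e \<in> arcs Q"
  shows "head Q e = a \<Longrightarrow> tail (reflect_quiver a Q) e = a \<and> head (reflect_quiver a Q) e = tail Q e"
    and "head Q e \<noteq> a \<Longrightarrow> tail (reflect_quiver a Q) e = tail Q e \<and> head (reflect_quiver a Q) e = head Q e"
  using no_out_arcs[OF assms] by (auto simp: reflect_quiver_def)

lemma reflect_quiver_arcs_at:
  "in_arcs (reflect_quiver a Q) a = {}" "out_arcs (reflect_quiver a Q) a = in_arcs Q a"
  using no_out_arcs by (auto simp: reflect_quiver_def in_arcs_def out_arcs_def split: if_splits)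

lemma quiver_rep_reflect_rep: "quiver_rep s (reflect_quiver a Q) (reflect_rep Q a M)"
  unfolding quiver_rep_def
proof (intro conjI ballI)
  fix i assume "i \<in> verts (reflect_quiver a Q)"
  then show "fin_dim_subspace s (space (reflect_rep Q a M) i)"
    using fin_dim_space kernel_of_fin_dim[OF subspace_family_space]
    by (cases "i = a") (auto simp: reflect_rep_simps)
next
  fix e assume "e \<in> arcs (reflect_quiver a Q)"
  then have e: "e \<in> arcs Q" by simp
  show "linear_between s s (space (reflect_rep Q a M) (tail (reflect_quiver a Q) e))
      (space (reflect_rep Q a M) (head (reflect_quiver a Q) e)) (rmap (reflect_rep Q a M) e)"
  proof (cases "head Q e = a")
    case True
    then show ?thesis
      using e no_out_arcs[OF e] reflect_quiver_ends(1)[OF e True]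
      by (auto simp: reflect_rep_simps linear_between_def arrow_sum_def)
  next
    case False
    then show ?thesis
      using e no_out_arcs[OF e] reflect_quiver_ends(2)[OF e False] rmap_linear[OF e]
      by (simp add: reflect_rep_simps)
  qed
qed

lemma sigma_other: "i \<noteq> a \<Longrightarrow> sigma Q a d i = d i"
  by (simp add: sigma_def unit_vec_def)

lemma sigma_at: "sigma Q a d a = (\<Sum>e\<in>in_arcs Q a. d (tail Q e)) - d a"
proof -
  have "(\<Sum>i\<in>verts Q. d i * unit_vec a i) = (\<Sum>i\<in>verts Q. if i = a then d a else 0)"
    by (rule sum.cong) (auto simp: unit_vec_def)
  then have 1: "(\<Sum>i\<in>verts Q. d i * unit_vec a i) = d a"
    using a_in_verts by (simp add: sum.delta)
  have "(\<Sum>e\<in>arcs Q. d (tail Q e) * unit_vec a (head Q e)) =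
      (\<Sum>e\<in>arcs Q. if head Q e = a then d (tail Q e) else 0)"
    by (rule sum.cong) (auto simp: unit_vec_def)
  also have "\<dots> = (\<Sum>e\<in>in_arcs Q a. d (tail Q e))"
    by (simp add: sum.inter_filter[symmetric] in_arcs_def)
  finally have 2: "(\<Sum>e\<in>arcs Q. d (tail Q e) * unit_vec a (head Q e)) = (\<Sum>e\<in>in_arcs Q a. d (tail Q e))" .
  have 3: "(\<Sum>e\<in>arcs Q. unit_vec a (tail Q e) * d (head Q e)) = 0"
    using no_out_arcs by (intro sum.neutral) (simp add: unit_vec_def)
  have 4: "(\<Sum>i\<in>verts Q. unit_vec a i * d i) = d a" using 1 by (simp add: mult.commute)
  show ?thesis
    unfolding sigma_def sym_euler_form_def euler_form_def 1 2 3 4 by (simp add: unit_vec_def)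
qed

end

section \<open>Fibres over the flags away from the sink\<close>

context rep_at_sink
begin

text \<open>
  The top member needs no separate condition: it is bounded by the space of \<open>M\<close> at \<open>a\<close> and its
  prescribed dimension is that of the whole space.
\<close>

lemma flags_at_sink:
  assumes P: "\<forall>l < length ds + 2. subspace_family (Ps ! l)"
    and len: "length Ps = length ds + 2"
  shows "flags_at s Q a ds M Ps =
    chains_above s (space M a) (map2 (\<lambda>P d. (image_of P, d a)) Ps (full_filt ds (dimvec s Q M)))"
    (is "_ = chains_above s _ ?xs")
proof (rule set_eqI)
  fix Ws
  let ?D = "full_filt ds (dimvec s Q M)" and ?n = "length ds" and ?T = "space M a"
  have lenD: "length ?D = ?n + 2" by (simp add: full_filt_def)
  have nth: "?xs ! l = (image_of (Ps ! l), (?D ! l) a)" if "l < ?n + 2" for l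
    using that len lenD by simp
  have lenx: "length ?xs = ?n + 2" using len lenD by simp
  have top: "(?D ! (?n + 1)) a = int (VS.dim ?T)"
    using a_in_verts by (simp add: full_filt_def nth_append dimvec_def)
  have no_out: "out_arcs Q a = {}" using sink by (simp add: is_sink_def)
  have fdT: "fin_dim_subspace s ?T" using fin_dim_space a_in_verts by blast
  show "Ws \<in> flags_at s Q a ds M Ps \<longleftrightarrow> Ws \<in> chains_above s ?T ?xs"
  proof
    assume W: "Ws \<in> flags_at s Q a ds M Ps"
    then have lenW: "length Ws = ?n + 2" by (simp add: flags_at_def)
    have "Ws ! l \<in> subspaces_between s (image_of (Ps ! l)) ((Ws @ [?T]) ! Suc l) ((?D ! l) a)"
      if l: "l < ?n + 2" for l
    proof -
      have "VS.subspace (Ws ! l)" "Ws ! l \<subseteq> ?T" "int (VS.dim (Ws ! l)) = (?D ! l) a"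
        "\<forall>e\<in>in_arcs Q a. rmap M e ` (Ps ! l) (tail Q e) \<subseteq> Ws ! l"
        using W l by (auto simp: flags_at_def)
      moreover from this have "image_of (Ps ! l) \<subseteq> Ws ! l"
        using image_of_subset_iff P l by blast
      moreover have "Ws ! l \<subseteq> (Ws @ [?T]) ! Suc l"
      proof (cases "l < ?n + 1")
        case True
        then show ?thesis using W lenW by (simp add: flags_at_def nth_append)
      next
        case False
        then have "Suc l = length Ws" using l lenW by simp
        then show ?thesis using \<open>Ws ! l \<subseteq> ?T\<close> by simp
      qed
      ultimately show ?thesis by (simp add: subspaces_between_def)
    qed
    then show "Ws \<in> chains_above s ?T ?xs" using nth lenx lenW by (simp add: chains_above_iff)
  next
    assume W: "Ws \<in> chains_above s ?T ?xs"
    then have lenW: "length Ws = ?n + 2" using lenx by (simp add: chains_above_iff)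
    have B: "Ws ! l \<in> subspaces_between s (image_of (Ps ! l)) ((Ws @ [?T]) ! Suc l) ((?D ! l) a)"
      if l: "l < ?n + 2" for l
    proof -
      have "Ws ! l \<in> subspaces_between s (fst (?xs ! l)) ((Ws @ [?T]) ! Suc l) (snd (?xs ! l))"
        using W l unfolding chains_above_iff lenx by blast
      then show ?thesis unfolding nth[OF l] by simp
    qed
    have sub: "Ws ! l \<subseteq> ?T" if "l < ?n + 2" for l using chains_above_subset[OF W] lenW that by simp
    have "VS.subspace (Ws ! (?n + 1))" "int (VS.dim (Ws ! (?n + 1))) = int (VS.dim ?T)"
      using B[of "?n + 1"] top by (auto simp: subspaces_between_def)
    then have last: "Ws ! (?n + 1) = ?T"
      using VS.fin_dim_subspace_mono(3)[OF fdT _ sub[of "?n + 1"]] by simp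
    have "Ws ! l \<subseteq> Ws ! Suc l" if "l < ?n + 1" for l
      using B[of l] that lenW by (simp add: subspaces_between_def nth_append)
    moreover have "VS.subspace (Ws ! l) \<and> Ws ! l \<subseteq> ?T \<and> int (VS.dim (Ws ! l)) = (?D ! l) a \<and>
        (\<forall>e\<in>in_arcs Q a. rmap M e ` (Ps ! l) (tail Q e) \<subseteq> Ws ! l)" if l: "l < ?n + 2" for l
    proof -
      have *: "VS.subspace (Ws ! l)" "int (VS.dim (Ws ! l)) = (?D ! l) a" "image_of (Ps ! l) \<subseteq> Ws ! l"
        using B[OF l] by (auto simp: subspaces_between_def)
      then have "\<forall>e\<in>in_arcs Q a. rmap M e ` (Ps ! l) (tail Q e) \<subseteq> Ws ! l"
        using image_of_subset_iff[of "Ps ! l" "Ws ! l"] P l by blast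
      then show ?thesis using * sub[OF l] by blast
    qed
    ultimately show "Ws \<in> flags_at s Q a ds M Ps"
      using lenW last no_out by (simp add: flags_at_def)
  qed
qed

lemma flags_at_source_after_reflection:
  assumes P: "\<forall>l < length es + 2. subspace_family (Ps ! l)"
    and mono: "\<forall>l < length es + 1. \<forall>i\<in>verts Q - {a}. (Ps ! l) i \<subseteq> (Ps ! Suc l) i"
    and len: "length Ps = length es + 2"
    and top: "Ps ! (length es + 1) = restrict (space M) (verts Q - {a})"
  shows "flags_at s (reflect_quiver a Q) a es (reflect_rep Q a M) Ps =
    chains_below s {0} (map2 (\<lambda>P d. (kernel_of P, d a)) Ps
      (full_filt es (dimvec s (reflect_quiver a Q) (reflect_rep Q a M))))"
    (is "flags_at s ?Q a es ?M Ps = chains_below s _ ?xs")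
proof (rule set_eqI)
  fix Ws
  let ?D = "full_filt es (dimvec s ?Q ?M)" and ?n = "length es" and ?T = "kernel_of (space M)"
  have lenD: "length ?D = ?n + 2" by (simp add: full_filt_def)
  have nth: "?xs ! l = (kernel_of (Ps ! l), (?D ! l) a)" if "l < ?n + 2" for l
    using that len lenD by simp
  have lenx: "length ?xs = ?n + 2" using len lenD by simp
  have topD: "(?D ! (?n + 1)) a = int (VS.dim ?T)"
    using a_in_verts by (simp add: full_filt_def nth_append dimvec_def reflect_rep_simps)
  have fdT: "fin_dim_subspace s ?T" using kernel_of_fin_dim[OF subspace_family_space] .
  have KT: "kernel_of (Ps ! l) \<subseteq> ?T" if "l < ?n + 2" for l
    using arrows_into_subset P that by blast
  have arcs: "(\<forall>e\<in>in_arcs ?Q a. A e)"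
     "(\<forall>e\<in>out_arcs ?Q a. rmap ?M e ` W \<subseteq> U (head ?Q e)) \<longleftrightarrow>
      (\<forall>e\<in>in_arcs Q a. component e ` W \<subseteq> U (tail Q e))" for A W U
    unfolding reflect_quiver_arcs_at using reflect_quiver_ends(1) reflect_rep_simps(3) by auto
  show "Ws \<in> flags_at s ?Q a es ?M Ps \<longleftrightarrow> Ws \<in> chains_below s {0} ?xs"
  proof
    assume W: "Ws \<in> flags_at s ?Q a es ?M Ps"
    then have lenW: "length Ws = ?n + 2" by (simp add: flags_at_def)
    have "Ws ! l \<in> subspaces_between s (({0} # Ws) ! l) (kernel_of (Ps ! l)) ((?D ! l) a)"
      if l: "l < ?n + 2" for l
    proof -
      have *: "VS.subspace (Ws ! l)" "Ws ! l \<subseteq> ?T" "int (VS.dim (Ws ! l)) = (?D ! l) a"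
        "\<forall>e\<in>out_arcs ?Q a. rmap ?M e ` (Ws ! l) \<subseteq> (Ps ! l) (head ?Q e)"
        using W l unfolding flags_at_def reflect_rep_simps(1) by auto
      have "Ws ! l \<subseteq> kernel_of (Ps ! l)"
        using subset_kernel_of_iff[OF *(2), of "Ps ! l"] *(4) unfolding arcs by blast
      moreover have "({0} # Ws) ! l \<subseteq> Ws ! l"
      proof (cases l)
        case 0
        then show ?thesis using VS.subspace_0[OF *(1)] by simp
      next
        case (Suc k)
        then show ?thesis using W l by (simp add: flags_at_def)
      qed
      ultimately show ?thesis using * by (simp add: subspaces_between_def)
    qed
    then show "Ws \<in> chains_below s {0} ?xs" using nth lenx lenW by (simp add: chains_below_iff)
  next
    assume W: "Ws \<in> chains_below s {0} ?xs"
    then have lenW: "length Ws = ?n + 2" using lenx by (simp add: chains_below_iff)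
    have B: "Ws ! l \<in> subspaces_between s (({0} # Ws) ! l) (kernel_of (Ps ! l)) ((?D ! l) a)"
      if l: "l < ?n + 2" for l
    proof -
      have "Ws ! l \<in> subspaces_between s (({0} # Ws) ! l) (fst (?xs ! l)) (snd (?xs ! l))"
        using W l unfolding chains_below_iff lenx by blast
      then show ?thesis unfolding nth[OF l] by simp
    qed
    have sub: "Ws ! l \<subseteq> ?T" if "l < ?n + 2" for l
      using B[OF that] KT[OF that] by (auto simp: subspaces_between_def)
    have "VS.subspace (Ws ! (?n + 1))" "int (VS.dim (Ws ! (?n + 1))) = int (VS.dim ?T)"
      using B[of "?n + 1"] topD by (auto simp: subspaces_between_def)
    then have last: "Ws ! (?n + 1) = ?T"
      using VS.fin_dim_subspace_mono(3)[OF fdT _ sub[of "?n + 1"]] by simp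
    have inc: "Ws ! l \<subseteq> Ws ! Suc l" if "l < ?n + 1" for l
      using B[of "Suc l"] that by (simp add: subspaces_between_def)
    have "VS.subspace (Ws ! l) \<and> Ws ! l \<subseteq> ?T \<and> int (VS.dim (Ws ! l)) = (?D ! l) a \<and>
        (\<forall>e\<in>out_arcs ?Q a. rmap ?M e ` (Ws ! l) \<subseteq> (Ps ! l) (head ?Q e))" if l: "l < ?n + 2" for l
    proof -
      have *: "VS.subspace (Ws ! l)" "int (VS.dim (Ws ! l)) = (?D ! l) a" "Ws ! l \<subseteq> kernel_of (Ps ! l)"
        using B[OF l] by (auto simp: subspaces_between_def)
      have "\<forall>e\<in>out_arcs ?Q a. rmap ?M e ` (Ws ! l) \<subseteq> (Ps ! l) (head ?Q e)"
        unfolding arcs using subset_kernel_of_iff[OF sub[OF l], of "Ps ! l"] *(3) by blast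
      then show ?thesis using * sub[OF l] by blast
    qed
    then show "Ws \<in> flags_at s ?Q a es ?M Ps"
      using lenW last inc by (simp add: flags_at_def reflect_rep_simps(1) reflect_quiver_arcs_at(1))
  qed
qed

end

text \<open>
  In the application, \<open>D\<close>, \<open>E\<close> and \<open>T\<close> are the entries \<open>d\<^sub>a\<close>, \<open>e\<^sub>a\<close> and the sum of the \<open>d\<^sub>j\<close> over the
  arrows \<open>j \<rightarrow> a\<close>, while \<open>p\<close> and \<open>k\<close> are the dimensions of the images \<open>I\<close> and the kernels \<open>K\<close>; the
  index \<open>Suc n\<close> belongs to the full representation.  Monotonicity of \<open>k\<close> says that the defect
  \<open>D - p\<close> satisfies the recursive inequality whose least non-negative solution is \<open>r\<close>.  Therefore
  \<open>p \<le> D\<close> implies \<open>r \<le> D - p\<close>, which is \<open>E \<le> k\<close>.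
\<close>

lemma reflected_bounds_iff:
  fixes D T p k E r :: "nat \<Rightarrow> int"
  assumes r0: "r 0 = 0"
    and rS: "\<And>l. l < n \<Longrightarrow> r (Suc l) = max 0 ((T l - D l) - (T (Suc l) - D (Suc l)) + r l)"
    and E: "\<And>l. l \<le> n \<Longrightarrow> E l = T l - D l + r l" and E_top: "E (Suc n) = k (Suc n)"
    and T: "\<And>l. l \<le> Suc n \<Longrightarrow> T l = k l + p l"
    and k: "\<And>l. l \<le> n \<Longrightarrow> k l \<le> k (Suc l)"
    and p_top: "p (Suc n) \<le> D (Suc n)"
  shows "(\<forall>l \<le> Suc n. p l \<le> D l) \<longleftrightarrow> (\<forall>l \<le> Suc n. E l \<le> k l)"
    and "(\<forall>l \<le> Suc n. p l \<le> D l) \<Longrightarrow> (\<forall>l \<le> n. E l \<le> E (Suc l))"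
proof -
  have E_le: "E l \<le> k l" if p: "\<forall>l \<le> Suc n. p l \<le> D l" and l: "l \<le> Suc n" for l
  proof -
    have r_le: "r l \<le> D l - p l" if "l \<le> n" for l
      using that
    proof (induction l)
      case 0
      then show ?case using p r0 by simp
    next
      case (Suc l)
      then have "k l \<le> k (Suc l)" "r l \<le> D l - p l" "p (Suc l) \<le> D (Suc l)"
          "T l = k l + p l" "T (Suc l) = k (Suc l) + p (Suc l)"
        using k p T by auto
      then show ?case using rS[of l] Suc.prems by simp
    qed
    show ?thesis
    proof (cases "l \<le> n")
      case True
      then show ?thesis using E[of l] T[of l] r_le[of l] by simp
    next
      case False
      then have "l = Suc n" using l by simp
      then show ?thesis using E_top by simp
    qed
  qed
  have r_nonneg: "r l \<ge> 0" if "l \<le> n" for l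
    using that r0 rS by (cases l) auto
  show "(\<forall>l \<le> Suc n. p l \<le> D l) \<longleftrightarrow> (\<forall>l \<le> Suc n. E l \<le> k l)"
  proof (intro iffI allI impI)
    fix l assume *: "\<forall>l \<le> Suc n. E l \<le> k l" and l: "l \<le> Suc n"
    show "p l \<le> D l"
    proof (cases "l \<le> n")
      case True
      then have "E l \<le> k l" using * by simp
      then show ?thesis using E[OF True] T[of l] r_nonneg[OF True] True by simp
    next
      case False
      then have "l = Suc n" using l by simp
      then show ?thesis using p_top by simp
    qed
  qed (use E_le in blast)
  show "\<forall>l \<le> n. E l \<le> E (Suc l)" if p: "\<forall>l \<le> Suc n. p l \<le> D l"
  proof (intro allI impI)
    fix l assume l: "l \<le> n"
    show "E l \<le> E (Suc l)"
    proof (cases "l < n")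
      case True
      then show ?thesis using E[of l] E[of "Suc l"] rS[OF True] by simp
    next
      case False
      then have "l = n" using l by simp
      then show ?thesis using E_le[OF p, of n] k[of n] E_top by simp
    qed
  qed
qed

lemma length_reflect_filt [simp]: "length (reflect_filt Q a ds) = length ds"
  by (simp add: reflect_filt_def del: upt_Suc)

context rep_at_sink
begin

lemma full_filt_reflect_filt:
  assumes l: "l \<le> length ds"
  shows "full_filt (reflect_filt Q a ds) v ! l =
     (\<lambda>i. sigma Q a (full_filt ds v' ! l) i + r_plus Q a ds l * unit_vec a i)"
proof (cases l)
  case 0
  have "sigma Q a 0 i = 0" for i
    by (cases "i = a") (simp_all add: sigma_at sigma_other)
  then show ?thesis using 0 by (simp add: full_filt_def fun_eq_iff)
next
  case (Suc k)
  then show ?thesis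
    using l by (simp add: full_filt_def reflect_filt_def nth_append del: upt_Suc)
qed

lemma r_plus_Suc:
  assumes l: "l < length ds"
  shows "r_plus Q a ds (Suc l) = max 0
     (((\<Sum>e\<in>in_arcs Q a. (full_filt ds v ! l) (tail Q e)) - (full_filt ds v ! l) a) -
      ((\<Sum>e\<in>in_arcs Q a. (full_filt ds v ! Suc l) (tail Q e)) - (full_filt ds v ! Suc l) a) +
      r_plus Q a ds l)"
proof -
  have 1: "(0 # ds) ! l = full_filt ds v ! l" "(0 # ds) ! Suc l = full_filt ds v ! Suc l"
    using l by (auto simp: full_filt_def nth_append nth_Cons split: nat.splits)
  show ?thesis
    unfolding r_plus.simps 1 sigma_at by (simp add: sum_subtractf)
qed

lemma Fl_del_vertex_reflect:
  "Fl s (del_vertex (reflect_quiver a Q) a) (reflect_filt Q a ds) (reflect_rep Q a M) =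
   Fl s (del_vertex Q a) ds M"
proof (rule Fl_cong)
  have "tail (reflect_quiver a Q) e \<noteq> a \<and> head (reflect_quiver a Q) e \<noteq> a \<longleftrightarrow>
      tail Q e \<noteq> a \<and> head Q e \<noteq> a" if "e \<in> arcs Q" for e
    using reflect_quiver_ends[OF that] no_out_arcs[OF that] by metis
  then show "arcs (del_vertex (reflect_quiver a Q) a) = arcs (del_vertex Q a)"
    by (auto simp: pre_digraph.arcs_del_vert)
  fix e assume "e \<in> arcs (del_vertex (reflect_quiver a Q) a)"
  then have e: "e \<in> arcs Q" "tail Q e \<noteq> a" "head Q e \<noteq> a"
    using \<open>arcs (del_vertex (reflect_quiver a Q) a) = arcs (del_vertex Q a)\<close>
    by (auto simp: pre_digraph.arcs_del_vert)
  then show "tail (del_vertex (reflect_quiver a Q) a) e = tail (del_vertex Q a) e \<and>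
      head (del_vertex (reflect_quiver a Q) a) e = head (del_vertex Q a) e \<and>
      rmap (reflect_rep Q a M) e = rmap M e"
    using reflect_quiver_ends(2)[OF e(1,3)]
    by (simp add: pre_digraph.tail_del_vert pre_digraph.head_del_vert reflect_rep_simps)
next
  fix l i assume "l < length (reflect_filt Q a ds)" "i \<in> verts (del_vertex (reflect_quiver a Q) a)"
  then have l: "l < length ds" and i: "i \<noteq> a" by (auto simp: pre_digraph.verts_del_vert)
  have "(full_filt (reflect_filt Q a ds) 0 ! Suc l) i = (full_filt ds 0 ! Suc l) i"
    using full_filt_reflect_filt[of "Suc l" ds 0 0] l i by (simp add: sigma_other unit_vec_def)
  then show "(reflect_filt Q a ds ! l) i = (ds ! l) i"
    using l by (simp add: full_filt_def nth_append)
qed (auto simp: pre_digraph.verts_del_vert reflect_rep_simps)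

lemma flags_off_sinkD:
  assumes Ps: "Ps \<in> Fl s (del_vertex Q a) ds M"
  shows "length Ps = length ds + 2"
    and "l < length ds + 2 \<Longrightarrow> subspace_family (Ps ! l)"
    and "l < length ds + 1 \<Longrightarrow> i \<in> verts Q - {a} \<Longrightarrow> (Ps ! l) i \<subseteq> (Ps ! Suc l) i"
    and "Ps ! (length ds + 1) = restrict (space M) (verts Q - {a})"
    and "l < length ds + 2 \<Longrightarrow> i \<in> verts Q - {a} \<Longrightarrow>
      int (VS.dim ((Ps ! l) i)) = (full_filt ds (dimvec s Q M) ! l) i"
  using Ps full_filt_dimvec_del_vertex[of i Q a l ds s M]
  by (auto simp: Fl_iff subrep_def subspace_family_def pre_digraph.verts_del_vert)

lemma arrows_into_mono:
  "(\<And>i. i \<in> verts Q - {a} \<Longrightarrow> P i \<subseteq> P' i) \<Longrightarrow> arrows_into P \<subseteq> arrows_into P'"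
  using tail_in_arc by (intro arrow_sum_mono) blast

lemma arrows_into_restrict: "arrows_into (restrict P (verts Q - {a})) = arrows_into P"
  using tail_in_arc by (intro equalityI arrow_sum_mono) auto

text \<open>
  Both fibres are non-empty exactly when \<open>p l \<le> D l\<close> for all \<open>l\<close>, in the notation of the proof.
\<close>

lemma fibres_over_flags_off_sink:
  assumes filt: "is_filtration Q ds (dimvec s Q M)" and Ps: "Ps \<in> Fl s (del_vertex Q a) ds M"
  defines "F \<equiv> flags_at s Q a ds M Ps"
    and "G \<equiv> flags_at s (reflect_quiver a Q) a (reflect_filt Q a ds) (reflect_rep Q a M) Ps"
  shows "F \<noteq> {} \<longleftrightarrow> G \<noteq> {}"
    and "F \<noteq> {} \<Longrightarrow> one_mod (UNIV :: 'k set) F" and "G \<noteq> {} \<Longrightarrow> one_mod (UNIV :: 'k set) G"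
proof -
  let ?n = "length ds" and ?Q = "reflect_quiver a Q" and ?M = "reflect_rep Q a M"
  let ?es = "reflect_filt Q a ds"
  let ?D = "full_filt ds (dimvec s Q M)" and ?E = "full_filt ?es (dimvec s ?Q ?M)"
  define D where "D l = (?D ! l) a" for l
  define E where "E l = (?E ! l) a" for l
  define T where "T l = (\<Sum>e\<in>in_arcs Q a. (?D ! l) (tail Q e))" for l
  define p where "p l = int (VS.dim (image_of (Ps ! l)))" for l
  define k where "k l = int (VS.dim (kernel_of (Ps ! l)))" for l
  define xs where "xs = map2 (\<lambda>P d. (image_of P, d a)) Ps ?D"
  define ys where "ys = map2 (\<lambda>P d. (kernel_of P, d a)) Ps ?E"
  note facts = flags_off_sinkD[OF Ps]
  have fam: "subspace_family (Ps ! l)" if "l \<le> Suc ?n" for l using facts(2) that by simp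
  have F: "F = chains_above s (space M a) xs"
    unfolding F_def xs_def using facts(1,2) by (intro flags_at_sink) auto
  have G: "G = chains_below s {0} ys"
    unfolding G_def ys_def using facts by (intro flags_at_source_after_reflection) auto
  have lenD: "length ?D = ?n + 2" "length ?E = ?n + 2" by (auto simp: full_filt_def)
  have lenx: "length xs = ?n + 2" "length ys = ?n + 2" using facts(1) lenD by (auto simp: xs_def ys_def)
  have nth: "xs ! l = (image_of (Ps ! l), D l)" "ys ! l = (kernel_of (Ps ! l), E l)" if "l \<le> Suc ?n" for l
    using that facts(1) lenD by (auto simp: xs_def ys_def D_def E_def)
  have top_arrows: "arrows_into (Ps ! Suc ?n) = arrows_into (space M)"
    using facts(4) arrows_into_restrict by simp
  have D_top: "D (Suc ?n) = int (VS.dim (space M a))"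
    using a_in_verts by (simp add: D_def full_filt_def nth_append dimvec_def)
  have E_top: "E (Suc ?n) = k (Suc ?n)"
    using a_in_verts by (simp add: E_def k_def full_filt_def nth_append dimvec_def reflect_rep_simps top_arrows)
  have step: "arrows_into (Ps ! l) \<subseteq> arrows_into (Ps ! Suc l)" if "l \<le> ?n" for l
    using facts(3)[of l] that by (intro arrows_into_mono) auto
  have T: "T l = k l + p l" if l: "l \<le> Suc ?n" for l
  proof -
    have "T l = (\<Sum>e\<in>in_arcs Q a. int (VS.dim ((Ps ! l) (tail Q e))))"
      unfolding T_def using facts(5)[of l] l tail_in_arc by (intro sum.cong) auto
    also have "\<dots> = int (\<Sum>e\<in>in_arcs Q a. VS.dim ((Ps ! l) (tail Q e)))" by simp
    finally show ?thesis
      unfolding dim_kernel_plus_dim_image[OF fam[OF l]] by (simp add: k_def p_def)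
  qed
  have k: "k l \<le> k (Suc l)" if "l \<le> ?n" for l
  proof -
    have "kernel_of (Ps ! l) \<subseteq> kernel_of (Ps ! Suc l)" using step[OF that] by blast
    then show ?thesis
      using VS.fin_dim_subspace_mono(2)[OF kernel_of_fin_dim[OF fam[of "Suc l"]]
          VS.fin_dim_subspace_imp_subspace[OF kernel_of_fin_dim[OF fam[of l]]]] that
      by (simp add: k_def)
  qed
  have p_le: "p l \<le> D (Suc ?n)" if "l \<le> Suc ?n" for l
    using image_of_fin_dim[OF fam[OF that]] fin_dim_space[OF a_in_verts]
      VS.fin_dim_subspace_mono(2)[OF _ VS.fin_dim_subspace_imp_subspace]
    unfolding p_def D_top by simp
  have E: "E l = T l - D l + r_plus Q a ds l" if "l \<le> ?n" for l
    using full_filt_reflect_filt[OF that, of "dimvec s ?Q ?M" "dimvec s Q M"]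
    by (simp add: E_def T_def D_def sigma_at unit_vec_def)
  have r: "r_plus Q a ds (Suc l) = max 0 ((T l - D l) - (T (Suc l) - D (Suc l)) + r_plus Q a ds l)"
    if "l < ?n" for l
    using r_plus_Suc[OF that, of "dimvec s Q M"] by (simp add: T_def D_def)
  note bounds = reflected_bounds_iff[where r = "r_plus Q a ds" and n = ?n and p = p and k = k
      and D = D and T = T and E = E, OF _ r E E_top T k p_le[OF order_refl]]
  have D_mono: "D l \<le> D (Suc l)" if "l \<le> ?n" for l
    using filt a_in_verts that by (simp add: is_filtration_def D_def)
  \<comment> \<open>Necessity of the bounds: a member of a chain contains the image, or lies in the kernel.\<close>
  have F_imp: "\<forall>l \<le> Suc ?n. p l \<le> D l" if neF: "F \<noteq> {}"
  proof (intro allI impI)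
    fix l assume l: "l \<le> Suc ?n"
    obtain Ws where Ws: "Ws \<in> chains_above s (space M a) xs" using neF F by blast
    then have "Ws ! l \<in> subspaces_between s (fst (xs ! l)) ((Ws @ [space M a]) ! Suc l) (snd (xs ! l))"
      using l lenx unfolding chains_above_iff by simp
    then have W: "VS.subspace (Ws ! l)" "image_of (Ps ! l) \<subseteq> Ws ! l" "int (VS.dim (Ws ! l)) = D l"
      unfolding nth[OF l] by (auto simp: subspaces_between_def)
    have "length Ws = ?n + 2" using Ws lenx by (simp add: chains_above_iff)
    then have "Ws ! l \<subseteq> space M a" using chains_above_subset[OF Ws, of l] l by simp
    then have "fin_dim_subspace s (Ws ! l)"
      using VS.fin_dim_subspace_mono(1) fin_dim_space a_in_verts W(1) by blast
    then show "p l \<le> D l"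
      using VS.fin_dim_subspace_mono(2)[OF _ _ W(2)] W(3)
        VS.fin_dim_subspace_imp_subspace[OF image_of_fin_dim(1)[OF fam[OF l]]]
      unfolding p_def by fastforce
  qed
  have G_imp: "\<forall>l \<le> Suc ?n. E l \<le> k l" if neG: "G \<noteq> {}"
  proof (intro allI impI)
    fix l assume l: "l \<le> Suc ?n"
    obtain Ws where Ws: "Ws \<in> chains_below s {0} ys" using neG G by blast
    then have "Ws ! l \<in> subspaces_between s (({0} # Ws) ! l) (fst (ys ! l)) (snd (ys ! l))"
      using l lenx unfolding chains_below_iff by simp
    then have W: "VS.subspace (Ws ! l)" "Ws ! l \<subseteq> kernel_of (Ps ! l)" "int (VS.dim (Ws ! l)) = E l"
      unfolding nth[OF l] by (auto simp: subspaces_between_def)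
    show "E l \<le> k l"
      using VS.fin_dim_subspace_mono(2)[OF kernel_of_fin_dim[OF fam[OF l]] W(1,2)] W(3)
      unfolding k_def by simp
  qed
  \<comment> \<open>Sufficiency: the bounds are all that is needed to choose the members one after the other.\<close>
  have F_chains: "one_mod (UNIV :: 'k set) F"
    if p: "\<forall>l \<le> Suc ?n. p l \<le> D l"
  proof -
    have fd: "fin_dim_subspace s (space M a)" using fin_dim_space a_in_verts by blast
    have I: "\<forall>l<length xs. VS.subspace (fst (xs ! l)) \<and> fst (xs ! l) \<subseteq> (map fst xs @ [space M a]) ! Suc l"
    proof (intro allI impI)
      fix l assume "l < length xs"
      then have l: "l \<le> Suc ?n" using lenx by simp
      have "image_of (Ps ! l) \<subseteq> (map fst xs @ [space M a]) ! Suc l"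
      proof (cases "l \<le> ?n")
        case True
        then have "(map fst xs @ [space M a]) ! Suc l = image_of (Ps ! Suc l)"
          using lenx nth[of "Suc l"] by (simp add: nth_append)
        then show ?thesis using step[OF True] by blast
      next
        case False
        then have "(map fst xs @ [space M a]) ! Suc l = space M a" using l lenx by (simp add: nth_append)
        then show ?thesis using image_of_fin_dim(2)[OF fam[OF l]] by simp
      qed
      then show "VS.subspace (fst (xs ! l)) \<and> fst (xs ! l) \<subseteq> (map fst xs @ [space M a]) ! Suc l"
        using VS.fin_dim_subspace_imp_subspace[OF image_of_fin_dim(1)[OF fam[OF l]]] nth[OF l] by simp
    qed
    have N: "\<forall>l<length xs. int (VS.dim (fst (xs ! l))) \<le> snd (xs ! l) \<and>
        snd (xs ! l) \<le> (map snd xs @ [int (VS.dim (space M a))]) ! Suc l"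
    proof (intro allI impI)
      fix l assume "l < length xs"
      then have l: "l \<le> Suc ?n" using lenx by simp
      have "D l \<le> (map snd xs @ [int (VS.dim (space M a))]) ! Suc l"
      proof (cases "l \<le> ?n")
        case True
        then have "(map snd xs @ [int (VS.dim (space M a))]) ! Suc l = D (Suc l)"
          using lenx nth[of "Suc l"] by (simp add: nth_append)
        then show ?thesis using D_mono[OF True] by simp
      next
        case False
        then have "l = Suc ?n" using l by simp
        then show ?thesis using lenx D_top by (simp add: nth_append)
      qed
      then show "int (VS.dim (fst (xs ! l))) \<le> snd (xs ! l) \<and>
          snd (xs ! l) \<le> (map snd xs @ [int (VS.dim (space M a))]) ! Suc l"
        using p l nth[OF l] by (simp add: p_def)
    qed
    show ?thesis unfolding F by (rule VS.one_mod_chains_above[OF fd I N])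
  qed
  have G_chains: "one_mod (UNIV :: 'k set) G"
    if p: "\<forall>l \<le> Suc ?n. p l \<le> D l"
  proof -
    have E_k: "\<forall>l \<le> Suc ?n. E l \<le> k l" and E_mono: "\<forall>l \<le> ?n. E l \<le> E (Suc l)"
      using bounds p by auto
    have K: "\<forall>l<length ys. fin_dim_subspace s (fst (ys ! l)) \<and> ({0} # map fst ys) ! l \<subseteq> fst (ys ! l)"
    proof (intro allI impI)
      fix l assume "l < length ys"
      then have l: "l \<le> Suc ?n" using lenx by simp
      note fdk = kernel_of_fin_dim[OF fam[OF l]]
      have "({0} # map fst ys) ! l \<subseteq> kernel_of (Ps ! l)"
      proof (cases l)
        case 0
        then show ?thesis using VS.subspace_0[OF VS.fin_dim_subspace_imp_subspace[OF fdk]] by simp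
      next
        case (Suc j)
        then have "({0} # map fst ys) ! l = kernel_of (Ps ! j)" using lenx l nth[of j] by simp
        then show ?thesis using step[of j] Suc l by auto
      qed
      then show "fin_dim_subspace s (fst (ys ! l)) \<and> ({0} # map fst ys) ! l \<subseteq> fst (ys ! l)"
        using fdk nth[OF l] by simp
    qed
    have N: "\<forall>l<length ys. snd (ys ! l) \<le> int (VS.dim (fst (ys ! l))) \<and>
        (int (VS.dim {0}) # map snd ys) ! l \<le> snd (ys ! l)"
    proof (intro allI impI)
      fix l assume "l < length ys"
      then have l: "l \<le> Suc ?n" using lenx by simp
      have "(int (VS.dim {0}) # map snd ys) ! l \<le> E l"
      proof (cases l)
        case 0
        then show ?thesis using VS.dim_zero_space by (simp add: E_def full_filt_def)
      next
        case (Suc j)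
        then show ?thesis using E_mono lenx l nth[of j] by simp
      qed
      then show "snd (ys ! l) \<le> int (VS.dim (fst (ys ! l))) \<and>
          (int (VS.dim {0}) # map snd ys) ! l \<le> snd (ys ! l)"
        using E_k l nth[OF l] by (simp add: k_def)
    qed
    show ?thesis unfolding G by (rule VS.one_mod_chains_below[OF VS.subspace_single_0 K N])
  qed
  have bnd: "(\<forall>l \<le> Suc ?n. p l \<le> D l) \<longleftrightarrow> (\<forall>l \<le> Suc ?n. E l \<le> k l)"
    using bounds(1) by simp
  show "F \<noteq> {} \<longleftrightarrow> G \<noteq> {}"
  proof
    show "G \<noteq> {}" if "F \<noteq> {}"
      using G_chains[OF F_imp[OF that]] unfolding one_mod_def by (rule conjunct1)
    show "F \<noteq> {}" if "G \<noteq> {}"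
      using F_chains[OF bnd[THEN iffD2, OF G_imp[OF that]]] unfolding one_mod_def by (rule conjunct1)
  qed
  show "one_mod (UNIV :: 'k set) F" if "F \<noteq> {}" by (rule F_chains[OF F_imp[OF that]])
  show "one_mod (UNIV :: 'k set) G" if "G \<noteq> {}" by (rule G_chains[OF bnd[THEN iffD2, OF G_imp[OF that]]])
qed

theorem Fl_reflect_sink:
  assumes filt: "is_filtration Q ds (dimvec s Q M)"
  defines "X \<equiv> Fl s Q ds M"
    and "Y \<equiv> Fl s (reflect_quiver a Q) (reflect_filt Q a ds) (reflect_rep Q a M)"
  shows "X \<noteq> {} \<longleftrightarrow> Y \<noteq> {}"
    and "finite (UNIV :: 'k set) \<Longrightarrow> [card X = card Y] (mod card (UNIV :: 'k set))"
proof -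
  let ?B = "Fl s (del_vertex Q a) ds M"
  let ?F = "flags_at s Q a ds M"
  let ?G = "flags_at s (reflect_quiver a Q) a (reflect_filt Q a ds) (reflect_rep Q a M)"
  have loop: "\<forall>e\<in>arcs Q. tail Q e \<noteq> a \<or> head Q e \<noteq> a" using no_out_arcs by blast
  have X: "bij_betw (\<lambda>(Ps, Ws). map2 (\<lambda>P W. P(a := W)) Ps Ws) (SIGMA Ps:?B. ?F Ps) X"
    unfolding X_def using flags_split_at_vertex[OF a_in_verts loop D.wf_digraph] .
  have Y: "bij_betw (\<lambda>(Ps, Ws). map2 (\<lambda>P W. P(a := W)) Ps Ws) (SIGMA Ps:?B. ?G Ps) Y"
    unfolding Y_def Fl_del_vertex_reflect[of ds, symmetric]
  proof (rule flags_split_at_vertex)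
    show "a \<in> verts (reflect_quiver a Q)" using a_in_verts by simp
    show "\<forall>e\<in>arcs (reflect_quiver a Q). tail (reflect_quiver a Q) e \<noteq> a \<or> head (reflect_quiver a Q) e \<noteq> a"
      using reflect_quiver_ends no_out_arcs by (metis reflect_quiver_simps(2))
    show "wf_digraph (reflect_quiver a Q)"
      using fin_digraph_reflect_quiver[OF fin, of a] by (rule fin_digraph.axioms(1))
  qed
  note fibres = fibres_over_flags_off_sink[OF filt]
  have "X \<noteq> {} \<longleftrightarrow> (SIGMA Ps:?B. ?F Ps) \<noteq> {}"
    unfolding bij_betw_imp_surj_on[OF X, symmetric] by (simp only: image_is_empty)
  also have "\<dots> \<longleftrightarrow> (\<exists>Ps\<in>?B. ?F Ps \<noteq> {})" by (simp add: Sigma_empty_iff)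
  also have "\<dots> \<longleftrightarrow> (\<exists>Ps\<in>?B. ?G Ps \<noteq> {})" using fibres(1) by (intro bex_cong refl)
  also have "\<dots> \<longleftrightarrow> (SIGMA Ps:?B. ?G Ps) \<noteq> {}" by (simp add: Sigma_empty_iff)
  also have "\<dots> \<longleftrightarrow> Y \<noteq> {}"
    unfolding bij_betw_imp_surj_on[OF Y, symmetric] by (simp only: image_is_empty)
  finally show "X \<noteq> {} \<longleftrightarrow> Y \<noteq> {}" .
  assume k: "finite (UNIV :: 'k set)"
  let ?q = "card (UNIV :: 'k set)"
  have "finite (verts (del_vertex Q a))" by (simp add: pre_digraph.verts_del_vert)
  moreover have "quiver_rep s (del_vertex Q a) M"
    using rep by (auto simp: quiver_rep_def pre_digraph.del_vert_simps)
  ultimately have finB: "finite ?B" using finite_Fl[OF VS.vector_space_axioms k] by blast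
  \<comment> \<open>Only the flags away from \<open>a\<close> with a non-empty fibre count, each of them as 1 modulo \<open>q\<close>.\<close>
  have same: "{Ps \<in> ?B. ?F Ps \<noteq> {}} = {Ps \<in> ?B. ?G Ps \<noteq> {}}"
    using fibres(1) by (intro Collect_cong conj_cong refl)
  have cX: "[card X = card {Ps \<in> ?B. ?F Ps \<noteq> {}}] (mod ?q)"
    unfolding bij_betw_same_card[OF X, symmetric]
    by (rule card_Sigma_cong_card_nonempty[OF finB k]) (rule fibres(2))
  have cY: "[card Y = card {Ps \<in> ?B. ?G Ps \<noteq> {}}] (mod ?q)"
    unfolding bij_betw_same_card[OF Y, symmetric]
    by (rule card_Sigma_cong_card_nonempty[OF finB k]) (rule fibres(3))
  show "[card X = card Y] (mod ?q)"
    using cong_trans[OF cX[unfolded same] cong_sym[OF cY]] .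
qed

end

section \<open>Reflecting once at every vertex\<close>

text \<open>
  Reflections also exchange the values of \<open>tail\<close> and \<open>head\<close> at names that are not arrows, so after
  reflecting once at every vertex the original quiver is recovered only up to this relation.
\<close>

definition same_quiver :: "('a, 'b) pre_digraph \<Rightarrow> ('a, 'b) pre_digraph \<Rightarrow> bool" where
  "same_quiver Q Q' \<longleftrightarrow> verts Q = verts Q' \<and> arcs Q = arcs Q' \<and>
     (\<forall>e\<in>arcs Q. tail Q e = tail Q' e \<and> head Q e = head Q' e)"

lemma same_quiver_arcs:
  assumes "same_quiver Q Q'"
  shows "in_arcs Q a = in_arcs Q' a" "out_arcs Q a = out_arcs Q' a"
  using assms by (auto simp: same_quiver_def)

lemma same_quiver_reflect_quiver:
  "same_quiver Q Q' \<Longrightarrow> same_quiver (reflect_quiver a Q) (reflect_quiver a Q')"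
  by (auto simp: same_quiver_def reflect_quiver_def)

lemma same_quiver_sigma:
  assumes "same_quiver Q Q'"
  shows "sigma Q a = sigma Q' a"
proof -
  have "(\<Sum>\<alpha>\<in>arcs Q. d (tail Q \<alpha>) * e (head Q \<alpha>)) = (\<Sum>\<alpha>\<in>arcs Q'. d (tail Q' \<alpha>) * e (head Q' \<alpha>))"
    for d e :: "'a \<Rightarrow> int"
    using assms by (intro sum.cong) (auto simp: same_quiver_def)
  then show ?thesis
    using assms by (simp add: fun_eq_iff sigma_def sym_euler_form_def euler_form_def same_quiver_def)
qed

lemma same_quiver_reflect_filt:
  assumes "same_quiver Q Q'"
  shows "reflect_filt Q a = reflect_filt Q' a"
proof -
  have "r_plus Q a ds l = r_plus Q' a ds l" for ds l
    by (induction l) (simp_all add: same_quiver_sigma[OF assms])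
  then show ?thesis by (simp add: reflect_filt_def same_quiver_sigma[OF assms] fun_eq_iff del: upt_Suc)
qed

lemma same_quiver_reflect_rep:
  assumes "same_quiver Q Q'"
  shows "reflect_rep Q a M = reflect_rep Q' a M"
proof -
  have "component \<alpha> u \<in> space M (tail Q \<alpha>) \<longleftrightarrow> component \<alpha> u \<in> space M (tail Q' \<alpha>)"
    if "\<alpha> \<in> in_arcs Q' a" for \<alpha> u
    using that assms by (simp add: same_quiver_def)
  then have sum: "arrow_sum (in_arcs Q' a) (\<lambda>\<alpha>. space M (tail Q \<alpha>)) =
      arrow_sum (in_arcs Q' a) (\<lambda>\<alpha>. space M (tail Q' \<alpha>))"
    unfolding arrow_sum_def by (intro Collect_cong conj_cong ball_cong refl) blast+
  show ?thesis
    unfolding reflect_rep_def phi_def same_quiver_arcs(1)[OF assms] sum ..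
qed

lemma same_quiver_seq:
  assumes "same_quiver Q Q'"
  shows "reflect_rep_seq Q w M = reflect_rep_seq Q' w M"
    and "reflect_filt_seq Q w ds = reflect_filt_seq Q' w ds"
    and "admissible_seq Q w \<longleftrightarrow> admissible_seq Q' w"
proof -
  have "reflect_rep_seq Q w M = reflect_rep_seq Q' w M \<and>
    reflect_filt_seq Q w ds = reflect_filt_seq Q' w ds \<and> (admissible_seq Q w \<longleftrightarrow> admissible_seq Q' w)"
    using assms
  proof (induction w arbitrary: Q Q' M ds)
    case (Cons a w)
    have "is_sink Q a \<longleftrightarrow> is_sink Q' a"
      using Cons.prems same_quiver_arcs(2)[OF Cons.prems] by (simp add: is_sink_def same_quiver_def)
    then show ?case
      using Cons.IH[OF same_quiver_reflect_quiver[OF Cons.prems, of a]]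
      by (simp add: same_quiver_reflect_rep[OF Cons.prems] same_quiver_reflect_filt[OF Cons.prems])
  qed simp
  then show "reflect_rep_seq Q w M = reflect_rep_seq Q' w M"
    "reflect_filt_seq Q w ds = reflect_filt_seq Q' w ds" "admissible_seq Q w \<longleftrightarrow> admissible_seq Q' w"
    by auto
qed

lemma reflect_seq_append:
  "reflect_rep_seq Q (u @ w) M = reflect_rep_seq (fold reflect_quiver u Q) w (reflect_rep_seq Q u M)"
  "reflect_filt_seq Q (u @ w) ds = reflect_filt_seq (fold reflect_quiver u Q) w (reflect_filt_seq Q u ds)"
  "admissible_seq Q (u @ w) \<longleftrightarrow> admissible_seq Q u \<and> admissible_seq (fold reflect_quiver u Q) w"
  by (induction u arbitrary: Q M ds) auto

lemma fold_reflect_quiver_simps [simp]: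
  "verts (fold reflect_quiver w Q) = verts Q" "arcs (fold reflect_quiver w Q) = arcs Q"
  by (induction w arbitrary: Q) auto

lemma fin_digraph_fold_reflect_quiver: "fin_digraph Q \<Longrightarrow> fin_digraph (fold reflect_quiver w Q)"
  by (induction w arbitrary: Q) (auto intro: fin_digraph_reflect_quiver)

text \<open>
  Reflections preserve loops, and a vertex with a loop is never a sink.
\<close>

lemma admissible_seq_no_loop:
  "admissible_seq Q w \<Longrightarrow> a \<in> set w \<Longrightarrow> e \<in> arcs Q \<Longrightarrow> tail Q e \<noteq> a \<or> head Q e \<noteq> a"
proof (induction w arbitrary: Q)
  case (Cons b w)
  show ?case
  proof (cases "a = b")
    case True
    then show ?thesis using Cons.prems by (auto simp: is_sink_def out_arcs_def)
  next
    case False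
    then have "tail (reflect_quiver b Q) e \<noteq> a \<or> head (reflect_quiver b Q) e \<noteq> a"
      using Cons by auto
    then show ?thesis by (auto simp: reflect_quiver_def split: if_splits)
  qed
qed simp

lemma fold_reflect_quiver_ends:
  assumes "distinct w" "tail Q e \<noteq> head Q e"
  shows "tail (fold reflect_quiver w Q) e =
      (if (tail Q e \<in> set w) = (head Q e \<in> set w) then tail Q e else head Q e)"
    and "head (fold reflect_quiver w Q) e =
      (if (tail Q e \<in> set w) = (head Q e \<in> set w) then head Q e else tail Q e)"
proof -
  have "tail (fold reflect_quiver w Q) e =
      (if (tail Q e \<in> set w) = (head Q e \<in> set w) then tail Q e else head Q e) \<and>
    head (fold reflect_quiver w Q) e =
      (if (tail Q e \<in> set w) = (head Q e \<in> set w) then head Q e else tail Q e)"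
    using assms
  proof (induction w arbitrary: Q)
    case (Cons a w)
    have ends: "tail (reflect_quiver a Q) e = (if tail Q e = a \<or> head Q e = a then head Q e else tail Q e)"
      "head (reflect_quiver a Q) e = (if tail Q e = a \<or> head Q e = a then tail Q e else head Q e)"
      by (simp_all add: reflect_quiver_def)
    have ne: "tail (reflect_quiver a Q) e \<noteq> head (reflect_quiver a Q) e"
      using Cons.prems(2) by (auto simp: ends)
    have d: "distinct w" "a \<notin> set w" using Cons.prems by auto
    show ?case using Cons.IH[OF d(1) ne] d(2) Cons.prems(2) by (auto simp: ends)
  qed simp
  then show "tail (fold reflect_quiver w Q) e =
      (if (tail Q e \<in> set w) = (head Q e \<in> set w) then tail Q e else head Q e)"
    "head (fold reflect_quiver w Q) e =
      (if (tail Q e \<in> set w) = (head Q e \<in> set w) then head Q e else tail Q e)"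
    by blast+
qed

text \<open>
  Every arrow has two different ends, so it is reversed exactly twice.
\<close>

lemma same_quiver_after_admissible_ordering:
  assumes Q: "wf_digraph Q" and as: "admissible_ordering Q as"
  shows "same_quiver (fold reflect_quiver as Q) Q"
proof -
  have as': "admissible_seq Q as" "distinct as" "set as = verts Q"
    using as by (auto simp: admissible_ordering_def)
  have "tail (fold reflect_quiver as Q) e = tail Q e \<and> head (fold reflect_quiver as Q) e = head Q e"
    if e: "e \<in> arcs Q" for e
  proof -
    have v: "tail Q e \<in> set as" "head Q e \<in> set as"
      using e as'(3) wf_digraph.wellformed[OF Q] by auto
    then have "tail Q e \<noteq> head Q e" using admissible_seq_no_loop[OF as'(1) v(1) e] by auto
    then show ?thesis using fold_reflect_quiver_ends[OF as'(2), of Q e] v by simp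
  qed
  then show ?thesis by (simp add: same_quiver_def)
qed

lemma iterated_coxeter:
  assumes Q: "wf_digraph Q" and as: "admissible_ordering Q as"
  shows "reflect_rep_seq Q (concat (replicate r as)) M = (reflect_rep_seq Q as ^^ r) M"
    and "reflect_filt_seq Q (concat (replicate r as)) ds = (reflect_filt_seq Q as ^^ r) ds"
    and "admissible_seq Q (concat (replicate r as))"
    and "same_quiver (fold reflect_quiver (concat (replicate r as)) Q) Q"
proof -
  note same = same_quiver_after_admissible_ordering[OF Q as]
  show "reflect_rep_seq Q (concat (replicate r as)) M = (reflect_rep_seq Q as ^^ r) M"
    by (induction r arbitrary: M)
      (simp_all add: reflect_seq_append same_quiver_seq(1)[OF same] funpow_swap1)
  show "reflect_filt_seq Q (concat (replicate r as)) ds = (reflect_filt_seq Q as ^^ r) ds"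
    by (induction r arbitrary: ds)
      (simp_all add: reflect_seq_append same_quiver_seq(2)[OF same] funpow_swap1)
  show "admissible_seq Q (concat (replicate r as))"
    using as by (induction r)
      (simp_all add: reflect_seq_append same_quiver_seq(3)[OF same] admissible_ordering_def)
  have fold_same: "same_quiver (fold reflect_quiver w R) (fold reflect_quiver w R')"
    if "same_quiver R R'" for w R R'
    using that by (induction w arbitrary: R R') (auto intro: same_quiver_reflect_quiver)
  show "same_quiver (fold reflect_quiver (concat (replicate r as)) Q) Q"
  proof (induction r)
    case 0
    then show ?case by (simp add: same_quiver_def)
  next
    case (Suc r)
    show ?case
      using fold_same[OF same, of "concat (replicate r as)"] Suc by (auto simp: same_quiver_def)
  qed
qed

section \<open>Iterated reflections\<close>

lemma quiver_rep_reflect_seq: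
  assumes "vector_space s" "fin_digraph Q" "admissible_seq Q w" "quiver_rep (pscale s) Q M"
  shows "quiver_rep (pscale s) (fold reflect_quiver w Q) (reflect_rep_seq Q w M)"
  using assms
proof (induction w arbitrary: Q M)
  case (Cons a w)
  interpret rep_at_sink s Q a M using Cons.prems by (intro rep_at_sink.intro) auto
  show ?case
    using Cons.IH[OF Cons.prems(1) fin_digraph_reflect_quiver[OF Cons.prems(2)] _ quiver_rep_reflect_rep]
      Cons.prems(3) by simp
qed simp

lemma is_filtration_reflect_quiver [simp]:
  "is_filtration (reflect_quiver a Q) ds v \<longleftrightarrow> is_filtration Q ds v"
  by (simp add: is_filtration_def)

lemma dimvec_reflect_quiver [simp]: "dimvec s (reflect_quiver a Q) M = dimvec s Q M"
  by (simp add: dimvec_def)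

lemma all_le_Suc_iff: "(\<forall>p\<le>Suc n. P p) \<longleftrightarrow> P 0 \<and> (\<forall>p\<le>n. P (Suc p))"
  by (metis Suc_le_mono not0_implies_Suc zero_le)

abbreviation reflected_Fl ::
  "('k::field \<Rightarrow> 'v::ab_group_add \<Rightarrow> 'v) \<Rightarrow> ('a, 'b) pre_digraph \<Rightarrow> 'a list \<Rightarrow> ('a \<Rightarrow> int) list \<Rightarrow>
   ('a, 'b, 'b list \<Rightarrow> 'v) qrep \<Rightarrow> ('a \<Rightarrow> ('b list \<Rightarrow> 'v) set) list set" where
  "reflected_Fl s Q w ds M \<equiv> Fl (pscale s) (fold reflect_quiver w Q) (reflect_filt_seq Q w ds) (reflect_rep_seq Q w M)"

abbreviation reflected_is_filtration ::
  "('k::field \<Rightarrow> 'v::ab_group_add \<Rightarrow> 'v) \<Rightarrow> ('a, 'b) pre_digraph \<Rightarrow> 'a list \<Rightarrow> ('a \<Rightarrow> int) list \<Rightarrow>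
   ('a, 'b, 'b list \<Rightarrow> 'v) qrep \<Rightarrow> bool" where
  "reflected_is_filtration s Q w ds M \<equiv>
     is_filtration Q (reflect_filt_seq Q w ds) (dimvec (pscale s) Q (reflect_rep_seq Q w M))"

text \<open>
  Non-emptiness passes from the reflected flags back to the original ones only for filtrations,
  which is why every intermediate sequence enters the equivalence.
\<close>

theorem Fl_reflect_seq:
  fixes s :: "'k::field \<Rightarrow> 'v::ab_group_add \<Rightarrow> 'v"
  assumes "vector_space s" "fin_digraph Q" "admissible_seq Q w" "quiver_rep (pscale s) Q M"
  shows "Fl (pscale s) Q ds M \<noteq> {} \<longleftrightarrow>
      (\<forall>p \<le> length w. reflected_is_filtration s Q (take p w) ds M) \<and> reflected_Fl s Q w ds M \<noteq> {}"
    and "Fl (pscale s) Q ds M \<noteq> {} \<Longrightarrow> finite (UNIV :: 'k set) \<Longrightarrow>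
      [card (Fl (pscale s) Q ds M) = card (reflected_Fl s Q w ds M)] (mod card (UNIV :: 'k set))"
proof -
  have "(Fl (pscale s) Q ds M \<noteq> {} \<longleftrightarrow>
      (\<forall>p \<le> length w. reflected_is_filtration s Q (take p w) ds M) \<and> reflected_Fl s Q w ds M \<noteq> {}) \<and>
    (Fl (pscale s) Q ds M \<noteq> {} \<longrightarrow> finite (UNIV :: 'k set) \<longrightarrow>
      [card (Fl (pscale s) Q ds M) = card (reflected_Fl s Q w ds M)] (mod card (UNIV :: 'k set)))"
    using assms
  proof (induction w arbitrary: Q M ds)
    case Nil
    then show ?case
      using Fl_nonempty_imp_is_filtration[OF vector_space_pscale, of s Q M ds] by auto
  next
    case (Cons a w)
    interpret rep_at_sink s Q a M using Cons.prems by (intro rep_at_sink.intro) auto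
    have adm: "admissible_seq (reflect_quiver a Q) w" using Cons.prems by simp
    note IH = Cons.IH[OF Cons.prems(1) fin_digraph_reflect_quiver[OF Cons.prems(2)] adm
        quiver_rep_reflect_rep, of "reflect_filt Q a ds", simplified]
    have filt: "is_filtration Q ds (dimvec (pscale s) Q M)" if "Fl (pscale s) Q ds M \<noteq> {}"
      using Fl_nonempty_imp_is_filtration[OF VS.vector_space_axioms rep that] .
    note step = Fl_reflect_sink[of ds]
    let ?Fl' = "Fl (pscale s) (reflect_quiver a Q) (reflect_filt Q a ds) (reflect_rep Q a M)"
    have iff: "Fl (pscale s) Q ds M \<noteq> {} \<longleftrightarrow> is_filtration Q ds (dimvec (pscale s) Q M) \<and> ?Fl' \<noteq> {}"
      using filt step(1) by blast
    show ?case
    proof (intro conjI impI)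
      show "Fl (pscale s) Q ds M \<noteq> {} \<longleftrightarrow>
        (\<forall>p \<le> length (a # w). reflected_is_filtration s Q (take p (a # w)) ds M) \<and>
        reflected_Fl s Q (a # w) ds M \<noteq> {}"
        unfolding iff using IH by (simp add: all_le_Suc_iff)
      assume ne: "Fl (pscale s) Q ds M \<noteq> {}" and k: "finite (UNIV :: 'k set)"
      then have "?Fl' \<noteq> {}" using iff by blast
      then have "[card ?Fl' = card (reflected_Fl s Q (a # w) ds M)] (mod card (UNIV :: 'k set))"
        using IH k by simp
      with step(2)[OF filt[OF ne] k]
      show "[card (Fl (pscale s) Q ds M) = card (reflected_Fl s Q (a # w) ds M)] (mod card (UNIV :: 'k set))"
        by (rule cong_trans)
    qed
  qed
  then show "Fl (pscale s) Q ds M \<noteq> {} \<longleftrightarrow>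
      (\<forall>p \<le> length w. reflected_is_filtration s Q (take p w) ds M) \<and> reflected_Fl s Q w ds M \<noteq> {}"
    and "Fl (pscale s) Q ds M \<noteq> {} \<Longrightarrow> finite (UNIV :: 'k set) \<Longrightarrow>
      [card (Fl (pscale s) Q ds M) = card (reflected_Fl s Q w ds M)] (mod card (UNIV :: 'k set))"
    by blast+
qed

lemma Fl_zero_rep:
  assumes s: "vector_space s" and M: "quiver_rep s Q M" and Q: "wf_digraph Q" and zero: "zero_rep Q M"
  shows "Fl s Q ds M = (if zero_filt Q ds then {replicate (length ds + 2) (restrict (space M) (verts Q))} else {})"
proof -
  interpret vector_space s by fact
  interpret wf_digraph Q by fact
  let ?U = "restrict (space M) (verts Q)"
  have M0: "space M i = {0}" if "i \<in> verts Q" for i using zero that by (simp add: zero_rep_def)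
  have sub: "subrep s Q M U \<longleftrightarrow> U = ?U" for U
  proof
    assume U: "subrep s Q M U"
    show "U = ?U"
    proof
      fix i
      show "U i = ?U i"
      proof (cases "i \<in> verts Q")
        case True
        then have "subspace (U i)" "U i \<subseteq> {0}" using U M0 by (auto simp: subrep_def)
        then show ?thesis using True M0 subspace_0 by fastforce
      next
        case False
        then show ?thesis using U by (auto simp: subrep_def extensional_def)
      qed
    qed
  next
    have "rmap M e 0 = 0" if "e \<in> arcs Q" for e
    proof -
      have "linear_between s s (space M (tail Q e)) (space M (head Q e)) (rmap M e)"
        using M that by (simp add: quiver_rep_def)
      then show ?thesis using linear_between_zero[OF s s] M0 that by (metis tail_in_verts subspace_single_0)
    qed
    moreover assume "U = ?U"
    ultimately show "subrep s Q M U" using M0 by (auto simp: subrep_def)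
  qed
  have dims: "(\<forall>l < length ds + 2. \<forall>i\<in>verts Q. 0 = (full_filt ds (dimvec s Q M) ! l) i) \<longleftrightarrow> zero_filt Q ds"
  proof
    assume L: "\<forall>l < length ds + 2. \<forall>i\<in>verts Q. 0 = (full_filt ds (dimvec s Q M) ! l) i"
    have "(ds ! l) i = 0" if "l < length ds" "i \<in> verts Q" for l i
      using L[rule_format, of "Suc l" i] that by (simp add: full_filt_def nth_append)
    then show "zero_filt Q ds" by (auto simp: zero_filt_def in_set_conv_nth)
  next
    assume "zero_filt Q ds"
    then show "\<forall>l < length ds + 2. \<forall>i\<in>verts Q. 0 = (full_filt ds (dimvec s Q M) ! l) i"
      using M0 dim_zero_space
      by (auto simp: full_filt_def nth_Cons nth_append zero_filt_def dimvec_def split: nat.splits)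
  qed
  have dim: "(\<forall>i\<in>verts Q. int (dim (?U i)) = D i) \<longleftrightarrow> (\<forall>i\<in>verts Q. 0 = D i)" for D :: "_ \<Rightarrow> int"
    using M0 dim_zero_space by auto
  have "Us \<in> Fl s Q ds M \<longleftrightarrow> zero_filt Q ds \<and> Us = replicate (length ds + 2) ?U" for Us
  proof
    assume Us: "Us \<in> Fl s Q ds M"
    then have all: "Us ! l = ?U" if "l < length ds + 2" for l using that by (simp add: Fl_iff sub)
    have len: "length Us = length ds + 2" using Us by (simp add: Fl_iff)
    have "Us = replicate (length ds + 2) ?U"
      using len all by (intro nth_equalityI) (simp_all del: replicate_Suc)
    moreover have "\<forall>l < length ds + 2. \<forall>i\<in>verts Q. 0 = (full_filt ds (dimvec s Q M) ! l) i"
    proof (intro allI impI)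
      fix l assume l: "l < length ds + 2"
      have "\<forall>i\<in>verts Q. int (dim ((Us ! l) i)) = (full_filt ds (dimvec s Q M) ! l) i"
        using Us l unfolding Fl_iff by blast
      then show "\<forall>i\<in>verts Q. 0 = (full_filt ds (dimvec s Q M) ! l) i"
        unfolding all[OF l] dim .
    qed
    ultimately show "zero_filt Q ds \<and> Us = replicate (length ds + 2) ?U" using dims by blast
  next
    assume *: "zero_filt Q ds \<and> Us = replicate (length ds + 2) ?U"
    then have "Us ! l = ?U" if "l < length ds + 2" for l using that by (simp del: replicate_Suc)
    then show "Us \<in> Fl s Q ds M" unfolding Fl_iff using * dims dim by (simp add: sub M0 dim_zero_space del: replicate_Suc)
  qed
  then show ?thesis by auto
qed

section \<open>Isomorphic representations\<close>

definition rep_iso_by ::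
  "('k::field \<Rightarrow> 'v::ab_group_add \<Rightarrow> 'v) \<Rightarrow> ('k \<Rightarrow> 'w::ab_group_add \<Rightarrow> 'w) \<Rightarrow>
   ('a, 'b) pre_digraph \<Rightarrow> ('a, 'b, 'v) qrep \<Rightarrow> ('a, 'b, 'w) qrep \<Rightarrow> ('a \<Rightarrow> 'v \<Rightarrow> 'w) \<Rightarrow> bool" where
  "rep_iso_by s t Q M N f \<longleftrightarrow>
     (\<forall>i\<in>verts Q. linear_between s t (space M i) (space N i) (f i) \<and>
        bij_betw (f i) (space M i) (space N i)) \<and>
     (\<forall>e\<in>arcs Q. \<forall>x\<in>space M (tail Q e). f (head Q e) (rmap M e x) = rmap N e (f (tail Q e) x))"

lemma rep_iso_iff: "rep_iso s t Q M N \<longleftrightarrow> (\<exists>f. rep_iso_by s t Q M N f)"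
  by (simp add: rep_iso_def rep_iso_by_def)

lemma rep_iso_by_inverse:
  assumes s: "vector_space s" and Q: "wf_digraph Q" and M: "quiver_rep s Q M"
    and f: "rep_iso_by s t Q M N f"
  shows "rep_iso_by t s Q N M (\<lambda>i. inv_into (space M i) (f i))"
  unfolding rep_iso_by_def
proof (intro conjI ballI)
  interpret vector_space s by fact
  interpret wf_digraph Q by fact
  let ?g = "\<lambda>i. inv_into (space M i) (f i)"
  have bij: "bij_betw (f i) (space M i) (space N i)" and lin: "linear_between s t (space M i) (space N i) (f i)"
    if "i \<in> verts Q" for i using f that by (auto simp: rep_iso_by_def)
  have gf: "?g i (f i x) = x" if "i \<in> verts Q" "x \<in> space M i" for i x
    using bij[OF that(1)] that(2) by (simp add: bij_betw_def)
  have ex: "\<exists>x\<in>space M i. y = f i x" if "i \<in> verts Q" "y \<in> space N i" for i y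
    using bij[OF that(1)] that(2) by (auto simp: bij_betw_def)
  show "bij_betw (?g i) (space N i) (space M i)" if "i \<in> verts Q" for i
    using bij[OF that] by (rule bij_betw_inv_into)
  show "linear_between t s (space N i) (space M i) (?g i)" if i: "i \<in> verts Q" for i
    unfolding linear_between_def
  proof (intro conjI ballI allI)
    show "?g i ` space N i \<subseteq> space M i" using bij_betw_inv_into[OF bij[OF i]] by (simp add: bij_betw_def)
    have sub: "subspace (space M i)" using M i fin_dim_subspace_imp_subspace by (auto simp: quiver_rep_def)
    fix y assume "y \<in> space N i"
    then obtain x where x: "x \<in> space M i" "y = f i x" using ex[OF i] by blast
    show "?g i (y + y') = ?g i y + ?g i y'" if y': "y' \<in> space N i" for y'
    proof -
      obtain x' where x': "x' \<in> space M i" "y' = f i x'" using ex[OF i y'] by blast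
      have "y + y' = f i (x + x')" using lin[OF i] x x' by (simp add: linear_between_def)
      then show ?thesis using gf[OF i] x x' subspace_add[OF sub] by simp
    qed
    show "?g i (t c y) = s c (?g i y)" for c
    proof -
      have "t c y = f i (s c x)" using lin[OF i] x by (simp add: linear_between_def)
      then show ?thesis using gf[OF i] x subspace_scale[OF sub] by simp
    qed
  qed
  fix e y assume e: "e \<in> arcs Q" and y: "y \<in> space N (tail Q e)"
  then obtain x where x: "x \<in> space M (tail Q e)" "y = f (tail Q e) x" using ex[of "tail Q e"] by auto
  have "rmap M e ` space M (tail Q e) \<subseteq> space M (head Q e)"
    using M e by (simp add: quiver_rep_def linear_between_def)
  then have "rmap M e x \<in> space M (head Q e)" using x(1) by blast
  moreover have "f (head Q e) (rmap M e x) = rmap N e y" using f e x by (simp add: rep_iso_by_def)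
  ultimately have "?g (head Q e) (rmap N e y) = rmap M e x" using gf[of "head Q e"] e by fastforce
  then show "?g (head Q e) (rmap N e y) = rmap M e (?g (tail Q e) y)" using gf[of "tail Q e"] e x by simp
qed

definition map_flag ::
  "('a, 'b) pre_digraph \<Rightarrow> ('a \<Rightarrow> 'v \<Rightarrow> 'w) \<Rightarrow> ('a \<Rightarrow> 'v set) list \<Rightarrow> ('a \<Rightarrow> 'w set) list" where
  "map_flag Q f Us = map (\<lambda>U. restrict (\<lambda>i. f i ` U i) (verts Q)) Us"

lemma dim_image_rep_iso:
  assumes s: "vector_space s" and t: "vector_space t" and M: "quiver_rep s Q M"
    and f: "rep_iso_by s t Q M N f" and i: "i \<in> verts Q"
    and U: "module.subspace s U" "U \<subseteq> space M i"
  shows "module.subspace t (f i ` U)" "vector_space.dim t (f i ` U) = vector_space.dim s U"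
proof -
  interpret vs1: vector_space s by fact
  interpret vs2: vector_space t by fact
  have U': "fin_dim_subspace s U" using vs1.fin_dim_subspace_mono(1) M i U by (auto simp: quiver_rep_def)
  have lin: "linear_between s t U (space N i) (f i)"
    using f i U(2) unfolding rep_iso_by_def linear_between_def by blast
  have inj: "inj_on (f i) U"
    using f i inj_on_subset[OF _ U(2), of "f i"] by (simp add: rep_iso_by_def bij_betw_def)
  show "module.subspace t (f i ` U)" "vector_space.dim t (f i ` U) = vector_space.dim s U"
    using injective_image_fin_dim[OF s t U' lin inj] vs2.fin_dim_subspace_imp_subspace by auto
qed

lemma dimvec_rep_iso:
  assumes s: "vector_space s" and t: "vector_space t" and M: "quiver_rep s Q M"
    and f: "rep_iso_by s t Q M N f"
  shows "dimvec t Q N = dimvec s Q M"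
proof
  fix i
  interpret vs1: vector_space s by fact
  have "vector_space.dim t (space N i) = vector_space.dim s (space M i)" if i: "i \<in> verts Q"
  proof -
    have "f i ` space M i = space N i" using f i by (simp add: rep_iso_by_def bij_betw_def)
    moreover have "vs1.subspace (space M i)"
      using M i vs1.fin_dim_subspace_imp_subspace by (auto simp: quiver_rep_def)
    ultimately show ?thesis using dim_image_rep_iso(2)[OF s t M f i, of "space M i"] by simp
  qed
  then show "dimvec t Q N i = dimvec s Q M i" by (simp add: dimvec_def)
qed

lemma map_flag_in_Fl:
  assumes s: "vector_space s" and t: "vector_space t" and Q: "wf_digraph Q" and M: "quiver_rep s Q M"
    and f: "rep_iso_by s t Q M N f" and Us: "Us \<in> Fl s Q ds M"
  shows "map_flag Q f Us \<in> Fl t Q ds N"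
proof -
  interpret wf_digraph Q by fact
  have img: "f i ` space M i = space N i" if "i \<in> verts Q" for i
    using f that by (simp add: rep_iso_by_def bij_betw_def)
  have len: "length Us = length ds + 2" using Us by (simp add: Fl_iff)
  have sub: "subrep t Q N (restrict (\<lambda>i. f i ` U i) (verts Q))" if U: "subrep s Q M U" for U
    unfolding subrep_def
  proof (intro conjI ballI)
    fix i assume i: "i \<in> verts Q"
    have Ui: "module.subspace s (U i)" "U i \<subseteq> space M i" using U i by (auto simp: subrep_def)
    show "module.subspace t (restrict (\<lambda>i. f i ` U i) (verts Q) i)"
      using dim_image_rep_iso(1)[OF s t M f i Ui] i by simp
    show "restrict (\<lambda>i. f i ` U i) (verts Q) i \<subseteq> space N i" using img[OF i] Ui(2) i by auto
  next
    fix e assume e: "e \<in> arcs Q"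
    have "rmap N e (f (tail Q e) x) \<in> f (head Q e) ` U (head Q e)" if x: "x \<in> U (tail Q e)" for x
    proof -
      have "x \<in> space M (tail Q e)" using x U e by (auto simp: subrep_def)
      then have "rmap N e (f (tail Q e) x) = f (head Q e) (rmap M e x)"
        using f e by (simp add: rep_iso_by_def)
      moreover have "rmap M e ` U (tail Q e) \<subseteq> U (head Q e)" using U e by (simp add: subrep_def)
      then have "rmap M e x \<in> U (head Q e)" using x by blast
      ultimately show ?thesis by blast
    qed
    then show "rmap N e ` restrict (\<lambda>i. f i ` U i) (verts Q) (tail Q e)
        \<subseteq> restrict (\<lambda>i. f i ` U i) (verts Q) (head Q e)" using e by auto
  qed simp
  have nth: "map_flag Q f Us ! l = restrict (\<lambda>i. f i ` (Us ! l) i) (verts Q)" if "l < length ds + 2" for l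
    using that len by (simp add: map_flag_def)
  have last: "restrict (\<lambda>i. f i ` restrict (space M) (verts Q) i) (verts Q) = restrict (space N) (verts Q)"
    using img by (auto simp: restrict_def fun_eq_iff)
  show ?thesis
    unfolding Fl_iff
  proof (intro conjI allI impI ballI)
    show "length (map_flag Q f Us) = length ds + 2" using len by (simp add: map_flag_def)
    fix l assume l: "l < length ds + 2"
    have U: "subrep s Q M (Us ! l)" using Us l by (simp add: Fl_iff)
    show "subrep t Q N (map_flag Q f Us ! l)" using sub[OF U] nth[OF l] by simp
    fix i assume i: "i \<in> verts Q"
    have Ui: "module.subspace s ((Us ! l) i)" "(Us ! l) i \<subseteq> space M i" using U i by (auto simp: subrep_def)
    show "int (vector_space.dim t ((map_flag Q f Us ! l) i)) = (full_filt ds (dimvec t Q N) ! l) i"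
      using dim_image_rep_iso(2)[OF s t M f i Ui] nth[OF l] i Us l dimvec_rep_iso[OF s t M f]
      by (simp add: Fl_iff)
  next
    fix l i assume l: "l < length ds + 1" and i: "i \<in> verts Q"
    have "(Us ! l) i \<subseteq> (Us ! Suc l) i" using Us l i by (simp add: Fl_iff)
    then show "(map_flag Q f Us ! l) i \<subseteq> (map_flag Q f Us ! Suc l) i"
      using nth[of l] nth[of "Suc l"] l i by auto
  next
    show "map_flag Q f Us ! (length ds + 1) = restrict (space N) (verts Q)"
      using nth[of "length ds + 1"] Us last by (simp add: Fl_iff)
  qed
qed

lemma map_flag_inverse:
  assumes inv: "\<And>i x. i \<in> verts Q \<Longrightarrow> x \<in> space M i \<Longrightarrow> g i (f i x) = x"
    and Us: "Us \<in> Fl s Q ds M"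
  shows "map_flag Q g (map_flag Q f Us) = Us"
proof (rule nth_equalityI)
  fix l assume "l < length (map_flag Q g (map_flag Q f Us))"
  then have l: "l < length Us" by (simp add: map_flag_def)
  then have U: "subrep s Q M (Us ! l)" using Us by (simp add: Fl_iff)
  have "g i ` f i ` (Us ! l) i = (Us ! l) i" if i: "i \<in> verts Q" for i
  proof -
    have "g i (f i x) = x" if "x \<in> (Us ! l) i" for x
      using inv[OF i] U i that by (auto simp: subrep_def)
    then show ?thesis by (auto simp: image_image)
  qed
  moreover have "Us ! l \<in> extensional (verts Q)" using U by (simp add: subrep_def)
  ultimately have "restrict (\<lambda>i. g i ` restrict (\<lambda>i. f i ` (Us ! l) i) (verts Q) i) (verts Q) = Us ! l"
    by (auto simp: fun_eq_iff restrict_def extensional_def)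
  then show "map_flag Q g (map_flag Q f Us) ! l = Us ! l" using l by (simp add: map_flag_def)
qed (simp add: map_flag_def)

text \<open>
  Besides the invariance under isomorphism, this allows replacing a representation by its lift, on
  which the reflections act.
\<close>

theorem Fl_rep_iso:
  assumes s: "vector_space s" and t: "vector_space t" and Q: "wf_digraph Q"
    and M: "quiver_rep s Q M" and N: "quiver_rep t Q N" and iso: "rep_iso s t Q M N"
  shows "\<exists>h. bij_betw h (Fl s Q ds M) (Fl t Q ds N)"
proof -
  obtain f where f: "rep_iso_by s t Q M N f" using iso rep_iso_iff by blast
  let ?g = "\<lambda>i. inv_into (space M i) (f i)"
  have g: "rep_iso_by t s Q N M ?g" using rep_iso_by_inverse[OF s Q M f] .
  have gf: "?g i (f i x) = x" if "i \<in> verts Q" "x \<in> space M i" for i x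
    using f that by (simp add: rep_iso_by_def bij_betw_def)
  have fg: "f i (?g i x) = x" if "i \<in> verts Q" "x \<in> space N i" for i x
    using f that by (auto simp: rep_iso_by_def bij_betw_def intro!: f_inv_into_f)
  have "bij_betw (map_flag Q f) (Fl s Q ds M) (Fl t Q ds N)"
    using map_flag_inverse[where g = ?g and f = f, OF gf] map_flag_inverse[where g = f and f = ?g, OF fg]
      map_flag_in_Fl[OF s t Q M f] map_flag_in_Fl[OF t s Q N g]
    by (intro bij_betw_byWitness[where f' = "map_flag Q ?g"]) auto
  then show ?thesis by blast
qed

lemma at_Nil_simps [simp]:
  "at_Nil x [] = x" "at_Nil (0 :: 'v::zero) = 0"
  "at_Nil (x + y :: 'w::ab_group_add) = at_Nil x + at_Nil y"
  "at_Nil x = at_Nil y \<longleftrightarrow> x = y"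
  by (auto simp: at_Nil_def fun_eq_iff)

lemma at_Nil_pscale: "vector_space s \<Longrightarrow> at_Nil (s c x) = pscale s c (at_Nil x)"
  by (auto simp: at_Nil_def pscale_def fun_eq_iff vector_space.scale_eq_0_iff)

lemma linear_at_Nil: "vector_space s \<Longrightarrow> linear_between s (pscale s) V (at_Nil ` V) at_Nil"
  by (simp add: linear_between_def at_Nil_pscale)

lemma quiver_rep_lift_rep:
  assumes s: "vector_space s" and Q: "wf_digraph Q" and M: "quiver_rep s Q M"
  shows "quiver_rep (pscale s) Q (lift_rep M)"
  unfolding quiver_rep_def
proof (intro conjI ballI)
  fix i assume "i \<in> verts Q"
  then have "fin_dim_subspace s (space M i)" using M by (simp add: quiver_rep_def)
  then show "fin_dim_subspace (pscale s) (space (lift_rep M) i)"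
    using injective_image_fin_dim(1)[OF s vector_space_pscale[OF s] _ linear_at_Nil[OF s]]
    by (simp add: lift_rep_def inj_on_def)
next
  interpret vector_space s by fact
  interpret wf_digraph Q by fact
  fix e assume e: "e \<in> arcs Q"
  have lin: "linear_between s s (space M (tail Q e)) (space M (head Q e)) (rmap M e)"
    using M e by (simp add: quiver_rep_def)
  have sub: "subspace (space M (tail Q e))"
    using M e fin_dim_subspace_imp_subspace by (auto simp: quiver_rep_def)
  show "linear_between (pscale s) (pscale s) (space (lift_rep M) (tail Q e))
      (space (lift_rep M) (head Q e)) (rmap (lift_rep M) e)"
    using lin sub
    by (auto simp: linear_between_def lift_rep_def at_Nil_pscale[OF s, symmetric] pscale_def at_Nil_pscale[OF s])
qed

lemma rep_iso_lift_rep: "vector_space s \<Longrightarrow> rep_iso s (pscale s) Q M (lift_rep M)"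
  unfolding rep_iso_iff rep_iso_by_def
  by (intro exI[of _ "\<lambda>_. at_Nil"]) (auto simp: lift_rep_def linear_at_Nil bij_betw_def inj_on_def)

section \<open>The criterion for non-emptiness\<close>

text \<open>
  Reflecting along \<open>r\<close> rounds of the admissible ordering ends at the zero representation, whose
  flags are known.
\<close>

theorem Fl_nonempty_iff:
  fixes s :: "'k::field \<Rightarrow> 'v::ab_group_add \<Rightarrow> 'v"
  assumes s: "vector_space s" and Q: "fin_digraph Q" and as: "admissible_ordering Q as"
    and M: "quiver_rep s Q M" and zero: "cox_vanishes Q as r M"
  shows "Fl s Q ds M \<noteq> {} \<longleftrightarrow>
        zero_filt Q ((reflect_filt_seq Q as ^^ r) ds) \<and>
        (\<forall>p \<le> r * length as. is_filtration Q (reflect_filt_seq Q (take p (concat (replicate r as))) ds)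
             (dimvec (pscale s) Q (reflect_rep_seq Q (take p (concat (replicate r as))) (lift_rep M))))"
    and "finite (UNIV :: 'k set) \<Longrightarrow> Fl s Q ds M \<noteq> {} \<Longrightarrow>
      [card (Fl s Q ds M) = 1] (mod card (UNIV :: 'k set))"
proof -
  have wf: "wf_digraph Q" using Q by (rule fin_digraph.axioms(1))
  let ?w = "concat (replicate r as)" and ?M = "lift_rep M :: (_, _, 'b list \<Rightarrow> 'v) qrep"
  let ?Q = "fold reflect_quiver ?w Q"
  note cox = iterated_coxeter[OF wf as, where r = r]
  have M': "quiver_rep (pscale s) Q ?M" using quiver_rep_lift_rep[OF s wf M] .
  obtain h where h: "bij_betw h (Fl s Q ds M) (Fl (pscale s) Q ds ?M)"
    using Fl_rep_iso[OF s vector_space_pscale[OF s] wf M M' rep_iso_lift_rep[OF s]] by blast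
  have ne: "Fl s Q ds M \<noteq> {} \<longleftrightarrow> Fl (pscale s) Q ds ?M \<noteq> {}"
    unfolding bij_betw_imp_surj_on[OF h, symmetric] by (simp only: image_is_empty)
  have z: "zero_rep ?Q (reflect_rep_seq Q ?w ?M)"
    using zero by (simp add: cox_vanishes_def zero_rep_def cox(1))
  have end': "Fl (pscale s) ?Q (reflect_filt_seq Q ?w ds) (reflect_rep_seq Q ?w ?M) =
      (if zero_filt Q ((reflect_filt_seq Q as ^^ r) ds) then
        {replicate (length (reflect_filt_seq Q ?w ds) + 2)
          (restrict (space (reflect_rep_seq Q ?w ?M)) (verts ?Q))} else {})"
    using Fl_zero_rep[OF vector_space_pscale[OF s] quiver_rep_reflect_seq[OF s Q cox(3) M']
        fin_digraph.axioms(1)[OF fin_digraph_fold_reflect_quiver[OF Q]] z]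
    by (simp add: zero_filt_def cox(2))
  have len: "length ?w = r * length as" by (simp add: length_concat sum_list_replicate)
  note main = Fl_reflect_seq[OF s Q cox(3) M', of ds, unfolded end' len]
  show "Fl s Q ds M \<noteq> {} \<longleftrightarrow>
        zero_filt Q ((reflect_filt_seq Q as ^^ r) ds) \<and>
        (\<forall>p \<le> r * length as. is_filtration Q (reflect_filt_seq Q (take p ?w) ds)
             (dimvec (pscale s) Q (reflect_rep_seq Q (take p ?w) ?M)))"
    unfolding ne main(1) by auto
  assume k: "finite (UNIV :: 'k set)" and "Fl s Q ds M \<noteq> {}"
  then have ne': "Fl (pscale s) Q ds ?M \<noteq> {}" using ne by blast
  then have "zero_filt Q ((reflect_filt_seq Q as ^^ r) ds)" using main(1) by (auto split: if_splits)
  then show "[card (Fl s Q ds M) = 1] (mod card (UNIV :: 'k set))"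
    using main(2)[OF ne' k] by (simp add: bij_betw_same_card[OF h])
qed

section \<open>Splittings and indecomposables\<close>

text \<open>
  Internal direct sums of two subrepresentations; unlike for \<open>internal_direct_sum\<close>, the families
  are arbitrary off the vertex set.
\<close>

definition splits ::
  "('k::field \<Rightarrow> 'v::ab_group_add \<Rightarrow> 'v) \<Rightarrow> ('a, 'b) pre_digraph \<Rightarrow> ('a, 'b, 'v) qrep \<Rightarrow>
   ('a \<Rightarrow> 'v set) \<Rightarrow> ('a \<Rightarrow> 'v set) \<Rightarrow> bool" where
  "splits s Q M A B \<longleftrightarrow>
     (\<forall>i\<in>verts Q. module.subspace s (A i) \<and> module.subspace s (B i) \<and> A i \<inter> B i = {0} \<and>
        space M i = {x + y |x y. x \<in> A i \<and> y \<in> B i}) \<and>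
     (\<forall>e\<in>arcs Q. rmap M e ` A (tail Q e) \<subseteq> A (head Q e) \<and> rmap M e ` B (tail Q e) \<subseteq> B (head Q e))"

text \<open>
  Indecomposability in terms of \<open>splits\<close>; it follows from \<open>indecomposable\<close>, and is the form that
  passes to reflections.
\<close>

definition indec ::
  "('k::field \<Rightarrow> 'v::ab_group_add \<Rightarrow> 'v) \<Rightarrow> ('a, 'b) pre_digraph \<Rightarrow> ('a, 'b, 'v) qrep \<Rightarrow> bool" where
  "indec s Q M \<longleftrightarrow> \<not> zero_rep Q M \<and>
     (\<forall>A B. splits s Q M A B \<longrightarrow> (\<forall>i\<in>verts Q. A i = {0}) \<or> (\<forall>i\<in>verts Q. B i = {0}))"

lemma splits_sym:
  fixes M :: "('a, 'b, 'v::ab_group_add) qrep"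
  assumes "splits s Q M A B"
  shows "splits s Q M B A"
proof -
  have "{x + y |x y. x \<in> X \<and> y \<in> Y} = {x + y |x y. x \<in> Y \<and> y \<in> X}" for X Y :: "'v set"
  proof -
    have "{x + y |x y. x \<in> X \<and> y \<in> Y} \<subseteq> {x + y |x y. x \<in> Y \<and> y \<in> X}" for X Y :: "'v set"
      using add.commute by blast
    then show ?thesis by (intro equalityI)
  qed
  then show ?thesis using assms by (simp add: splits_def Int_commute)
qed

lemma splits_subset:
  assumes s: "vector_space s" and M: "splits s Q M A B" and i: "i \<in> verts Q"
  shows "A i \<subseteq> space M i" "B i \<subseteq> space M i"
proof -
  interpret vector_space s by fact
  have *: "subspace (A i)" "subspace (B i)" "space M i = {x + y |x y. x \<in> A i \<and> y \<in> B i}"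
    using M i by (auto simp: splits_def)
  show "A i \<subseteq> space M i"
  proof
    fix x assume "x \<in> A i"
    then have "x + 0 \<in> space M i" using * subspace_0 by blast
    then show "x \<in> space M i" by simp
  qed
  show "B i \<subseteq> space M i"
  proof
    fix x assume "x \<in> B i"
    then have "0 + x \<in> space M i" using * subspace_0 by blast
    then show "x \<in> space M i" by simp
  qed
qed

lemma quiver_rep_splits:
  assumes s: "vector_space s" and Q: "wf_digraph Q" and M: "quiver_rep s Q M" and AB: "splits s Q M A B"
  shows "quiver_rep s Q (M\<lparr>space := A\<rparr>)" "quiver_rep s Q (M\<lparr>space := B\<rparr>)"
proof -
  interpret vector_space s by fact
  interpret wf_digraph Q by fact
  have *: "quiver_rep s Q (M\<lparr>space := A\<rparr>)" if AB: "splits s Q M A B" for A B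
    unfolding quiver_rep_def
  proof (intro conjI ballI)
    fix i assume i: "i \<in> verts Q"
    show "fin_dim_subspace s (space (M\<lparr>space := A\<rparr>) i)"
      using fin_dim_subspace_mono(1)[of "space M i" "A i"] M AB splits_subset(1)[OF s AB i] i
      by (simp add: quiver_rep_def splits_def)
  next
    fix e assume e: "e \<in> arcs Q"
    have "A (tail Q e) \<subseteq> space M (tail Q e)" using splits_subset(1)[OF s AB] e by simp
    moreover have "linear_between s s (space M (tail Q e)) (space M (head Q e)) (rmap M e)"
      using M e by (simp add: quiver_rep_def)
    moreover have "rmap M e ` A (tail Q e) \<subseteq> A (head Q e)" using AB e by (simp add: splits_def)
    ultimately show "linear_between s s (space (M\<lparr>space := A\<rparr>) (tail Q e)) (space (M\<lparr>space := A\<rparr>) (head Q e))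
        (rmap (M\<lparr>space := A\<rparr>) e)"
      unfolding linear_between_def by (simp add: subset_iff)
  qed
  show "quiver_rep s Q (M\<lparr>space := A\<rparr>)" using *[OF AB] .
  show "quiver_rep s Q (M\<lparr>space := B\<rparr>)" using *[OF splits_sym[OF AB]] .
qed

lemma dimvec_splits:
  assumes s: "vector_space s" and M: "quiver_rep s Q M" and AB: "splits s Q M A B"
  shows "dimvec s Q M = dimvec s Q (M\<lparr>space := A\<rparr>) + dimvec s Q (M\<lparr>space := B\<rparr>)"
proof
  fix i
  interpret vector_space s by fact
  have "dim (space M i) = dim (A i) + dim (B i)" if i: "i \<in> verts Q"
  proof -
    have *: "subspace (A i)" "subspace (B i)" "A i \<inter> B i = {0}"
        "space M i = {x + y |x y. x \<in> A i \<and> y \<in> B i}"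
      using AB i by (auto simp: splits_def)
    have "fin_dim_subspace s (space M i)" using M i by (simp add: quiver_rep_def)
    then have "fin_dim_subspace s (A i)" "fin_dim_subspace s (B i)"
      using fin_dim_subspace_mono(1) * splits_subset[OF s AB i] by blast+
    then show ?thesis using dim_direct_sum(2)[OF _ _ *(3)] *(4) by simp
  qed
  then show "dimvec s Q M i = (dimvec s Q (M\<lparr>space := A\<rparr>) + dimvec s Q (M\<lparr>space := B\<rparr>)) i"
    by (simp add: dimvec_def)
qed

lemma splits_image:
  assumes s: "vector_space s" and t: "vector_space t" and Q: "wf_digraph Q" and M: "quiver_rep s Q M"
    and f: "rep_iso_by s t Q M N f" and AB: "splits s Q M A B"
  shows "splits t Q N (\<lambda>i. f i ` A i) (\<lambda>i. f i ` B i)"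
  unfolding splits_def
proof (intro conjI ballI)
  interpret vs1: vector_space s by fact
  interpret vs2: vector_space t by fact
  interpret wf_digraph Q by fact
  fix i assume i: "i \<in> verts Q"
  note sub = splits_subset[OF s AB i]
  have *: "vs1.subspace (A i)" "vs1.subspace (B i)" "A i \<inter> B i = {0}"
        "space M i = {x + y |x y. x \<in> A i \<and> y \<in> B i}"
      using AB i by (auto simp: splits_def)
  show 1: "vs2.subspace (f i ` A i)" "vs2.subspace (f i ` B i)"
    using dim_image_rep_iso(1)[OF s t M f i] * sub by auto
  have lin: "linear_between s t (space M i) (space N i) (f i)" and inj: "inj_on (f i) (space M i)"
    and img: "f i ` space M i = space N i"
    using f i by (auto simp: rep_iso_by_def bij_betw_def)
  have f0: "f i 0 = 0"
    using linear_between_zero[OF s t lin] M i vs1.fin_dim_subspace_imp_subspace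
    by (auto simp: quiver_rep_def)
  show "f i ` A i \<inter> f i ` B i = {0}"
    using inj_on_image_Int[OF inj sub] * f0 by simp
  have add: "f i (x + y) = f i x + f i y" if "x \<in> A i" "y \<in> B i" for x y
  proof -
    have "x \<in> space M i" "y \<in> space M i" using sub that by blast+
    then show ?thesis using lin by (simp add: linear_between_def)
  qed
  have "space N i = {f i (x + y) |x y. x \<in> A i \<and> y \<in> B i}" unfolding img[symmetric] *(4) by blast
  also have "\<dots> = {x + y |x y. x \<in> f i ` A i \<and> y \<in> f i ` B i}" using add by force
  finally show "space N i = {x + y |x y. x \<in> f i ` A i \<and> y \<in> f i ` B i}" .
next
  interpret wf_digraph Q by fact
  have closed: "rmap N e ` f (tail Q e) ` X (tail Q e) \<subseteq> f (head Q e) ` X (head Q e)"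
    if e: "e \<in> arcs Q" and X: "X (tail Q e) \<subseteq> space M (tail Q e)" "rmap M e ` X (tail Q e) \<subseteq> X (head Q e)" for e X
  proof -
    have "rmap N e (f (tail Q e) x) \<in> f (head Q e) ` X (head Q e)" if x: "x \<in> X (tail Q e)" for x
    proof -
      have "rmap N e (f (tail Q e) x) = f (head Q e) (rmap M e x)"
        using f e x X(1) unfolding rep_iso_by_def by (metis subsetD)
      then show ?thesis using X(2) x by blast
    qed
    then show ?thesis by blast
  qed
  fix e assume e: "e \<in> arcs Q"
  then have "tail Q e \<in> verts Q" by simp
  note sub = splits_subset[OF s AB this]
  show "rmap N e ` f (tail Q e) ` A (tail Q e) \<subseteq> f (head Q e) ` A (head Q e)"
    using closed[OF e, of A] sub AB e by (simp add: splits_def)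
  show "rmap N e ` f (tail Q e) ` B (tail Q e) \<subseteq> f (head Q e) ` B (head Q e)"
    using closed[OF e, of B] sub AB e by (simp add: splits_def)
qed

lemma zero_rep_iso:
  assumes s: "vector_space s" and t: "vector_space t" and M: "quiver_rep s Q M"
    and f: "rep_iso_by s t Q M N f" and z: "zero_rep Q M"
  shows "zero_rep Q N"
  unfolding zero_rep_def
proof
  interpret vs1: vector_space s by fact
  fix i assume i: "i \<in> verts Q"
  have lin: "linear_between s t (space M i) (space N i) (f i)" and img: "f i ` space M i = space N i"
    using f i by (auto simp: rep_iso_by_def bij_betw_def)
  have "f i 0 = 0"
    using linear_between_zero[OF s t lin] M i vs1.fin_dim_subspace_imp_subspace
    by (auto simp: quiver_rep_def)
  then show "space N i = {0}" using img z i by (auto simp: zero_rep_def)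
qed

lemma indec_rep_iso:
  assumes s: "vector_space s" and t: "vector_space t" and Q: "wf_digraph Q"
    and M: "quiver_rep s Q M" and N: "quiver_rep t Q N" and iso: "rep_iso s t Q M N"
    and ind: "indec s Q M"
  shows "indec t Q N"
proof -
  interpret vs2: vector_space t by fact
  obtain f where f: "rep_iso_by s t Q M N f" using iso rep_iso_iff by blast
  let ?g = "\<lambda>i. inv_into (space M i) (f i)"
  have g: "rep_iso_by t s Q N M ?g" using rep_iso_by_inverse[OF s Q M f] .
  have zero: "X i = {0}" if "splits t Q N A B" "X = A \<or> X = B" "?g i ` X i = {0}" "i \<in> verts Q" for A B X i
  proof -
    have "X i \<subseteq> space N i" "vs2.subspace (X i)"
      using that(2) splits_subset[OF t that(1,4)] that(1,4) by (auto simp: splits_def)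
    moreover have "inj_on (?g i) (space N i)" "?g i 0 = 0"
    proof -
      have "linear_between t s (space N i) (space M i) (?g i)" using g that(4) by (simp add: rep_iso_by_def)
      moreover have "vs2.subspace (space N i)"
        using N that(4) vs2.fin_dim_subspace_imp_subspace by (auto simp: quiver_rep_def)
      ultimately show "?g i 0 = 0" using linear_between_zero[OF t s] by blast
      show "inj_on (?g i) (space N i)" using g that(4) by (simp add: rep_iso_by_def bij_betw_def)
    qed
    ultimately have sub: "X i \<subseteq> space N i" and X0: "0 \<in> X i" and inj: "inj_on (?g i) (space N i)"
        and g0: "?g i 0 = 0"
      using vs2.subspace_0 by auto
    have "x = 0" if x: "x \<in> X i" for x
    proof -
      have "?g i x \<in> ?g i ` X i" using x by (rule imageI)
      then have "?g i x = 0" using \<open>?g i ` X i = {0}\<close> by simp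
      then show "x = 0" using inj_onD[OF inj, of x 0] g0 sub x X0 by auto
    qed
    then have "X i = {0}" using X0 by blast
    then show ?thesis .
  qed
  show ?thesis
    unfolding indec_def
  proof (intro conjI allI impI)
    show "\<not> zero_rep Q N" using zero_rep_iso[OF t s N g] ind by (auto simp: indec_def)
    fix A B assume AB: "splits t Q N A B"
    have "splits s Q M (\<lambda>i. ?g i ` A i) (\<lambda>i. ?g i ` B i)" using splits_image[OF t s Q N g AB] .
    then have "(\<forall>i\<in>verts Q. ?g i ` A i = {0}) \<or> (\<forall>i\<in>verts Q. ?g i ` B i = {0})"
      using ind unfolding indec_def by blast
    then show "(\<forall>i\<in>verts Q. A i = {0}) \<or> (\<forall>i\<in>verts Q. B i = {0})"
      using zero[OF AB, of A] zero[OF AB, of B] by blast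
  qed
qed

lemma indecomposable_imp_indec:
  assumes s: "vector_space s" and Q: "wf_digraph Q" and M: "indecomposable s Q M"
  shows "indec s Q M"
  unfolding indec_def
proof (intro conjI allI impI)
  interpret vector_space s by fact
  interpret wf_digraph Q by fact
  show "\<not> zero_rep Q M" using M by (simp add: indecomposable_def)
  fix A B assume AB: "splits s Q M A B"
  let ?A = "restrict A (verts Q)" and ?B = "restrict B (verts Q)"
  have "internal_direct_sum s Q M [?A, ?B]"
    unfolding internal_direct_sum_def
  proof (intro conjI ballI)
    fix U assume U: "U \<in> set [?A, ?B]"
    have "subrep s Q M ?A" "subrep s Q M ?B"
      using AB splits_subset[OF s AB] by (auto simp: subrep_def splits_def)
    then show "subrep s Q M U" using U by auto
  next
    fix i x assume i: "i \<in> verts Q" and x: "x \<in> space M i"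
    have *: "subspace (A i)" "subspace (B i)" "A i \<inter> B i = {0}"
        "space M i = {x + y |x y. x \<in> A i \<and> y \<in> B i}"
      using AB i by (auto simp: splits_def)
    obtain p q where pq: "x = p + q" "p \<in> A i" "q \<in> B i" using x *(4) by blast
    show "\<exists>!xs. length xs = length [?A, ?B] \<and> (\<forall>l<length [?A, ?B]. xs ! l \<in> ([?A, ?B] ! l) i) \<and> sum_list xs = x"
    proof (rule ex1I[of _ "[p, q]"])
      show "length [p, q] = length [?A, ?B] \<and> (\<forall>l<length [?A, ?B]. [p, q] ! l \<in> ([?A, ?B] ! l) i) \<and> sum_list [p, q] = x"
        using pq i by (simp add: all_less_Suc_iff)
      fix xs assume xs: "length xs = length [?A, ?B] \<and> (\<forall>l<length [?A, ?B]. xs ! l \<in> ([?A, ?B] ! l) i) \<and> sum_list xs = x"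
      then obtain p' q' where xs': "xs = [p', q']"
        by (auto simp: length_Suc_conv)
      then have pq': "p' \<in> A i" "q' \<in> B i" "x = p' + q'" using xs i by (auto simp: all_less_Suc_iff)
      have "p - p' \<in> A i" using *(1) pq pq' subspace_diff by blast
      moreover have "p - p' = q' - q" using pq(1) pq'(3) by (simp add: algebra_simps)
      then have "p - p' \<in> B i" using *(2) pq pq' subspace_diff by simp
      ultimately have "p - p' = 0" using *(3) by blast
      then show "xs = [p, q]" using xs' pq(1) pq'(3) by simp
    qed
  qed
  then have "zero_rep Q (M\<lparr>space := ?A\<rparr>) \<or> zero_rep Q (M\<lparr>space := ?B\<rparr>)"
    using M by (simp add: indecomposable_def)
  then show "(\<forall>i\<in>verts Q. A i = {0}) \<or> (\<forall>i\<in>verts Q. B i = {0})"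
    by (simp add: zero_rep_def)
qed

section \<open>Reflections of split and indecomposable representations\<close>

context rep_at_sink
begin

abbreviation "reflect_space A \<equiv> (\<lambda>i. if i = a then kernel_of A else A i)"

lemma reflect_rep_space_update:
  "reflect_rep Q a (M\<lparr>space := A\<rparr>) = (reflect_rep Q a M)\<lparr>space := reflect_space A\<rparr>"
  by (simp add: reflect_rep_def phi_def cong: if_cong)

lemma splits_subspace_family:
  assumes "splits s Q M A B"
  shows "subspace_family A" "subspace_family B"
  using assms splits_subset[OF VS.vector_space_axioms assms]
  by (auto simp: subspace_family_def splits_def)

text \<open>
  Decomposing every entry of \<open>u\<close> separately.
\<close>

lemma arrows_into_split:
  assumes sum: "\<And>i. i \<in> verts Q - {a} \<Longrightarrow> space M i = {x + y |x y. x \<in> A i \<and> y \<in> B i}"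
    and u: "u \<in> arrows_into (space M)"
  obtains v w where "v \<in> arrows_into A" "w \<in> arrows_into B" "u = v + w"
proof -
  have "\<forall>e\<in>in_arcs Q a. \<exists>x. x \<in> A (tail Q e) \<and> component e u - x \<in> B (tail Q e)"
  proof
    fix e assume e: "e \<in> in_arcs Q a"
    then have "component e u \<in> space M (tail Q e)" using u by (simp add: arrow_sum_def)
    then obtain x y where "x \<in> A (tail Q e)" "y \<in> B (tail Q e)" "component e u = x + y"
      using sum[OF tail_in_arc[OF e]] by blast
    then show "\<exists>x. x \<in> A (tail Q e) \<and> component e u - x \<in> B (tail Q e)"
      by (intro exI[of _ x]) simp
  qed
  then obtain c where c: "\<And>e. e \<in> in_arcs Q a \<Longrightarrow> c e \<in> A (tail Q e) \<and> component e u - c e \<in> B (tail Q e)"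
    by metis
  define v where "v = (\<lambda>w. case w of [] \<Rightarrow> 0 | e # w' \<Rightarrow> if e \<in> in_arcs Q a then c e w' else 0)"
  have cv: "component e v = (if e \<in> in_arcs Q a then c e else 0)" for e
    by (simp add: component_def v_def fun_eq_iff del: in_in_arcs_conv)
  have v0: "v [] = 0" by (simp add: v_def)
  have "v \<in> arrows_into A" using c v0 by (simp add: arrow_sum_def cv del: in_in_arcs_conv)
  moreover have "component e (u - v) = component e u - component e v" for e
    by (simp add: component_def fun_eq_iff)
  then have "u - v \<in> arrows_into B"
    using c v0 u by (simp add: arrow_sum_def cv del: in_in_arcs_conv)
  ultimately show thesis using that[of v "u - v"] by simp
qed

lemma arrows_into_disjoint:
  assumes disj: "\<And>i. i \<in> verts Q - {a} \<Longrightarrow> A i \<inter> B i = {0}"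
    and u: "u \<in> arrows_into A" "u \<in> arrows_into B"
  shows "u = 0"
proof (rule arrow_family_eqI)
  show "u [] = 0 []" using u by (simp add: arrow_sum_def)
  show "component e u = component e 0" for e
  proof (cases "e \<in> in_arcs Q a")
    case True
    then have "component e u \<in> A (tail Q e) \<inter> B (tail Q e)" using u by (simp add: arrow_sum_def)
    then show ?thesis using disj[OF tail_in_arc[OF True]] by simp
  next
    case False
    then show ?thesis using u by (simp add: arrow_sum_def del: in_in_arcs_conv)
  qed
qed

lemma image_of_subset_if_closed:
  assumes A: "subspace_family A" "VS.subspace (A a)"
    and closed: "\<And>e. e \<in> arcs Q \<Longrightarrow> rmap M e ` A (tail Q e) \<subseteq> A (head Q e)"
  shows "image_of A \<subseteq> A a"
  unfolding image_of_subset_iff[OF A]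
proof
  fix e assume "e \<in> in_arcs Q a"
  then show "rmap M e ` A (tail Q e) \<subseteq> A a" using closed[of e] by simp
qed

lemma phi_add:
  assumes "u \<in> arrows_into (space M)" "v \<in> arrows_into (space M)"
  shows "phi Q a M (u + v) = phi Q a M u + phi Q a M v"
  using phi_linear[OF subspace_family_space] assms by (simp add: linear_between_def)

lemma phi_zero: "phi Q a M 0 = 0"
  unfolding phi_def using rmap_zero by (intro sum.neutral) simp

lemma reflect_arc_cases:
  assumes "e \<in> arcs (reflect_quiver a Q)"
  obtains (star) "e \<in> in_arcs Q a" "tail (reflect_quiver a Q) e = a"
      "head (reflect_quiver a Q) e = tail Q e" "rmap (reflect_rep Q a M) e = component e" "tail Q e \<noteq> a"
    | (other) "e \<in> arcs Q" "e \<notin> in_arcs Q a" "tail (reflect_quiver a Q) e = tail Q e"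
      "head (reflect_quiver a Q) e = head Q e" "rmap (reflect_rep Q a M) e = rmap M e"
      "tail Q e \<noteq> a" "head Q e \<noteq> a"
proof (cases "head Q e = a")
  case True
  then show thesis
    using assms star reflect_quiver_ends(1)[of e] no_out_arcs[of e] by (simp add: reflect_rep_simps)
next
  case False
  then show thesis
    using assms other reflect_quiver_ends(2)[of e] no_out_arcs[of e] by (simp add: reflect_rep_simps)
qed

text \<open>
  If \<open>u = v + w\<close> is the decomposition of an element of the kernel of \<open>\<phi>\<^sub>a\<close>, then \<open>\<phi>\<^sub>a v = - \<phi>\<^sub>a w\<close>
  lies in both summands at \<open>a\<close>, hence vanishes: kernels decompose like the representation.
\<close>

lemma splits_reflect:
  assumes AB: "splits s Q M A B"
  shows "splits s (reflect_quiver a Q) (reflect_rep Q a M) (reflect_space A) (reflect_space B)"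
proof -
  note fam = splits_subspace_family[OF AB]
  have sum: "space M i = {x + y |x y. x \<in> A i \<and> y \<in> B i}" and disj: "A i \<inter> B i = {0}"
    and sub: "VS.subspace (A i)" "VS.subspace (B i)" if "i \<in> verts Q" for i
    using AB that by (auto simp: splits_def)
  have closed: "rmap M e ` A (tail Q e) \<subseteq> A (head Q e)" "rmap M e ` B (tail Q e) \<subseteq> B (head Q e)"
    if "e \<in> arcs Q" for e using AB that by (auto simp: splits_def)
  have imgA: "image_of A \<subseteq> A a" and imgB: "image_of B \<subseteq> B a"
    using image_of_subset_if_closed[OF fam(1)] image_of_subset_if_closed[OF fam(2)] sub[OF a_in_verts] closed
    by blast+
  have subk: "VS.subspace (kernel_of A)" "VS.subspace (kernel_of B)"
    using VS.fin_dim_subspace_imp_subspace kernel_of_fin_dim fam by blast+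
  have kernels: "kernel_of A \<inter> kernel_of B = {0}"
  proof -
    have "u = 0" if "u \<in> kernel_of A" "u \<in> kernel_of B" for u
      using arrows_into_disjoint[of A B u] disj that by simp
    then show ?thesis using VS.subspace_0[OF subk(1)] VS.subspace_0[OF subk(2)] by blast
  qed
  have kernel_sum: "kernel_of (space M) = {x + y |x y. x \<in> kernel_of A \<and> y \<in> kernel_of B}"
  proof (intro equalityI subsetI)
    fix u assume u: "u \<in> kernel_of (space M)"
    obtain v w where vw: "v \<in> arrows_into A" "w \<in> arrows_into B" "u = v + w"
      using arrows_into_split[of A B u] sum u by blast
    have vwM: "v \<in> arrows_into (space M)" "w \<in> arrows_into (space M)"
      using vw arrows_into_subset[OF fam(1)] arrows_into_subset[OF fam(2)] by blast+
    have z: "phi Q a M v + phi Q a M w = 0" using phi_add[OF vwM] vw(3) u by simp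
    have vA: "phi Q a M v \<in> A a" and wB: "phi Q a M w \<in> B a" using vw imgA imgB by blast+
    have "phi Q a M v = - phi Q a M w" using z by (simp add: eq_neg_iff_add_eq_0)
    then have "phi Q a M v \<in> B a" using VS.subspace_neg[OF sub(2)[OF a_in_verts] wB] by simp
    then have "phi Q a M v = 0" using vA disj[OF a_in_verts] by blast
    moreover from this have "phi Q a M w = 0" using z by simp
    ultimately show "u \<in> {x + y |x y. x \<in> kernel_of A \<and> y \<in> kernel_of B}" using vw by blast
  next
    fix u assume "u \<in> {x + y |x y. x \<in> kernel_of A \<and> y \<in> kernel_of B}"
    then obtain x y where xy: "u = x + y" "x \<in> kernel_of A" "y \<in> kernel_of B" by blast
    have "x \<in> kernel_of (space M)" "y \<in> kernel_of (space M)"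
      using xy arrows_into_subset[OF fam(1)] arrows_into_subset[OF fam(2)] by blast+
    then show "u \<in> kernel_of (space M)"
      unfolding xy(1)
      using VS.subspace_add[OF VS.fin_dim_subspace_imp_subspace[OF kernel_of_fin_dim[OF subspace_family_space]]]
      by blast
  qed
  show ?thesis
    unfolding splits_def
  proof (intro conjI ballI)
    fix i assume "i \<in> verts (reflect_quiver a Q)"
    then have i: "i \<in> verts Q" by simp
    show "VS.subspace (reflect_space A i)" "VS.subspace (reflect_space B i)"
      using sub[OF i] subk by auto
    show "reflect_space A i \<inter> reflect_space B i = {0}" using disj[OF i] kernels by auto
    show "space (reflect_rep Q a M) i = {x + y |x y. x \<in> reflect_space A i \<and> y \<in> reflect_space B i}"
    proof (cases "i = a")
      case True
      then show ?thesis using kernel_sum by (simp only: reflect_rep_simps True if_True simp_thms)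
    next
      case False
      then show ?thesis using sum[OF i] by (simp add: reflect_rep_simps)
    qed
  next
    fix e assume e: "e \<in> arcs (reflect_quiver a Q)"
    then have closed': "rmap (reflect_rep Q a M) e ` reflect_space X (tail (reflect_quiver a Q) e)
        \<subseteq> reflect_space X (head (reflect_quiver a Q) e)"
      if X: "e \<in> arcs Q \<Longrightarrow> rmap M e ` X (tail Q e) \<subseteq> X (head Q e)" for X
    proof (cases rule: reflect_arc_cases)
      case star
      then show ?thesis by (auto simp: arrow_sum_def simp del: in_in_arcs_conv)
    next
      case other
      then show ?thesis using X by simp
    qed
    show "rmap (reflect_rep Q a M) e ` reflect_space A (tail (reflect_quiver a Q) e)
        \<subseteq> reflect_space A (head (reflect_quiver a Q) e)"
      "rmap (reflect_rep Q a M) e ` reflect_space B (tail (reflect_quiver a Q) e)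
        \<subseteq> reflect_space B (head (reflect_quiver a Q) e)"
      using closed'[of A] closed'[of B] closed by simp_all
  qed
qed

lemma arrows_into_zero:
  assumes "\<And>i. i \<in> verts Q - {a} \<Longrightarrow> P i = {0}"
  shows "arrows_into P = {0}"
proof -
  have "u = 0" if u: "u \<in> arrows_into P" for u
    using arrows_into_disjoint[of P P, OF _ u u] assms by simp
  moreover have "0 \<in> arrows_into P" using assms[OF tail_in_arc] by (simp add: arrow_sum_def del: in_in_arcs_conv)
  ultimately show ?thesis by blast
qed

lemma zero_rep_reflect:
  assumes "\<And>i. i \<in> verts Q - {a} \<Longrightarrow> space M i = {0}"
  shows "zero_rep (reflect_quiver a Q) (reflect_rep Q a M)"
  unfolding zero_rep_def
proof
  fix i assume i: "i \<in> verts (reflect_quiver a Q)"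
  show "space (reflect_rep Q a M) i = {0}"
  proof (cases "i = a")
    case True
    have "kernel_of (space M) = {0}" using arrows_into_zero[of "space M"] assms phi_zero by auto
    then show ?thesis using True by (simp only: reflect_rep_simps)
  next
    case False
    then show ?thesis using assms i by (simp add: reflect_rep_simps)
  qed
qed

text \<open>
  A complement of the image of \<open>\<phi>\<^sub>a\<close> in the space at \<open>a\<close> is a direct summand concentrated at \<open>a\<close>.
\<close>

lemma indec_not_surjective:
  assumes ind: "indec s Q M" and I: "image_of (space M) \<noteq> space M a" and i: "i \<in> verts Q - {a}"
  shows "space M i = {0}"
proof -
  let ?I = "image_of (space M)"
  note fdI = image_of_fin_dim[OF subspace_family_space]
  have subI: "VS.subspace ?I" using fdI VS.fin_dim_subspace_imp_subspace by blast
  obtain C where C: "VS.subspace C" "C \<subseteq> space M a" "C \<inter> ?I = {0}"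
      "space M a = {x + y |x y. x \<in> ?I \<and> y \<in> C}"
    by (rule VS.subspace_complement[OF fin_dim_space[OF a_in_verts] subI fdI(2)])
  \<comment> \<open>The candidate summands: \<open>M\<close> with its space at \<open>a\<close> cut down to the image, and the complement.\<close>
  let ?A = "(space M)(a := ?I)" and ?B = "(\<lambda>_. {0})(a := C)"
  have "splits s Q M ?A ?B"
    unfolding splits_def
  proof (intro conjI ballI)
    fix i assume i: "i \<in> verts Q"
    have sub: "VS.subspace (space M i)" using fin_dim_space[OF i] VS.fin_dim_subspace_imp_subspace by blast
    show "VS.subspace (?A i)" "VS.subspace (?B i)" using sub subI C(1) VS.subspace_single_0 by auto
    show "?A i \<inter> ?B i = {0}" using C(3) VS.subspace_0[OF sub] by auto
    show "space M i = {x + y |x y. x \<in> ?A i \<and> y \<in> ?B i}"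
    proof (cases "i = a")
      case True
      then show ?thesis using C(4) by (simp only: fun_upd_same)
    qed simp
  next
    fix e assume e: "e \<in> arcs Q"
    have t: "tail Q e \<noteq> a" using no_out_arcs[OF e] .
    show "rmap M e ` ?A (tail Q e) \<subseteq> ?A (head Q e)"
    proof (cases "head Q e = a")
      case True
      then have "rmap M e ` space M (tail Q e) \<subseteq> ?I"
        using image_of_subset_iff[OF subspace_family_space subI] e by simp
      then show ?thesis using True t by simp
    next
      case False
      then show ?thesis using t rmap_linear[OF e] by (simp add: linear_between_def)
    qed
    show "rmap M e ` ?B (tail Q e) \<subseteq> ?B (head Q e)"
      using t rmap_zero[OF e] VS.subspace_0[OF C(1)] by simp
  qed
  then have "(\<forall>i\<in>verts Q. ?A i = {0}) \<or> (\<forall>i\<in>verts Q. ?B i = {0})"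
    by (rule ind[unfolded indec_def, THEN conjunct2, rule_format])
  moreover have "?B a \<noteq> {0}"
  proof
    assume "?B a = {0}"
    then have "space M a = ?I" using C(4) by simp
    then show False using I by simp
  qed
  ultimately have "?A i = {0}" using a_in_verts i by blast
  then show ?thesis using i by simp
qed

text \<open>
  A splitting \<open>A\<close>, \<open>B\<close> of the reflection is turned into a splitting of \<open>M\<close> by taking, at \<open>a\<close>, the
  images under \<open>\<phi>\<^sub>a\<close> of the sums over \<open>A\<close> and over \<open>B\<close>.
\<close>

lemma indec_reflect:
  assumes ind: "indec s Q M" and I: "image_of (space M) = space M a"
  shows "indec s (reflect_quiver a Q) (reflect_rep Q a M)"
  unfolding indec_def
proof (intro conjI allI impI)
  let ?Q = "reflect_quiver a Q" and ?M = "reflect_rep Q a M"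
  show "\<not> zero_rep ?Q ?M"
  proof
    assume z: "zero_rep ?Q ?M"
    have M0: "space M i = {0}" if "i \<in> verts Q - {a}" for i
      using z that reflect_rep_simps(2)[of i] by (simp add: zero_rep_def)
    have "image_of (space M) = {0}" using arrows_into_zero[of "space M"] M0 phi_zero by simp
    then have "space M a = {0}" using I by simp
    then have "zero_rep Q M" using M0 by (auto simp: zero_rep_def)
    then show False using ind by (simp add: indec_def)
  qed
  fix A B assume AB: "splits s ?Q ?M A B"
  have sum: "space M i = {x + y |x y. x \<in> A i \<and> y \<in> B i}" and disj: "A i \<inter> B i = {0}"
    and sub: "VS.subspace (A i)" "VS.subspace (B i)" if "i \<in> verts Q - {a}" for i
    using AB that reflect_rep_simps(2)[of i] by (auto simp: splits_def)
  have sub_a: "VS.subspace (A a)" "VS.subspace (B a)"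
    and sum_a: "kernel_of (space M) = {x + y |x y. x \<in> A a \<and> y \<in> B a}"
    using AB a_in_verts reflect_rep_simps(1) by (auto simp: splits_def)
  note subs = splits_subset[OF VS.vector_space_axioms AB]
  have "A i \<subseteq> space M i" "B i \<subseteq> space M i" if "i \<in> verts Q - {a}" for i
    using subs[of i] that reflect_rep_simps(2)[of i] by auto
  then have fam: "subspace_family A" "subspace_family B"
    using sub by (simp_all add: subspace_family_def)
  have star: "component e ` A a \<subseteq> A (tail Q e)" "component e ` B a \<subseteq> B (tail Q e)"
    if e: "e \<in> in_arcs Q a" for e
  proof -
    have eqs: "tail ?Q e = a" "head ?Q e = tail Q e" "rmap ?M e = component e"
      using e reflect_quiver_ends(1)[of e] reflect_rep_simps(3)[OF e] by auto
    have "e \<in> arcs ?Q" using e by simp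
    then have "rmap ?M e ` A (tail ?Q e) \<subseteq> A (head ?Q e) \<and> rmap ?M e ` B (tail ?Q e) \<subseteq> B (head ?Q e)"
      by (rule AB[unfolded splits_def, THEN conjunct2, rule_format])
    then show "component e ` A a \<subseteq> A (tail Q e)" "component e ` B a \<subseteq> B (tail Q e)"
      unfolding eqs by simp_all
  qed
  have "A a \<subseteq> space ?M a" "B a \<subseteq> space ?M a" using subs a_in_verts by simp_all
  then have kA: "A a \<subseteq> kernel_of (space M)" and kB: "B a \<subseteq> kernel_of (space M)"
    unfolding reflect_rep_simps(1) .
  have ker: "A a \<subseteq> kernel_of A" "B a \<subseteq> kernel_of B"
    unfolding subset_kernel_of_iff[OF kA] subset_kernel_of_iff[OF kB] by (intro ballI star; assumption)+
  let ?A = "A(a := image_of A)" and ?B = "B(a := image_of B)"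
  have subimg: "VS.subspace (image_of A)" "VS.subspace (image_of B)"
    using image_of_fin_dim(1) VS.fin_dim_subspace_imp_subspace fam by blast+
  \<comment> \<open>If \<open>x\<close> in the sum over \<open>A\<close> and \<open>y\<close> in the sum over \<open>B\<close> have the same image, then \<open>x - y\<close> is in the
      kernel, so \<open>x - y = p + q\<close> with \<open>p\<close> and \<open>q\<close> in the summands of the kernel; as \<open>x - p = y + q\<close>
      lies in both sums, \<open>x = p\<close> has image zero.\<close>
  have disj_img: "image_of A \<inter> image_of B = {0}"
  proof -
    have "z = 0" if zA: "z \<in> image_of A" and zB: "z \<in> image_of B" for z
    proof -
      obtain x where x: "x \<in> arrows_into A" "z = phi Q a M x" using zA by blast
      obtain y where y: "y \<in> arrows_into B" "z = phi Q a M y" using zB by blast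
      have xM: "x \<in> arrows_into (space M)" and yM: "y \<in> arrows_into (space M)"
        using x y arrows_into_subset[OF fam(1)] arrows_into_subset[OF fam(2)] by blast+
      have subM: "VS.subspace (arrows_into (space M))" and subA: "VS.subspace (arrows_into A)"
        and subB: "VS.subspace (arrows_into B)"
        using fin_dim_arrows_into(1) subspace_family_space fam VS.fin_dim_subspace_imp_subspace by blast+
      have d: "x - y \<in> arrows_into (space M)" using VS.subspace_diff[OF subM xM yM] .
      have "phi Q a M x = phi Q a M (x - y) + phi Q a M y" using phi_add[OF d yM] by simp
      then have "x - y \<in> kernel_of (space M)" using d x y by simp
      then obtain p q where pq: "x - y = p + q" "p \<in> A a" "q \<in> B a" using sum_a by blast
      then have "p \<in> arrows_into A" "q \<in> arrows_into B" and phip: "phi Q a M p = 0" using ker by blast+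
      then have "x - p \<in> arrows_into A" "y + q \<in> arrows_into B"
        using VS.subspace_diff[OF subA] VS.subspace_add[OF subB] x y by auto
      moreover have "x - p = y + q" using pq(1) by (simp add: algebra_simps)
      ultimately have "x - p = 0" using arrows_into_disjoint[of A B "x - p"] disj by simp
      then show "z = 0" using x phip by simp
    qed
    then show ?thesis using VS.subspace_0[OF subimg(1)] VS.subspace_0[OF subimg(2)] by blast
  qed
  have sum_img: "space M a = {x + y |x y. x \<in> image_of A \<and> y \<in> image_of B}"
    unfolding I[symmetric]
  proof (intro equalityI subsetI)
    fix z assume "z \<in> image_of (space M)"
    then obtain u where u: "u \<in> arrows_into (space M)" "z = phi Q a M u" by blast
    obtain v w where vw: "v \<in> arrows_into A" "w \<in> arrows_into B" "u = v + w"
      using arrows_into_split[of A B u] sum u by blast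
    have "v \<in> arrows_into (space M)" "w \<in> arrows_into (space M)"
      using vw arrows_into_subset[OF fam(1)] arrows_into_subset[OF fam(2)] by blast+
    then have "z = phi Q a M v + phi Q a M w" using u vw phi_add by simp
    then show "z \<in> {x + y |x y. x \<in> image_of A \<and> y \<in> image_of B}" using vw by blast
  next
    fix z assume "z \<in> {x + y |x y. x \<in> image_of A \<and> y \<in> image_of B}"
    then obtain x y where xy: "z = x + y" "x \<in> image_of A" "y \<in> image_of B" by blast
    have "x \<in> image_of (space M)" "y \<in> image_of (space M)"
      using xy arrows_into_subset[OF fam(1)] arrows_into_subset[OF fam(2)] by blast+
    then show "z \<in> image_of (space M)"
      unfolding xy(1)
      using VS.subspace_add[OF VS.fin_dim_subspace_imp_subspace[OF image_of_fin_dim(1)[OF subspace_family_space]]]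
      by blast
  qed
  have "splits s Q M ?A ?B"
    unfolding splits_def
  proof (intro conjI ballI)
    fix i assume i: "i \<in> verts Q"
    show "VS.subspace (?A i)" "VS.subspace (?B i)" using sub[of i] subimg i by auto
    show "?A i \<inter> ?B i = {0}" using disj[of i] disj_img i by (cases "i = a") auto
    show "space M i = {x + y |x y. x \<in> ?A i \<and> y \<in> ?B i}"
    proof (cases "i = a")
      case True
      then show ?thesis using sum_img by (simp only: fun_upd_same)
    next
      case False
      then show ?thesis using sum[of i] i by simp
    qed
  next
    fix e assume e: "e \<in> arcs Q"
    have *: "rmap M e ` (X(a := image_of X)) (tail Q e) \<subseteq> (X(a := image_of X)) (head Q e)"
      if X: "subspace_family X" "VS.subspace (image_of X)"
        "e \<notin> in_arcs Q a \<Longrightarrow> rmap M e ` X (tail Q e) \<subseteq> X (head Q e)" for X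
    proof (cases "head Q e = a")
      case True
      then have "rmap M e ` X (tail Q e) \<subseteq> image_of X"
        using image_of_subset_iff[OF X(1,2)] e by simp
      then show ?thesis using True no_out_arcs[OF e] by simp
    next
      case False
      then show ?thesis using X(3) no_out_arcs[OF e] by simp
    qed
    have "rmap M e ` A (tail Q e) \<subseteq> A (head Q e) \<and> rmap M e ` B (tail Q e) \<subseteq> B (head Q e)"
      if ne: "e \<notin> in_arcs Q a"
    proof -
      have h: "head Q e \<noteq> a" using e ne by simp
      have eqs: "tail ?Q e = tail Q e" "head ?Q e = head Q e" "rmap ?M e = rmap M e"
        using reflect_quiver_ends(2)[OF e h] reflect_rep_simps(4)[OF ne] by auto
      have "e \<in> arcs ?Q" using e by simp
      then have "rmap ?M e ` A (tail ?Q e) \<subseteq> A (head ?Q e) \<and> rmap ?M e ` B (tail ?Q e) \<subseteq> B (head ?Q e)"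
        by (rule AB[unfolded splits_def, THEN conjunct2, rule_format])
      then show ?thesis unfolding eqs .
    qed
    then show "rmap M e ` ?A (tail Q e) \<subseteq> ?A (head Q e)" "rmap M e ` ?B (tail Q e) \<subseteq> ?B (head Q e)"
      using *[OF fam(1) subimg(1)] *[OF fam(2) subimg(2)] by blast+
  qed
  then have cases: "(\<forall>i\<in>verts Q. ?A i = {0}) \<or> (\<forall>i\<in>verts Q. ?B i = {0})"
    by (rule ind[unfolded indec_def, THEN conjunct2, rule_format])
  have zero: "X i = {0}" if X: "\<forall>i\<in>verts Q. (X(a := image_of X)) i = {0}" "X a \<subseteq> kernel_of X"
      "VS.subspace (X a)" and i: "i \<in> verts Q" for X i
  proof (cases "i = a")
    case True
    have "X i = {0}" if "i \<in> verts Q - {a}" for i using X(1) that by auto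
    then have "arrows_into X = {0}" by (rule arrows_into_zero)
    then have "X a \<subseteq> {0}" using X(2) by auto
    then show ?thesis using True VS.subspace_0[OF X(3)] by auto
  next
    case False
    then show ?thesis using X(1) i by auto
  qed
  show "(\<forall>i\<in>verts ?Q. A i = {0}) \<or> (\<forall>i\<in>verts ?Q. B i = {0})"
  proof (rule disj_forward[OF cases])
    show "\<forall>i\<in>verts ?Q. A i = {0}" if "\<forall>i\<in>verts Q. ?A i = {0}"
      using zero[OF that ker(1) sub_a(1)] by simp
    show "\<forall>i\<in>verts ?Q. B i = {0}" if "\<forall>i\<in>verts Q. ?B i = {0}"
      using zero[OF that ker(2) sub_a(2)] by simp
  qed
qed

end

section \<open>Dimension vectors of reflected representations\<close>

text \<open>
  The effect of a reflection at \<open>a\<close> on dimension vectors of indecomposables: those concentrated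
  at \<open>a\<close> are killed.
\<close>

definition reflect_dim :: "('a, 'b) pre_digraph \<Rightarrow> 'a \<Rightarrow> ('a \<Rightarrow> int) \<Rightarrow> 'a \<Rightarrow> int" where
  "reflect_dim Q a d = (if \<forall>i\<in>verts Q - {a}. d i = 0 then 0 else sigma Q a d)"

fun reflect_dim_seq :: "('a, 'b) pre_digraph \<Rightarrow> 'a list \<Rightarrow> ('a \<Rightarrow> int) \<Rightarrow> 'a \<Rightarrow> int" where
  "reflect_dim_seq Q [] d = d"
| "reflect_dim_seq Q (a # w) d = reflect_dim_seq (reflect_quiver a Q) w (reflect_dim Q a d)"

lemma dimvec_zero_rep:
  assumes "vector_space s" "zero_rep Q M"
  shows "dimvec s Q M = 0"
  using assms vector_space.dim_zero_space[OF assms(1)] by (simp add: dimvec_def zero_rep_def fun_eq_iff)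

lemma zero_rep_iff_dimvec:
  assumes s: "vector_space s" and M: "quiver_rep s Q M"
  shows "zero_rep Q M \<longleftrightarrow> dimvec s Q M = 0"
proof
  assume d: "dimvec s Q M = 0"
  have "space M i = {0}" if i: "i \<in> verts Q" for i
  proof -
    have "dimvec s Q M i = 0" using d by simp
    then have "vector_space.dim s (space M i) = 0" using i by (simp add: dimvec_def)
    moreover have "fin_dim_subspace s (space M i)" using M i by (simp add: quiver_rep_def)
    ultimately show ?thesis using vector_space.dim_eq_0_iff[OF s] by blast
  qed
  then show "zero_rep Q M" by (simp add: zero_rep_def)
qed (rule dimvec_zero_rep[OF s])

context rep_at_sink
begin

text \<open>
  The zero representation is included so that the statement can be iterated.
\<close>

lemma dimvec_reflect_indec:
  assumes ind: "indec s Q M \<or> zero_rep Q M"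
  defines "Q' \<equiv> reflect_quiver a Q" and "M' \<equiv> reflect_rep Q a M"
  shows "indec s Q' M' \<or> zero_rep Q' M'" and "dimvec s Q' M' = reflect_dim Q a (dimvec s Q M)"
proof -
  have dim0: "(dimvec s Q M i = 0) \<longleftrightarrow> space M i = {0}" if "i \<in> verts Q" for i
    using VS.dim_eq_0_iff[OF fin_dim_space[OF that]] that by (simp add: dimvec_def)
  have supp: "(\<forall>i\<in>verts Q - {a}. dimvec s Q M i = 0) \<longleftrightarrow> (\<forall>i\<in>verts Q - {a}. space M i = {0})"
    using dim0 by simp
  have "(indec s Q' M' \<or> zero_rep Q' M') \<and> dimvec s Q' M' = reflect_dim Q a (dimvec s Q M)"
  proof (cases "\<forall>i\<in>verts Q - {a}. space M i = {0}")
    case True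
    then have "zero_rep Q' M'" unfolding Q'_def M'_def using zero_rep_reflect by blast
    then show ?thesis using dimvec_zero_rep[OF VS.vector_space_axioms] supp True by (simp add: reflect_dim_def)
  next
    case False
    then have ind': "indec s Q M" using ind by (auto simp: zero_rep_def)
    have I: "image_of (space M) = space M a" using indec_not_surjective[OF ind'] False by blast
    have "dimvec s Q' M' = sigma Q a (dimvec s Q M)"
    proof
      fix i
      show "dimvec s Q' M' i = sigma Q a (dimvec s Q M) i"
      proof (cases "i = a")
        case True
        have "(\<Sum>e\<in>in_arcs Q a. dimvec s Q M (tail Q e)) = (\<Sum>e\<in>in_arcs Q a. int (VS.dim (space M (tail Q e))))"
          using tail_in_arc by (intro sum.cong) (auto simp: dimvec_def)
        also have "\<dots> = int (VS.dim (kernel_of (space M)) + VS.dim (space M a))"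
          using dim_kernel_plus_dim_image[OF subspace_family_space] I by (simp flip: of_nat_sum)
        finally show ?thesis
          using True a_in_verts by (simp add: sigma_at dimvec_def Q'_def M'_def reflect_rep_simps(1))
      next
        case False
        then show ?thesis by (simp add: sigma_other dimvec_def Q'_def M'_def reflect_rep_simps(2))
      qed
    qed
    moreover have "indec s Q' M'" unfolding Q'_def M'_def using indec_reflect[OF ind' I] .
    ultimately show ?thesis using False supp by (auto simp: reflect_dim_def)
  qed
  then show "indec s Q' M' \<or> zero_rep Q' M'" "dimvec s Q' M' = reflect_dim Q a (dimvec s Q M)" by auto
qed

end

lemma dimvec_reflect_seq_indec:
  assumes "vector_space s" "fin_digraph Q" "admissible_seq Q w" "quiver_rep (pscale s) Q M"
    and "indec (pscale s) Q M \<or> zero_rep Q M"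
  shows "dimvec (pscale s) Q (reflect_rep_seq Q w M) = reflect_dim_seq Q w (dimvec (pscale s) Q M)"
  using assms
proof (induction w arbitrary: Q M)
  case (Cons a w)
  interpret rep_at_sink s Q a M using Cons.prems by (intro rep_at_sink.intro) auto
  have adm: "admissible_seq (reflect_quiver a Q) w" using Cons.prems by simp
  show ?case
    using Cons.IH[OF Cons.prems(1) fin_digraph_reflect_quiver[OF Cons.prems(2)] adm quiver_rep_reflect_rep
        dimvec_reflect_indec(1)[OF Cons.prems(5)]]
      dimvec_reflect_indec(2)[OF Cons.prems(5)] by simp
qed simp

lemma dimvec_reflect_seq_splits:
  assumes "vector_space s" "fin_digraph Q" "admissible_seq Q w" "quiver_rep (pscale s) Q M"
    and "splits (pscale s) Q M A B"
  shows "dimvec (pscale s) Q (reflect_rep_seq Q w M) =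
    dimvec (pscale s) Q (reflect_rep_seq Q w (M\<lparr>space := A\<rparr>)) +
    dimvec (pscale s) Q (reflect_rep_seq Q w (M\<lparr>space := B\<rparr>))"
  using assms
proof (induction w arbitrary: Q M A B)
  case Nil
  then show ?case
    unfolding reflect_rep_seq.simps by (intro dimvec_splits vector_space_pscale)
next
  case (Cons a w)
  interpret rep_at_sink s Q a M using Cons.prems by (intro rep_at_sink.intro) auto
  have adm: "admissible_seq (reflect_quiver a Q) w" using Cons.prems by simp
  show ?case
    using Cons.IH[OF Cons.prems(1) fin_digraph_reflect_quiver[OF Cons.prems(2)] adm quiver_rep_reflect_rep
        splits_reflect[OF Cons.prems(5)]]
    by (simp add: reflect_rep_space_update)
qed

section \<open>Lists of direct summands\<close>

text \<open>
  Decompositions into several summands, obtained by splitting off one summand at a time, so that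
  statements about two summands can be iterated.
\<close>

fun successive_splits ::
  "('k::field \<Rightarrow> 'v::ab_group_add \<Rightarrow> 'v) \<Rightarrow> ('a, 'b) pre_digraph \<Rightarrow> ('a, 'b, 'v) qrep \<Rightarrow>
   ('a \<Rightarrow> 'v set) list \<Rightarrow> bool" where
  "successive_splits s Q M [] \<longleftrightarrow> zero_rep Q M"
| "successive_splits s Q M (U # Us) \<longleftrightarrow>
     (\<exists>B. splits s Q M U B \<and> successive_splits s Q (M\<lparr>space := B\<rparr>) Us)"

definition decomposes ::
  "('a \<Rightarrow> 'v::ab_group_add set) list \<Rightarrow> 'a \<Rightarrow> 'v \<Rightarrow> 'v list \<Rightarrow> bool" where
  "decomposes Us i x xs \<longleftrightarrow>
     length xs = length Us \<and> (\<forall>l<length Us. xs ! l \<in> (Us ! l) i) \<and> sum_list xs = x"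

lemma decomposes_Cons: "decomposes (U # Us) i x (y # ys) \<longleftrightarrow> y \<in> U i \<and> decomposes Us i (x - y) ys"
  by (auto simp: decomposes_def all_less_Suc_iff algebra_simps)

definition sums_of :: "('a \<Rightarrow> 'v::ab_group_add set) list \<Rightarrow> 'a \<Rightarrow> 'v set" where
  "sums_of Us i = {x. \<exists>xs. decomposes Us i x xs}"

lemma sums_of_Nil: "sums_of [] i = {0}"
  by (auto simp: sums_of_def decomposes_def)

lemma sums_of_Cons: "sums_of (U # Us) i = {x + y |x y. x \<in> U i \<and> y \<in> sums_of Us i}"
proof (intro equalityI subsetI)
  fix z assume "z \<in> sums_of (U # Us) i"
  then obtain xs where xs: "decomposes (U # Us) i z xs" by (auto simp: sums_of_def)
  then obtain x ys where "xs = x # ys" by (cases xs) (auto simp: decomposes_def)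
  then have "x \<in> U i" "decomposes Us i (z - x) ys" using xs by (simp_all add: decomposes_Cons)
  then show "z \<in> {x + y |x y. x \<in> U i \<and> y \<in> sums_of Us i}"
    by (intro CollectI exI[of _ x] exI[of _ "z - x"]) (auto simp: sums_of_def)
next
  fix z assume "z \<in> {x + y |x y. x \<in> U i \<and> y \<in> sums_of Us i}"
  then obtain x y ys where "z = x + y" "x \<in> U i" "decomposes Us i y ys" by (auto simp: sums_of_def)
  then have "decomposes (U # Us) i z (x # ys)" by (simp add: decomposes_Cons)
  then show "z \<in> sums_of (U # Us) i" by (auto simp: sums_of_def)
qed

lemma subspace_sums_of:
  assumes s: "vector_space s" and Us: "\<And>U. U \<in> set Us \<Longrightarrow> module.subspace s (U i)"
  shows "module.subspace s (sums_of Us i)"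
  using Us
proof (induction Us)
  case Nil
  interpret vector_space s by fact
  show ?case by (simp add: sums_of_Nil)
next
  case (Cons U Us)
  interpret vector_space s by fact
  show ?case unfolding sums_of_Cons using Cons by (intro subspace_sums) auto
qed

lemma sums_of_closed:
  assumes s: "vector_space s" and Q: "wf_digraph Q" and M: "quiver_rep s Q M" and e: "e \<in> arcs Q"
    and Us: "\<And>U. U \<in> set Us \<Longrightarrow> subrep s Q M U"
  shows "sums_of Us (tail Q e) \<subseteq> space M (tail Q e) \<and>
    rmap M e ` sums_of Us (tail Q e) \<subseteq> sums_of Us (head Q e)"
  using Us
proof (induction Us)
  case Nil
  interpret vector_space s by fact
  interpret wf_digraph Q by fact
  have lin: "linear_between s s (space M (tail Q e)) (space M (head Q e)) (rmap M e)"
    using M e by (simp add: quiver_rep_def)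
  have sub: "subspace (space M (tail Q e))"
    using M e fin_dim_subspace_imp_subspace by (auto simp: quiver_rep_def)
  then show ?case
    using linear_between_zero[OF s s lin] subspace_0 by (simp add: sums_of_Nil)
next
  case (Cons U Us)
  interpret vector_space s by fact
  interpret wf_digraph Q by fact
  have lin: "linear_between s s (space M (tail Q e)) (space M (head Q e)) (rmap M e)"
    using M e by (simp add: quiver_rep_def)
  have sub: "subspace (space M (tail Q e))"
    using M e fin_dim_subspace_imp_subspace by (auto simp: quiver_rep_def)
  have "subrep s Q M U" using Cons.prems by simp
  then have U: "U (tail Q e) \<subseteq> space M (tail Q e)" "rmap M e ` U (tail Q e) \<subseteq> U (head Q e)"
    using e by (simp_all add: subrep_def)
  have IH: "sums_of Us (tail Q e) \<subseteq> space M (tail Q e)"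
      "rmap M e ` sums_of Us (tail Q e) \<subseteq> sums_of Us (head Q e)"
    using Cons by auto
  have in_M: "x + y \<in> space M (tail Q e)" and
    img: "rmap M e (x + y) = rmap M e x + rmap M e y \<and> rmap M e x \<in> U (head Q e) \<and> rmap M e y \<in> sums_of Us (head Q e)"
    if xy: "x \<in> U (tail Q e)" "y \<in> sums_of Us (tail Q e)" for x y
  proof -
    have m: "x \<in> space M (tail Q e)" "y \<in> space M (tail Q e)" using xy U(1) IH(1) by auto
    then show "x + y \<in> space M (tail Q e)" using subspace_add[OF sub] by blast
    have "rmap M e (x + y) = rmap M e x + rmap M e y" using m lin by (simp add: linear_between_def)
    then show "rmap M e (x + y) = rmap M e x + rmap M e y \<and> rmap M e x \<in> U (head Q e) \<and> rmap M e y \<in> sums_of Us (head Q e)"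
      using xy U(2) IH(2) by blast
  qed
  show ?case unfolding sums_of_Cons using in_M img by blast
qed

lemma sum_list_replicate_zero: "sum_list (replicate n (0 :: 'v::monoid_add)) = 0"
  by (induction n) auto

lemma sum_list_single_entry:
  "k < n \<Longrightarrow> sum_list ((replicate n (0 :: 'v::monoid_add))[k := x]) = x"
  by (induction n arbitrary: k) (auto simp: sum_list_replicate_zero split: nat.split)

lemma ex1_unique: "\<exists>!x. P x \<Longrightarrow> P a \<Longrightarrow> P b \<Longrightarrow> a = b"
  by blast

lemma internal_direct_sum_imp_successive_splits:
  fixes s :: "'k::field \<Rightarrow> 'v::ab_group_add \<Rightarrow> 'v" and M :: "('a, 'b, 'v) qrep"
  assumes s: "vector_space s" and Q: "wf_digraph Q"
  shows "quiver_rep s Q M \<Longrightarrow> internal_direct_sum s Q M Us \<Longrightarrow> successive_splits s Q M Us"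
proof (induction Us arbitrary: M)
  case Nil
  interpret vector_space s by fact
  have "space M i = {0}" if i: "i \<in> verts Q" for i
  proof -
    have "subspace (space M i)" using Nil(1) i fin_dim_subspace_imp_subspace by (simp add: quiver_rep_def)
    moreover have "x = 0" if "x \<in> space M i" for x
    proof -
      have "\<exists>!xs. length xs = length ([] :: ('a \<Rightarrow> 'v set) list) \<and>
          (\<forall>l<length ([] :: ('a \<Rightarrow> 'v set) list). xs ! l \<in> ([] ! l) i) \<and> sum_list xs = x"
        using Nil(2) i that unfolding internal_direct_sum_def by blast
      from ex1_implies_ex[OF this] show "x = 0" by auto
    qed
    ultimately show ?thesis using subspace_0 by blast
  qed
  then show ?case by (simp add: zero_rep_def)
next
  case (Cons U Us)
  interpret vector_space s by fact
  interpret wf_digraph Q by fact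
  let ?B = "sums_of Us"
  have sub: "subrep s Q M V" if "V \<in> set (U # Us)" for V
    using Cons.prems(2) that unfolding internal_direct_sum_def by blast
  have unique: "\<exists>!xs. decomposes (U # Us) i x xs" if "i \<in> verts Q" "x \<in> space M i" for i x
    using Cons.prems(2) that unfolding internal_direct_sum_def decomposes_def by blast
  have Ui: "subspace (U i)" "U i \<subseteq> space M i" and Bi: "subspace (?B i)"
    and Vi: "\<And>V. V \<in> set Us \<Longrightarrow> subspace (V i)" "\<And>V. V \<in> set Us \<Longrightarrow> V i \<subseteq> space M i" if i: "i \<in> verts Q" for i
  proof -
    show "subspace (U i)" "U i \<subseteq> space M i" using sub[of U] i by (auto simp: subrep_def)
    show V: "\<And>V. V \<in> set Us \<Longrightarrow> subspace (V i)" "\<And>V. V \<in> set Us \<Longrightarrow> V i \<subseteq> space M i"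
      using sub i by (auto simp: subrep_def)
    show "subspace (?B i)" using subspace_sums_of[OF s V(1)] .
  qed
  have subM: "subspace (space M i)" if "i \<in> verts Q" for i
    using Cons.prems(1) that fin_dim_subspace_imp_subspace by (simp add: quiver_rep_def)
  have sums_in: "sums_of Vs i \<subseteq> space M i" if i: "i \<in> verts Q" and "\<And>V. V \<in> set Vs \<Longrightarrow> V i \<subseteq> space M i" for Vs i
    using that(2)
  proof (induction Vs)
    case Nil
    then show ?case using subspace_0[OF subM[OF i]] by (simp add: sums_of_Nil)
  next
    case (Cons V Vs)
    have "x + y \<in> space M i" if "x \<in> V i" "y \<in> sums_of Vs i" for x y
    proof -
      have "x \<in> space M i" "y \<in> space M i" using Cons that by auto
      then show ?thesis using subspace_add[OF subM[OF i]] by blast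
    qed
    then show ?case unfolding sums_of_Cons by blast
  qed
  have B_sub: "?B i \<subseteq> space M i" if i: "i \<in> verts Q" for i
    using sums_in[OF i, of Us] Vi(2)[OF i] by blast
  have AB: "splits s Q M U ?B"
    unfolding splits_def
  proof (intro conjI ballI)
    fix i assume i: "i \<in> verts Q"
    show "subspace (U i)" "subspace (?B i)" using Ui(1)[OF i] Bi[OF i] .
    show "space M i = {x + y |x y. x \<in> U i \<and> y \<in> ?B i}"
      unfolding sums_of_Cons[symmetric]
    proof (intro equalityI subsetI)
      fix x assume "x \<in> space M i"
      from ex1_implies_ex[OF unique[OF i this]] show "x \<in> sums_of (U # Us) i" by (auto simp: sums_of_def)
    next
      fix x assume "x \<in> sums_of (U # Us) i"
      then show "x \<in> space M i"
        using sums_in[OF i, of "U # Us"] Ui(2)[OF i] Vi(2)[OF i] by auto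
    qed
    show "U i \<inter> ?B i = {0}"
    proof -
      have "x = 0" if xU: "x \<in> U i" and xB: "x \<in> ?B i" for x
      proof -
        obtain ys where ys: "decomposes Us i x ys" using xB by (auto simp: sums_of_def)
        let ?z = "replicate (length Us) (0 :: 'v)"
        have 1: "decomposes (U # Us) i x (0 # ys)"
          using ys subspace_0[OF Ui(1)[OF i]] by (simp add: decomposes_Cons)
        have 2: "decomposes (U # Us) i x (x # ?z)"
          using xU subspace_0[OF Vi(1)[OF i]] by (simp add: decomposes_Cons) (simp add: decomposes_def sum_list_replicate_zero)
        have "x \<in> space M i" using xU Ui(2)[OF i] by blast
        have "0 # ys = x # ?z" by (rule ex1_unique[OF unique[OF i \<open>x \<in> space M i\<close>] 1 2])
        then show "x = 0" by simp
      qed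
      then show ?thesis using subspace_0[OF Ui(1)[OF i]] subspace_0[OF Bi[OF i]] by blast
    qed
  next
    fix e assume e: "e \<in> arcs Q"
    show "rmap M e ` U (tail Q e) \<subseteq> U (head Q e)" using sub[of U] e by (simp add: subrep_def)
    have "subrep s Q M V" if "V \<in> set Us" for V using sub that by simp
    then show "rmap M e ` ?B (tail Q e) \<subseteq> ?B (head Q e)"
      using sums_of_closed[OF s Q Cons.prems(1) e] by blast
  qed
  have "internal_direct_sum s Q (M\<lparr>space := ?B\<rparr>) Us"
    unfolding internal_direct_sum_def
  proof (intro conjI ballI)
    fix V assume V: "V \<in> set Us"
    have "V i \<subseteq> ?B i" if i: "i \<in> verts Q" for i
    proof
      fix x assume x: "x \<in> V i"
      obtain k where k: "k < length Us" "Us ! k = V" using V by (auto simp: in_set_conv_nth)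
      let ?xs = "(replicate (length Us) (0 :: 'v))[k := x]"
      have "sum_list ?xs = x"
        using k(1) by (rule sum_list_single_entry)
      moreover have "\<forall>l<length Us. ?xs ! l \<in> (Us ! l) i"
        using k x subspace_0[OF Vi(1)[OF i]] by (auto simp: nth_list_update)
      ultimately show "x \<in> ?B i"
        unfolding sums_of_def decomposes_def by (intro CollectI exI[of _ ?xs]) auto
    qed
    then show "subrep s Q (M\<lparr>space := ?B\<rparr>) V" using sub[of V] V by (simp add: subrep_def)
  next
    fix i x assume i: "i \<in> verts Q" and "x \<in> space (M\<lparr>space := ?B\<rparr>) i"
    then have xB: "x \<in> ?B i" by simp
    then obtain ys where ys: "decomposes Us i x ys" by (auto simp: sums_of_def)
    show "\<exists>!xs. length xs = length Us \<and> (\<forall>l<length Us. xs ! l \<in> (Us ! l) i) \<and> sum_list xs = x"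
      unfolding decomposes_def[symmetric]
    proof (rule ex1I[of _ ys], rule ys)
      fix zs assume zs: "decomposes Us i x zs"
      have 1: "decomposes (U # Us) i x (0 # xs)" if "decomposes Us i x xs" for xs
        using that subspace_0[OF Ui(1)[OF i]] by (simp add: decomposes_Cons)
      have "x \<in> space M i" using xB B_sub[OF i] by blast
      have "0 # zs = 0 # ys" by (rule ex1_unique[OF unique[OF i \<open>x \<in> space M i\<close>] 1[OF zs] 1[OF ys]])
      then show "zs = ys" by simp
    qed
  qed
  then have "successive_splits s Q (M\<lparr>space := ?B\<rparr>) Us"
    using Cons.IH quiver_rep_splits(2)[OF s Q Cons.prems(1) AB] by blast
  then show ?case using AB by auto
qed

lemma lift_rep_space_update:
  "lift_rep (M\<lparr>space := A\<rparr>) = (lift_rep M)\<lparr>space := \<lambda>i. at_Nil ` A i\<rparr>"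
  by (simp add: lift_rep_def)

lemma dimvec_reflect_seq_successive_splits:
  assumes s: "vector_space s" and Q: "fin_digraph Q" and w: "admissible_seq Q w"
  shows "quiver_rep s Q M \<Longrightarrow> successive_splits s Q M Us \<Longrightarrow>
    dimvec (pscale s) Q (reflect_rep_seq Q w (lift_rep M)) =
      (\<Sum>U\<leftarrow>Us. dimvec (pscale s) Q (reflect_rep_seq Q w (lift_rep (M\<lparr>space := U\<rparr>))))"
proof (induction Us arbitrary: M)
  have wf: "wf_digraph Q" using Q by (rule fin_digraph.axioms(1))
  {
    case Nil
    then have z: "zero_rep Q (lift_rep M)" by (auto simp: zero_rep_def lift_rep_def)
    have "reflect_dim_seq Q w 0 = 0"
      by (induction w arbitrary: Q) (simp_all add: reflect_dim_def)
    then show ?case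
      using dimvec_reflect_seq_indec[OF s Q w quiver_rep_lift_rep[OF s wf Nil(1)]] z
        dimvec_zero_rep[OF vector_space_pscale[OF s] z] by simp
  next
    case (Cons U Us)
    then obtain B where B: "splits s Q M U B" "successive_splits s Q (M\<lparr>space := B\<rparr>) Us" by auto
    have f: "rep_iso_by s (pscale s) Q M (lift_rep M) (\<lambda>_. at_Nil)"
      using s by (auto simp: rep_iso_by_def lift_rep_def linear_at_Nil bij_betw_def inj_on_def)
    have "splits (pscale s) Q (lift_rep M) (\<lambda>i. at_Nil ` U i) (\<lambda>i. at_Nil ` B i)"
      using splits_image[OF s vector_space_pscale[OF s] wf Cons.prems(1) f B(1)] .
    then have "dimvec (pscale s) Q (reflect_rep_seq Q w (lift_rep M)) =
        dimvec (pscale s) Q (reflect_rep_seq Q w (lift_rep (M\<lparr>space := U\<rparr>))) +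
        dimvec (pscale s) Q (reflect_rep_seq Q w (lift_rep (M\<lparr>space := B\<rparr>)))"
      unfolding lift_rep_space_update
      by (rule dimvec_reflect_seq_splits[OF s Q w quiver_rep_lift_rep[OF s wf Cons.prems(1)]])
    then show ?case
      using Cons.IH[OF quiver_rep_splits(2)[OF s wf Cons.prems(1) B(1)] B(2)] by simp
  }
qed

text \<open>
  The right-hand side depends on the multiset of dimension vectors of the summands only, and not
  on the field.
\<close>

theorem dimvec_reflect_seq_preprojective:
  assumes s: "vector_space s" and Q: "fin_digraph Q" and w: "admissible_seq Q w"
    and M: "quiver_rep s Q M" and Us: "preprojective_decomp s Q as M Us"
  shows "dimvec (pscale s) Q (reflect_rep_seq Q w (lift_rep M)) =
    (\<Sum>d\<in>#image_mset (\<lambda>U. dimvec s Q (M\<lparr>space := U\<rparr>)) (mset Us). reflect_dim_seq Q w d)"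
proof -
  have wf: "wf_digraph Q" using Q by (rule fin_digraph.axioms(1))
  note ps = vector_space_pscale[OF s]
  have "dimvec (pscale s) Q (reflect_rep_seq Q w (lift_rep M)) =
      (\<Sum>U\<leftarrow>Us. dimvec (pscale s) Q (reflect_rep_seq Q w (lift_rep (M\<lparr>space := U\<rparr>))))"
    using Us dimvec_reflect_seq_successive_splits[OF s Q w M]
      internal_direct_sum_imp_successive_splits[OF s wf M] by (simp add: preprojective_decomp_def)
  also have "\<dots> = (\<Sum>U\<leftarrow>Us. reflect_dim_seq Q w (dimvec s Q (M\<lparr>space := U\<rparr>)))"
  proof (intro arg_cong[of _ _ sum_list] map_cong refl)
    fix U assume "U \<in> set Us"
    then have ind: "indecomposable s Q (M\<lparr>space := U\<rparr>)"
      using Us by (simp add: preprojective_decomp_def indec_preprojective_def)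
    then have rep: "quiver_rep s Q (M\<lparr>space := U\<rparr>)" by (simp add: indecomposable_def)
    note rep' = quiver_rep_lift_rep[OF s wf rep] and iso = rep_iso_lift_rep[OF s]
    have "indec (pscale s) Q (lift_rep (M\<lparr>space := U\<rparr>))"
      using indec_rep_iso[OF s ps wf rep rep' iso indecomposable_imp_indec[OF s wf ind]] .
    then have "dimvec (pscale s) Q (reflect_rep_seq Q w (lift_rep (M\<lparr>space := U\<rparr>))) =
        reflect_dim_seq Q w (dimvec (pscale s) Q (lift_rep (M\<lparr>space := U\<rparr>)))"
      using dimvec_reflect_seq_indec[OF s Q w rep'] by blast
    also have "dimvec (pscale s) Q (lift_rep (M\<lparr>space := U\<rparr>)) = dimvec s Q (M\<lparr>space := U\<rparr>)"
      using dimvec_rep_iso[OF s ps rep] rep_iso_lift_rep[OF s] unfolding rep_iso_iff by blast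
    finally show "dimvec (pscale s) Q (reflect_rep_seq Q w (lift_rep (M\<lparr>space := U\<rparr>))) =
        reflect_dim_seq Q w (dimvec s Q (M\<lparr>space := U\<rparr>))" .
  qed
  also have "\<dots> = (\<Sum>d\<in>#image_mset (\<lambda>U. dimvec s Q (M\<lparr>space := U\<rparr>)) (mset Us). reflect_dim_seq Q w d)"
    by (simp add: sum_mset_sum_list[symmetric] multiset.map_comp comp_def)
  finally show ?thesis .
qed

section \<open>Independence of the field\<close>

text \<open>
  The reflections of \<open>M\<close> and \<open>M'\<close> have equal dimension vectors.  So the criterion is the same for
  both; it applies to \<open>M'\<close> because the vanishing of the iterated reflection is visible on its
  dimension vector.
\<close>

lemma same_multiplicities_same_criterion:
  fixes s :: "'k::field \<Rightarrow> 'v::ab_group_add \<Rightarrow> 'v" and s' :: "'l::field \<Rightarrow> 'w::ab_group_add \<Rightarrow> 'w"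
  assumes s: "vector_space s" and s': "vector_space s'" and Q: "fin_digraph Q"
    and as: "admissible_ordering Q as"
    and M: "quiver_rep s Q M" and M': "quiver_rep s' Q M'"
    and same: "same_multiplicities Q as s M s' M'" and zero: "cox_vanishes Q as r M"
  shows "Fl s Q ds M \<noteq> {} \<longleftrightarrow> Fl s' Q ds M' \<noteq> {}"
proof -
  have wf: "wf_digraph Q" using Q by (rule fin_digraph.axioms(1))
  let ?w = "concat (replicate r as)"
  note cox = iterated_coxeter[OF wf as, where r = r]
  have dims: "dimvec (pscale s) Q (reflect_rep_seq Q w (lift_rep M)) =
      dimvec (pscale s') Q (reflect_rep_seq Q w (lift_rep M'))" if w: "admissible_seq Q w" for w
  proof -
    obtain Us Ws where "preprojective_decomp s Q as M Us" "preprojective_decomp s' Q as M' Ws"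
      and eq: "image_mset (\<lambda>U. dimvec s Q (M\<lparr>space := U\<rparr>)) (mset Us) =
        image_mset (\<lambda>W. dimvec s' Q (M'\<lparr>space := W\<rparr>)) (mset Ws)"
      using same unfolding same_multiplicities_def by blast
    note preprojective = dimvec_reflect_seq_preprojective[OF s Q w M this(1)]
      dimvec_reflect_seq_preprojective[OF s' Q w M' this(2)]
    show ?thesis unfolding preprojective eq ..
  qed
  have rep: "quiver_rep (pscale s') (fold reflect_quiver ?w Q) (reflect_rep_seq Q ?w (lift_rep M'))"
    using quiver_rep_reflect_seq[OF s' Q cox(3) quiver_rep_lift_rep[OF s' wf M']] .
  have zero_eq: "zero_rep (fold reflect_quiver ?w Q) N \<longleftrightarrow> zero_rep Q N" for N :: "('a, 'b, 'b list \<Rightarrow> 'w) qrep"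
    by (simp add: zero_rep_def)
  have dim_eq: "dimvec t (fold reflect_quiver ?w Q) N = dimvec t Q N"
    for t :: "'l \<Rightarrow> ('b list \<Rightarrow> 'w) \<Rightarrow> 'b list \<Rightarrow> 'w" and N :: "('a, 'b, 'b list \<Rightarrow> 'w) qrep"
    by (simp add: dimvec_def)
  have "zero_rep Q (reflect_rep_seq Q ?w (lift_rep M))" using zero by (simp add: cox_vanishes_def cox(1))
  then have "dimvec (pscale s) Q (reflect_rep_seq Q ?w (lift_rep M)) = 0"
    using dimvec_zero_rep[OF vector_space_pscale[OF s]] by blast
  then have "zero_rep Q (reflect_rep_seq Q ?w (lift_rep M'))"
    using zero_rep_iff_dimvec[OF vector_space_pscale[OF s'] rep] dims[OF cox(3)]
    unfolding zero_eq dim_eq by simp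
  then have zero': "cox_vanishes Q as r M'" by (simp add: cox_vanishes_def cox(1))
  have prefix: "admissible_seq Q (take p ?w)" for p
    using cox(3) reflect_seq_append(3)[of Q "take p ?w" "drop p ?w"] by simp
  show ?thesis
    unfolding Fl_nonempty_iff(1)[OF s Q as M zero] Fl_nonempty_iff(1)[OF s' Q as M' zero'] dims[OF prefix] ..
qed

theorem corollary6p7:
  fixes s :: "'k::field \<Rightarrow> 'v::ab_group_add \<Rightarrow> 'v"
    and t :: "'k \<Rightarrow> 'u::ab_group_add \<Rightarrow> 'u"
    and s' :: "'l::field \<Rightarrow> 'w::ab_group_add \<Rightarrow> 'w"
    and Q :: "('a, 'b) pre_digraph"
    and M :: "('a, 'b, 'v) qrep"
    and N :: "('a, 'b, 'u) qrep"
    and M' :: "('a, 'b, 'w) qrep"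
    and as :: "'a list" and ds :: "('a \<Rightarrow> int) list" and r :: nat
  assumes "vector_space s"
    and "fin_digraph Q" and "\<not> (\<exists>p. pre_digraph.cycle Q p)"
    and "admissible_ordering Q as"
    and "preprojective s Q as M"
    and "is_filtration Q ds (dimvec s Q M)"
    and "cox_vanishes Q as r M"
  shows
    "(Fl s Q ds M \<noteq> {} \<longleftrightarrow>
        zero_filt Q ((reflect_filt_seq Q as ^^ r) ds) \<and>
        (\<forall>p \<le> r * length as.
           let w = take p (concat (replicate r as)) in
           is_filtration Q (reflect_filt_seq Q w ds)
             (dimvec (pscale s) Q (reflect_rep_seq Q w (lift_rep M)))))
     \<and> (vector_space t \<and> quiver_rep t Q N \<and> rep_iso s t Q M N \<longrightarrow>
          (Fl s Q ds M \<noteq> {} \<longleftrightarrow> Fl t Q ds N \<noteq> {}))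
     \<and> (vector_space s' \<and> preprojective s' Q as M' \<and> same_multiplicities Q as s M s' M' \<longrightarrow>
          (Fl s Q ds M \<noteq> {} \<longleftrightarrow> Fl s' Q ds M' \<noteq> {}))
     \<and> (finite (UNIV :: 'k set) \<and> Fl s Q ds M \<noteq> {} \<longrightarrow>
          [card (Fl s Q ds M) = 1] (mod card (UNIV :: 'k set)))"
proof (intro conjI impI)
  have wf: "wf_digraph Q" using assms(2) by (rule fin_digraph.axioms(1))
  have M: "quiver_rep s Q M" using assms(5) by (simp add: preprojective_def)
  note criterion = Fl_nonempty_iff[OF assms(1,2,4) M assms(7)]
  show "Fl s Q ds M \<noteq> {} \<longleftrightarrow>
        zero_filt Q ((reflect_filt_seq Q as ^^ r) ds) \<and>
        (\<forall>p \<le> r * length as.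
           let w = take p (concat (replicate r as)) in
           is_filtration Q (reflect_filt_seq Q w ds)
             (dimvec (pscale s) Q (reflect_rep_seq Q w (lift_rep M))))"
    unfolding Let_def by (rule criterion(1))
  show "Fl s Q ds M \<noteq> {} \<longleftrightarrow> Fl t Q ds N \<noteq> {}"
    if N: "vector_space t \<and> quiver_rep t Q N \<and> rep_iso s t Q M N"
  proof -
    obtain h where h: "bij_betw h (Fl s Q ds M) (Fl t Q ds N)"
      using Fl_rep_iso[OF assms(1) _ wf M, of t N ds] N by blast
    show ?thesis
      unfolding bij_betw_imp_surj_on[OF h, symmetric] by (simp only: image_is_empty)
  qed
  show "Fl s Q ds M \<noteq> {} \<longleftrightarrow> Fl s' Q ds M' \<noteq> {}"
    if M': "vector_space s' \<and> preprojective s' Q as M' \<and> same_multiplicities Q as s M s' M'"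
  proof (rule same_multiplicities_same_criterion[OF assms(1) _ assms(2,4) M _ _ assms(7)])
    show "vector_space s'" "quiver_rep s' Q M'" "same_multiplicities Q as s M s' M'"
      using M' by (simp_all add: preprojective_def)
  qed
  show "[card (Fl s Q ds M) = 1] (mod card (UNIV :: 'k set))"
    if "finite (UNIV :: 'k set) \<and> Fl s Q ds M \<noteq> {}"
    using criterion(2) that by blast
qed

end
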